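(* Let $\sigma=\sigma_0>0$ be known. Let the predictors $\mathbf X_1,\dots,\mathbf X_n$ be i.i.d. from a distribution $G$ on $[0,1]^d$ with Lebesgue density bounded and bounded away from zero, let the regression errors be sub-Gaussian with mean zero and variance $\sigma_0^2$, and let the prior be as in the context, with $J$ given a prior $\pi$ on the positive integers satisfying $$\exp\{-b_2J^d\log J\}\le\pi(J)\le\exp\{-b_1J^d\log J\},\qquad J\ge2,$$ for some constants $b_1,b_2>0$. Let $\rho$ be the Hellinger metric on the density of $(\mathbf X,Y)$ induced on the regression function, that is, $$\rho^2(f_1,f_2)=2\Big\{1-\int\exp\Big[-\frac{(f_1(\mathbf x)-f_2(\mathbf x))^2}{8\sigma^2}\Big]dG(\mathbf x)\Big\}.$$ For a predetermined $\gamma\in(0,1)$ and a sufficiently large constant $M_0>0$, consider the test $$\phi_n=\mathbf 1\big\{\Pi\big(\rho(f,\mathcal M_J)\le M_0\sqrt{(J^d\log n)/n}\,\big|\,\mathbb D_n\big)<\gamma\big\}.$$ Assume that $f_0$ is bounded. Then: (i) for any fixed $f_0\in\mathcal M$, $\mathrm E_0\phi_n\to0$; (ii) for any fixed $f_0$ integrable on $[0,1]^d$ with $f_0\notin\overline{\mathcal M}$, $\mathrm E_0(1-\phi_n)\to0$, where $\overline{\mathcal M}$ is the $\mathbb L_1(G)$-closure of $\mathcal M$; (iii) for alternatives in the Hölder class $\mathcal H(\alpha,L)$, $0<\alpha\le1$, $L>0$, we have for a sufficiently large constant $C>0$, $$\sup\{\mathrm E_0(1-\phi_n): f_0\in\mathcal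 H(\alpha,L),\ \rho(f_0,\mathcal M)>C(n/\log n)^{-\alpha/(2\alpha+d)}\}\to0.$$
   Context: Fix $d\ge1$. For $\mathbf x,\mathbf y\in\mathbb R^d$ write $\mathbf x\preceq\mathbf y$ if $x_k\le y_k$ for all $k$. $\mathcal M$ is the set of functions $f:[0,1]^d\to\mathbb R$ with $f(\mathbf x)\le f(\mathbf y)$ whenever $\mathbf x\preceq\mathbf y$. For a set $\mathcal A$ of functions, $\rho(f,\mathcal A)=\inf\{\rho(f,h):h\in\mathcal A\}$. Partition. For a positive integer $J$ and $\mathbf j\in\{1,\dots,J\}^d$, $I_{\mathbf j}$ is the product over $k=1,\dots,d$ of the intervals $((j_k-1)/J,\,j_k/J]$, where the interval is taken closed at $0$ when $j_k=1$. $\mathcal F_J=\{\sum_{\mathbf j}\theta_{\mathbf j}\mathbf 1_{I_{\mathbf j}}:\theta_{\mathbf j}\in\mathbb R\}$ and $\mathcal M_J=\mathcal F_J\cap\mathcal M$. Data. $\mathbb D_n=\{(\mathbf X_i,Y_i)\}_{i=1}^n$ with $Y_i=f_0(\mathbf X_i)+\varepsilon_i$, where $\varepsilon_i$ are i.i.d. (not necessarily normal), independent of the predictors. $\mathrm E_0$ is expectation under this true distribution with regression function $f_0$. Prior and posterior. Under the working model $\varepsilon_i\sim N(0,\sigma^2)$, the prior is: $J\sim\pi$ and, given $J$, $f=\sum_{\mathbf j\in\{1,\dots,J\}^d}\theta_{\mathbf j}\mathbf 1_{I_{\mathbf j}}$ with $\theta_{\mathbf j}\sim N(\zeta_{\mathbf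 j},\sigma^2\lambda_{\mathbf j}^2)$ independently, where $|\zeta_{\mathbf j}|$ is bounded and $\lambda_{\mathbf j}^2$ is bounded away from $0$ and $\infty$, uniformly in $\mathbf j$ and $J$ (and $n$). $\Pi(\cdot\mid\mathbb D_n)$ is the resulting joint posterior of $(J,f)$ computed from the Gaussian working likelihood $\prod_i(\sqrt{2\pi}\sigma)^{-1}\exp[-(Y_i-f(\mathbf X_i))^2/(2\sigma^2)]$; in the definition of $\phi_n$, $J$ is random under this posterior together with $f$. The shape restriction is not imposed on the prior. The Hellinger metric refers to the density $p_{f,\sigma}(\mathbf x,y)=(\sigma\sqrt{2\pi})^{-1}\exp[-(y-f(\mathbf x))^2/(2\sigma^2)]$ with respect to the product of $G$ and Lebesgue measure. Hölder class. For $0<\alpha\le1$, $\mathcal H(\alpha,L)$ is the set of $f:[0,1]^d\to\mathbb R$ with $\sup_{\mathbf x}|f(\mathbf x)|+\sup_{\mathbf x\ne\mathbf y}|f(\mathbf x)-f(\mathbf y)|/\|\mathbf x-\mathbf y\|^\alpha\le L$. *)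

theory Defs
  imports "HOL-Probability.Probability"
begin

text \<open>
  Functions on the unit cube \<open>[0,1]\<^sup>d\<close>, \<open>d = CARD('d)\<close>, are represented by total functions
  on \<open>real ^ 'd\<close> of which only the values on \<open>cbox 0 1\<close> matter. The order on \<open>real ^ 'd\<close>
  is the coordinatewise one.
\<close>

definition mono_fns :: "(real ^ 'd \<Rightarrow> real) set" where
  "mono_fns = {f. mono_on (cbox 0 1) f}"

definition grid :: "nat \<Rightarrow> (nat ^ 'd) set" where
  "grid J = {j. \<forall>k. 1 \<le> j $ k \<and> j $ k \<le> J}"

definition cell :: "nat \<Rightarrow> nat ^ 'd \<Rightarrow> (real ^ 'd) set" where
  "cell J j = {x. \<forall>k. x $ k \<in>
     (if j $ k = 1 then {0 .. 1 / real J}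
      else {(real (j $ k) - 1) / real J <.. real (j $ k) / real J})}"

definition step_fn :: "nat \<Rightarrow> (nat ^ 'd \<Rightarrow> real) \<Rightarrow> real ^ 'd \<Rightarrow> real" where
  "step_fn J \<theta> = (\<lambda>x. \<Sum>j\<in>grid J. \<theta> j * indicator (cell J j) x)"

definition step_fns :: "nat \<Rightarrow> (real ^ 'd \<Rightarrow> real) set" where
  "step_fns J = range (step_fn J)"

definition mono_step_fns :: "nat \<Rightarrow> (real ^ 'd \<Rightarrow> real) set" where
  "mono_step_fns J = step_fns J \<inter> mono_fns"

definition holder_class :: "real \<Rightarrow> real \<Rightarrow> (real ^ 'd \<Rightarrow> real) set" where
  "holder_class \<alpha> L = {f.
     (SUP x\<in>cbox 0 1. ereal \<bar>f x\<bar>)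
     + (SUP (x, y)\<in>{(x, y). x \<in> cbox 0 1 \<and> y \<in> cbox 0 1 \<and> x \<noteq> y}.
          ereal (\<bar>f x - f y\<bar> / norm (x - y) powr \<alpha>)) \<le> ereal L}"

text \<open>
  The Hellinger distance between the joint densities of \<open>(X, Y)\<close> with respect to the product of
  \<open>G\<close> and Lebesgue measure, when \<open>X\<close> has law \<open>G\<close> and \<open>Y\<close> given \<open>X = x\<close> is \<open>N(f x, \<sigma>\<^sup>2)\<close>
  for \<open>f = f1\<close> and \<open>f = f2\<close>.
\<close>

definition hellinger ::
  "(real ^ 'd) measure \<Rightarrow> real \<Rightarrow> (real ^ 'd \<Rightarrow> real) \<Rightarrow> (real ^ 'd \<Rightarrow> real) \<Rightarrow> real" where
  "hellinger G \<sigma> f1 f2 =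
     sqrt (2 * (1 - (\<integral>x. exp (- ((f1 x - f2 x)\<^sup>2 / (8 * \<sigma>\<^sup>2))) \<partial>G)))"

definition hellinger_setdist ::
  "(real ^ 'd) measure \<Rightarrow> real \<Rightarrow> (real ^ 'd \<Rightarrow> real) \<Rightarrow> (real ^ 'd \<Rightarrow> real) set \<Rightarrow> real" where
  "hellinger_setdist G \<sigma> f A = (INF h\<in>A. hellinger G \<sigma> f h)"

text \<open>Integrability of \<open>h\<close> is required explicitly because the integral is \<open>0\<close> by convention
  for functions that are not integrable.\<close>

definition L1_closure ::
  "(real ^ 'd) measure \<Rightarrow> (real ^ 'd \<Rightarrow> real) set \<Rightarrow> (real ^ 'd \<Rightarrow> real) set" where
  "L1_closure G A = {f. integrable G f \<and>
     (\<forall>e>0. \<exists>h\<in>A. integrable G h \<and> (\<integral>x. \<bar>f x - h x\<bar> \<partial>G) < e)}"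

definition subgaussian :: "real measure \<Rightarrow> bool" where
  "subgaussian Q \<longleftrightarrow> (\<exists>s>0. \<forall>t. integrable Q (\<lambda>e. exp (t * e)) \<and>
     (\<integral>e. exp (t * e) \<partial>Q) \<le> exp (s\<^sup>2 * t\<^sup>2 / 2))"

text \<open>
  A data set is a map \<open>D\<close> with \<open>D i = (X\<^sub>i, Y\<^sub>i)\<close> for \<open>i < n\<close>. Prior means \<open>\<zeta>\<close> and scales
  \<open>lam\<close> are indexed by the sample size \<open>n\<close>, the resolution \<open>J\<close> and the cell index \<open>j\<close>.
\<close>

definition likelihood ::
  "real \<Rightarrow> nat \<Rightarrow> (nat \<Rightarrow> (real ^ 'd) \<times> real) \<Rightarrow> (real ^ 'd \<Rightarrow> real) \<Rightarrow> real" where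
  "likelihood \<sigma> n D f = (\<Prod>i<n. normal_density (f (fst (D i))) \<sigma> (snd (D i)))"

definition coef_prior ::
  "real \<Rightarrow> (nat \<Rightarrow> nat \<Rightarrow> nat ^ 'd \<Rightarrow> real) \<Rightarrow> (nat \<Rightarrow> nat \<Rightarrow> nat ^ 'd \<Rightarrow> real) \<Rightarrow> nat \<Rightarrow> nat \<Rightarrow>
   (nat ^ 'd \<Rightarrow> real) measure" where
  "coef_prior \<sigma> \<zeta> lam n J =
     (\<Pi>\<^sub>M j\<in>grid J. density lborel (\<lambda>t. ennreal (normal_density (\<zeta> n J j) (\<sigma> * lam n J j) t)))"

text \<open>Unnormalised posterior mass of a set \<open>A\<close> of pairs \<open>(J, f)\<close>, and its normalisation
  (Bayes' formula).\<close>

definition posterior_mass ::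
  "real \<Rightarrow> nat pmf \<Rightarrow> (nat \<Rightarrow> nat \<Rightarrow> nat ^ 'd \<Rightarrow> real) \<Rightarrow> (nat \<Rightarrow> nat \<Rightarrow> nat ^ 'd \<Rightarrow> real) \<Rightarrow>
   nat \<Rightarrow> (nat \<Rightarrow> (real ^ 'd) \<times> real) \<Rightarrow> (nat \<times> (real ^ 'd \<Rightarrow> real)) set \<Rightarrow> real" where
  "posterior_mass \<sigma> \<pi> \<zeta> lam n D A =
     (\<integral>J. (\<integral>\<theta>. indicator A (J, step_fn J \<theta>) * likelihood \<sigma> n D (step_fn J \<theta>)
        \<partial>coef_prior \<sigma> \<zeta> lam n J) \<partial>measure_pmf \<pi>)"

definition posterior ::
  "real \<Rightarrow> nat pmf \<Rightarrow> (nat \<Rightarrow> nat \<Rightarrow> nat ^ 'd \<Rightarrow> real) \<Rightarrow> (nat \<Rightarrow> nat \<Rightarrow> nat ^ 'd \<Rightarrow> real) \<Rightarrow>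
   nat \<Rightarrow> (nat \<Rightarrow> (real ^ 'd) \<times> real) \<Rightarrow> (nat \<times> (real ^ 'd \<Rightarrow> real)) set \<Rightarrow> real" where
  "posterior \<sigma> \<pi> \<zeta> lam n D A =
     posterior_mass \<sigma> \<pi> \<zeta> lam n D A / posterior_mass \<sigma> \<pi> \<zeta> lam n D UNIV"

definition mono_test ::
  "(real ^ 'd) measure \<Rightarrow> real \<Rightarrow> nat pmf \<Rightarrow>
   (nat \<Rightarrow> nat \<Rightarrow> nat ^ 'd \<Rightarrow> real) \<Rightarrow> (nat \<Rightarrow> nat \<Rightarrow> nat ^ 'd \<Rightarrow> real) \<Rightarrow>
   real \<Rightarrow> real \<Rightarrow> nat \<Rightarrow> (nat \<Rightarrow> (real ^ 'd) \<times> real) \<Rightarrow> real" where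
  "mono_test G \<sigma> \<pi> \<zeta> lam \<gamma> M0 n D =
     (if posterior \<sigma> \<pi> \<zeta> lam n D
           {(J, f). hellinger_setdist G \<sigma> f (mono_step_fns J)
              \<le> M0 * sqrt (real J ^ CARD('d) * ln (real n) / real n)} < \<gamma>
      then 1 else 0)"

text \<open>
  Expectation of a statistic of the sample \<open>(X\<^sub>i, f0 X\<^sub>i + \<epsilon>\<^sub>i)\<close>, \<open>i < n\<close>, where the \<open>X\<^sub>i\<close> are
  i.i.d. with law \<open>G\<close> and, independently of them, the errors \<open>\<epsilon>\<^sub>i\<close> are i.i.d. with law \<open>Q\<close>.
\<close>

definition true_expectation ::
  "(real ^ 'd) measure \<Rightarrow> real measure \<Rightarrow> (real ^ 'd \<Rightarrow> real) \<Rightarrow> nat \<Rightarrow>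
   ((nat \<Rightarrow> (real ^ 'd) \<times> real) \<Rightarrow> real) \<Rightarrow> real" where
  "true_expectation G Q f0 n \<Phi> =
     (\<integral>\<omega>. \<Phi> (\<lambda>i. (fst (\<omega> i), f0 (fst (\<omega> i)) + snd (\<omega> i))) \<partial>(\<Pi>\<^sub>M i\<in>{..<n}. G \<Otimes>\<^sub>M Q))"

end

theory Submission
  imports Defs "HOL-Real_Asymp.Real_Asymp"
begin

text \<open>
  On a grid of resolution \<open>J\<close> the likelihood is \<open>exp (- RSS / (2 \<sigma>\<^sup>2))\<close> up to a constant, and the marginal
  likelihood is at least the maximal likelihood times \<open>n\<close> to the power \<open>- O(J^d)\<close>; so posterior odds reduce to
  comparing residual sums of squares, given that the errors are small on all grids and that every cell
  that is not too small receives its share of the design points. A level \<open>J\<close> with \<open>J^d log n\<close> of larger order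
  than \<open>n\<close> always satisfies the condition inside the test.

  For a monotone truth, level \<open>J\<close> is compared with level \<open>2J\<close>. The value \<open>h\<^sub>j\<close> of \<open>f0\<close> at the centre of a cell lies
  between the sample means of \<open>f0\<close> over the lowest and the highest of its \<open>2^d\<close> subcells, so if the level \<open>J\<close>
  fit is far from the monotone step function \<open>h\<close>, then level \<open>2J\<close> fits much better and has overwhelming
  posterior odds. No projection onto monotone functions is needed.

  Under an alternative, a level on which \<open>f0\<close> is well approximated serves as reference. Levels with
  \<open>J^d log n\<close> of the order of \<open>n \<epsilon>\<^sup>2\<close> or larger, where \<open>\<epsilon>\<close> is the separation, lose to it through the prior. On the
  other levels, a function satisfying the condition inside the test is far from \<open>f0\<close> and loses through
  the likelihood.
\<close>

text \<open>A monotone truth need not be smooth, so its approximation error at a level picked by the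
  posterior is unknown, while the distance to \<open>mono_step_fns J\<close> has to be of order
  sqrt(J^d log n / n) at that very level. Comparing J with 2J turns an error above this order into a
  loss of fit that shows in the data. All likelihood bounds are pointwise: on an event that depends
  on the sample alone they hold for every coefficient vector at once, so integrating over the prior
  costs nothing although the Gaussian coefficients are unbounded. In exchange, population norms must
  be bounded by empirical ones uniformly over the step functions of a level, and the lower bounds on
  the cell counts do this. Hellinger separation becomes L2 separation by
  \<open>hellinger_sq_le\<close>, which holds without bounds on the coefficients; a converse is used
  once, for a fixed alternative, after clipping the monotone function. The sub-Gaussian parameter of
  the errors and the \<sigma> of the working model are separate constants; their ratio only enlarges
  the constants of the proof.\<close>

subsection \<open>Grid cells\<close>

text \<open>The cutoff at 1 puts coordinate 0 into the first interval, the only one closed at its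
  left end.\<close>

definition cidx :: "nat \<Rightarrow> real ^ 'd \<Rightarrow> nat ^ 'd" where
  "cidx J x = (\<chi> k. max 1 (nat \<lceil>real J * x $ k\<rceil>))"

text \<open>The quotient is s / k rounded up. If s is a cell of level J * k, the result is the cell
  of level J that contains it.\<close>

definition coarsen :: "nat \<Rightarrow> nat ^ 'd \<Rightarrow> nat ^ 'd" where
  "coarsen k s = (\<chi> i. (s $ i + k - 1) div k)"

lemma finite_grid: "finite (grid J :: (nat ^ 'd) set)"
  and card_grid: "card (grid J :: (nat ^ 'd) set) = J ^ CARD('d)"
proof -
  have bij: "bij_betw vec_nth (grid J :: (nat ^ 'd) set) (\<Pi>\<^sub>E k\<in>(UNIV :: 'd set). {1..J})"
  proof (rule bij_betwI[where g = vec_lambda])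
    show "vec_nth \<in> (grid J :: (nat ^ 'd) set) \<rightarrow> (\<Pi>\<^sub>E k\<in>(UNIV :: 'd set). {1..J})"
      by (auto simp: grid_def PiE_def)
    show "vec_lambda \<in> (\<Pi>\<^sub>E k\<in>(UNIV :: 'd set). {1..J}) \<rightarrow> grid J"
      by (fastforce simp: grid_def PiE_def)
  qed (auto simp: vec_lambda_inverse)
  have "finite (\<Pi>\<^sub>E k\<in>(UNIV :: 'd set). {1..J})"
    by (rule finite_PiE) auto
  then show "finite (grid J :: (nat ^ 'd) set)"
    using bij_betw_finite[OF bij] by simp
  show "card (grid J :: (nat ^ 'd) set) = J ^ CARD('d)"
    using bij_betw_same_card[OF bij] by (simp add: card_PiE)
qed

lemma unit_cubeD: "x \<in> cbox 0 (1 :: real ^ 'd) \<Longrightarrow> 0 \<le> x $ k \<and> x $ k \<le> 1"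
  by (auto simp: mem_box_cart)

lemma cell_coordinate_iff:
  assumes "J \<ge> (1::nat)" "0 \<le> t" "1 \<le> (a::nat)"
  shows "t \<in> (if a = 1 then {0 .. 1 / real J}
      else {(real a - 1) / real J <.. real a / real J}) \<longleftrightarrow> max 1 (nat \<lceil>real J * t\<rceil>) = a"
proof (cases "a = 1")
  case True
  have "t \<le> 1 / real J \<longleftrightarrow> real J * t \<le> 1"
    using assms by (simp add: field_simps)
  also have "\<dots> \<longleftrightarrow> nat \<lceil>real J * t\<rceil> \<le> 1"
    by (auto simp: ceiling_le_iff nat_le_iff)
  finally have "t \<le> 1 / real J \<longleftrightarrow> nat \<lceil>real J * t\<rceil> \<le> 1" .
  then show ?thesis using True assms by (simp add: max_def) linarith
next
  case False
  then have "max 1 (nat \<lceil>real J * t\<rceil>) = a \<longleftrightarrow> \<lceil>real J * t\<rceil> = int a"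
    using assms by auto
  also have "\<dots> \<longleftrightarrow> real a - 1 < real J * t \<and> real J * t \<le> real a"
    by (simp add: ceiling_eq_iff)
  also have "\<dots> \<longleftrightarrow> t \<in> {(real a - 1) / real J <.. real a / real J}"
    using assms by (auto simp: field_simps)
  finally show ?thesis using False by simp
qed

lemma cell_iff_cidx:
  assumes "J \<ge> 1" "x \<in> cbox 0 1" "j \<in> grid J"
  shows "x \<in> cell J j \<longleftrightarrow> cidx J x = j"
proof -
  have "x $ k \<in> (if j $ k = 1 then {0 .. 1 / real J}
      else {(real (j $ k) - 1) / real J <.. real (j $ k) / real J})
      \<longleftrightarrow> max 1 (nat \<lceil>real J * x $ k\<rceil>) = j $ k" for k
    using assms by (intro cell_coordinate_iff) (auto dest: unit_cubeD simp: grid_def)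
  then have "x \<in> cell J j \<longleftrightarrow> (\<forall>k. max 1 (nat \<lceil>real J * x $ k\<rceil>) = j $ k)"
    unfolding cell_def by blast
  then show ?thesis by (auto simp: cidx_def vec_eq_iff)
qed

lemma cidx_in_grid:
  assumes "J \<ge> 1" "x \<in> cbox 0 1"
  shows "cidx J x \<in> grid J"
proof -
  have "real J * x $ k \<le> real J" for k
    using unit_cubeD[OF assms(2), of k] by (simp add: mult_left_le)
  then show ?thesis
    using assms by (auto simp: grid_def cidx_def nat_le_iff ceiling_le_iff)
qed

lemma cell_subset_unit_cube:
  assumes "J \<ge> 1" "j \<in> grid J"
  shows "cell J j \<subseteq> cbox 0 1"
proof
  fix x assume x: "x \<in> cell J j"
  have "0 \<le> x $ k \<and> x $ k \<le> 1" for k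
  proof -
    have j: "1 \<le> j $ k" "j $ k \<le> J" using assms(2) by (auto simp: grid_def)
    have "x $ k \<in> (if j $ k = 1 then {0 .. 1 / real J}
      else {(real (j $ k) - 1) / real J <.. real (j $ k) / real J})"
      using x by (auto simp: cell_def)
    moreover have "real (j $ k) / real J \<le> 1" "0 \<le> (real (j $ k) - 1) / real J" "1 / real J \<le> 1"
      using j assms(1) by auto
    ultimately show ?thesis by (auto split: if_splits)
  qed
  then show "x \<in> cbox 0 1" by (auto simp: mem_box_cart)
qed

lemma cell_subset_fibre:
  assumes "J \<ge> 1" "j \<in> grid J"
  shows "cell J j = {x \<in> cbox 0 1. cidx J x = j}"
  using cell_iff_cidx[OF assms(1) _ assms(2)] cell_subset_unit_cube[OF assms] by auto

lemma step_fn_eq: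
  assumes "J \<ge> 1" "x \<in> cbox 0 1"
  shows "step_fn J \<theta> x = \<theta> (cidx J x)"
proof -
  have "step_fn J \<theta> x = (\<Sum>j\<in>grid J. if cidx J x = j then \<theta> j else 0)"
    unfolding step_fn_def using assms
    by (intro sum.cong) (auto simp: cell_iff_cidx indicator_def)
  then show ?thesis using cidx_in_grid[OF assms] by (simp add: finite_grid)
qed

text \<open>With a and s the two ceilings cut off at 1, both k (a - 1) < s and s \<le> k a hold, and
  these two bounds determine a as s / k rounded up.\<close>

lemma ceiling_coarsen:
  assumes "k \<ge> (1::nat)"
  shows "max 1 (nat \<lceil>y\<rceil>) = (max 1 (nat \<lceil>y * real k\<rceil>) + k - 1) div k"
proof -
  define a where "a = max 1 (nat \<lceil>y\<rceil>)"
  define s where "s = max 1 (nat \<lceil>y * real k\<rceil>)"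
  have "y * real k \<le> real a * real k"
    by (intro mult_right_mono) (auto simp: a_def le_max_iff_disj, linarith)
  then have "\<lceil>y * real k\<rceil> \<le> int (k * a)"
    by (simp add: ceiling_le_iff mult.commute)
  moreover have "1 \<le> k * a" using assms by (auto simp: a_def)
  ultimately have s_le: "s \<le> k * a"
    unfolding s_def by (simp add: nat_le_iff)
  have s_gt: "k * (a - 1) < s"
  proof (cases "a = 1")
    case False
    then have "a = nat \<lceil>y\<rceil>" "a \<ge> 2" unfolding a_def by (auto simp: max_def split: if_splits)
    then have "real a - 1 < y" by linarith
    then have "real (k * (a - 1)) < y * real k"
      using assms \<open>a \<ge> 2\<close> by (simp add: of_nat_diff mult.commute)
    also have "\<dots> \<le> real s" unfolding s_def by linarith
    finally show ?thesis by linarith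
  qed (auto simp: s_def)
  have "k * a \<le> s + k - 1"
  proof -
    have "k * a = k * (a - 1) + k" unfolding a_def by (simp add: algebra_simps)
    then show ?thesis using s_gt by linarith
  qed
  moreover have "s + k - 1 < k * Suc a" using s_le assms by simp
  ultimately have "(s + k - 1) div k = a"
    by (metis div_nat_eqI)
  then show ?thesis unfolding a_def s_def by simp
qed

text \<open>Level J * k refines level J. A coefficient vector of level J can therefore be read as
  one of level J * k, which is how two levels are compared.\<close>

lemma coarsen_cidx:
  assumes "k \<ge> 1"
  shows "coarsen k (cidx (J * k) x) = cidx J x"
proof -
  have "max 1 (nat \<lceil>real J * x $ i\<rceil>) = (max 1 (nat \<lceil>real J * x $ i * real k\<rceil>) + k - 1) div k" for i
    by (rule ceiling_coarsen[OF assms])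
  then show ?thesis
    by (simp add: coarsen_def cidx_def vec_eq_iff mult.commute mult.left_commute)
qed

lemma cidx_mono: "x \<le> y \<Longrightarrow> cidx J x \<le> cidx J y"
  unfolding less_eq_vec_def cidx_def vec_lambda_beta
  by (intro allI max.mono nat_mono ceiling_mono mult_left_mono) auto

text \<open>Each coordinate differs by at most 1 / J; the factor d comes from passing through the l1
  norm.\<close>

lemma dist_same_cell:
  fixes x y :: "real ^ 'd"
  assumes "J \<ge> 1" "x \<in> cbox 0 1" "y \<in> cbox 0 1" "cidx J x = cidx J y"
  shows "norm (x - y) \<le> real CARD('d) / real J"
proof -
  have "\<bar>(x - y) $ k\<bar> \<le> 1 / real J" for k
  proof -
    have g: "cidx J x \<in> grid J" by (rule cidx_in_grid[OF assms(1,2)])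
    have "x \<in> cell J (cidx J x)" "y \<in> cell J (cidx J x)"
      using assms g by (auto simp: cell_iff_cidx)
    then have "x $ k \<in> {(real (cidx J x $ k) - 1) / real J .. real (cidx J x $ k) / real J}"
      "y $ k \<in> {(real (cidx J x $ k) - 1) / real J .. real (cidx J x $ k) / real J}"
      unfolding cell_def by (auto split: if_splits dest!: spec[of _ k])
    moreover have "real (cidx J x $ k) / real J = (real (cidx J x $ k) - 1) / real J + 1 / real J"
      by (simp add: diff_divide_distrib)
    ultimately show ?thesis by auto
  qed
  then have "(\<Sum>k\<in>UNIV. \<bar>(x - y) $ k\<bar>) \<le> (\<Sum>k\<in>(UNIV::'d set). 1 / real J)"
    by (rule sum_mono)
  then show ?thesis using norm_le_l1_cart[of "x - y"] by simp
qed

lemma cell_borel: "cell J j \<in> sets borel"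
proof -
  have "cell J j = (\<Inter>k\<in>UNIV. (\<lambda>x. x $ k) -` (if j $ k = 1 then {0 .. 1 / real J}
      else {(real (j $ k) - 1) / real J <.. real (j $ k) / real J}) \<inter> space borel)"
    unfolding cell_def by (simp only: set_eq_iff INT_iff vimage_eq Int_iff mem_Collect_eq space_borel) blast
  also have "\<dots> \<in> sets borel"
    by (intro sets.finite_INT measurable_sets[where A = borel]) auto
  finally show ?thesis .
qed

lemma emeasure_cell:
  fixes j :: "nat ^ 'd"
  assumes "J \<ge> 1" "j \<in> grid J"
  shows "emeasure lborel (cell J j) = ennreal (1 / real J ^ CARD('d))"
proof -
  define a b :: "real ^ 'd" where "a = (\<chi> k. (real (j $ k) - 1) / real J)"
    and "b = (\<chi> k. real (j $ k) / real J)"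
  have j: "1 \<le> j $ k" "j $ k \<le> J" for k using assms(2) by (auto simp: grid_def)
  have ab: "a $ k \<le> b $ k" for k
    unfolding a_def b_def by (simp add: divide_right_mono)
  \<comment> \<open>The half-open cell lies between an open and a closed box of equal measure, so
    its boundary conventions do not affect the volume.\<close>
  have "box a b \<subseteq> cell J j"
  proof
    fix x assume "x \<in> box a b"
    then have x: "(real (j $ k) - 1) / real J < x $ k" "x $ k < real (j $ k) / real J" for k
      by (auto simp: mem_box_cart a_def b_def)
    have "x $ k \<in> (if j $ k = 1 then {0 .. 1 / real J}
      else {(real (j $ k) - 1) / real J <.. real (j $ k) / real J})" for k
      using x[of k] by auto
    then show "x \<in> cell J j" unfolding cell_def by blast
  qed
  moreover have "cell J j \<subseteq> cbox a b"
  proof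
    fix x assume x: "x \<in> cell J j"
    have "a $ k \<le> x $ k \<and> x $ k \<le> b $ k" for k
      using x unfolding cell_def a_def b_def by (auto split: if_splits dest!: spec[of _ k])
    then show "x \<in> cbox a b" by (auto simp: mem_box_cart)
  qed
  moreover have "emeasure lborel (box a b) = emeasure lborel (cbox a b)"
    by (simp add: emeasure_lborel_box_eq emeasure_lborel_cbox_eq)
  moreover have "box a b \<in> sets lborel" "cbox a b \<in> sets lborel" "cell J j \<in> sets lborel"
    using cell_borel by auto
  ultimately have "emeasure lborel (cell J j) = emeasure lborel (cbox a b)"
    by (metis emeasure_mono order_antisym)
  also have "\<dots> = ennreal (measure lborel (cbox a b))"
    using emeasure_lborel_cbox_finite[of a b] by (intro emeasure_eq_ennreal_measure) auto
  also have "measure lborel (cbox a b) = (\<Prod>k\<in>UNIV. b $ k - a $ k)"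
    using ab interval_ne_empty_cart(1)[of a b] by (simp add: content_cbox_if_cart)
  also have "(\<Prod>k\<in>UNIV. b $ k - a $ k) = (\<Prod>k\<in>(UNIV::'d set). 1 / real J)"
    by (intro prod.cong) (auto simp: a_def b_def diff_divide_distrib)
  finally show ?thesis by (simp add: power_one_over)
qed

subsection \<open>Averages over the cells of a partition of a sample\<close>

text \<open>Division by zero gives an empty cell the average 0, so empty cells drop out of
  \<open>sum_cavg_sq_le\<close> and satisfy \<open>abs_cavg_le\<close>.\<close>

definition cavg :: "nat \<Rightarrow> (nat \<Rightarrow> 'b) \<Rightarrow> (nat \<Rightarrow> real) \<Rightarrow> 'b \<Rightarrow> real" where
  "cavg n c v j = (\<Sum>i | i < n \<and> c i = j. v i) / real (card {i. i < n \<and> c i = j})"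

lemma cavg_add: "cavg n c (\<lambda>i. v i + w i) j = cavg n c v j + cavg n c w j"
  by (simp add: cavg_def sum.distrib add_divide_distrib)

lemma sum_fibre: "(\<Sum>i | i < n \<and> c i = j. v i) = real (card {i. i < n \<and> c i = j}) * cavg n c v j"
proof (cases "{i. i < n \<and> c i = j} = {}")
  case True
  show ?thesis unfolding cavg_def True by simp
next
  case False
  then have "card {i. i < n \<and> c i = j} \<noteq> 0" by (simp add: card_eq_0_iff)
  then show ?thesis by (simp add: cavg_def)
qed

lemma sum_by_fibres:
  fixes n :: nat
  assumes "finite S" "c ` {..<n} \<subseteq> S"
  shows "(\<Sum>i<n. (u i :: real)) = (\<Sum>j\<in>S. \<Sum>i | i < n \<and> c i = j. u i)"
proof -
  have "{i \<in> {..<n}. c i = j} = {i. i < n \<and> c i = j}" for j by auto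
  then show ?thesis using sum.group[of "{..<n}" S c u] assms by (simp only: finite_lessThan)
qed

lemma sum_comp_fibres:
  fixes n :: nat
  assumes "finite S" "c ` {..<n} \<subseteq> S"
  shows "(\<Sum>i<n. (u (c i) :: real)) = (\<Sum>j\<in>S. real (card {i. i < n \<and> c i = j}) * u j)"
  unfolding sum_by_fibres[OF assms] by (intro sum.cong) auto

text \<open>Replacing a vector by its cell averages is the orthogonal projection, in the empirical
  inner product, onto the functions of the cell index.\<close>

lemma sum_mult_cavg: "(\<Sum>i<n. v i * h (c i)) = (\<Sum>i<n. cavg n c v (c i) * h (c i))"
proof -
  have "(\<Sum>i | i < n \<and> c i = j. v i * h (c i)) = (\<Sum>i | i < n \<and> c i = j. cavg n c v (c i) * h (c i))" for j
    using sum_fibre[where n = n and c = c and j = j and v = v] by (simp add: sum_distrib_right[symmetric])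
  then show ?thesis
    by (subst (1 2) sum_by_fibres[of "c ` {..<n}" c]) auto
qed

text \<open>The residual of this projection is orthogonal to every function of the cell index. With
  data as \<open>v\<close> it identifies the cell averages as least squares coefficients; with
  averages over a coarser partition as \<open>h\<close> it gives the exact cost of
  coarsening.\<close>

lemma cavg_pythagoras:
  "(\<Sum>i<n. (v i - h (c i))\<^sup>2) =
     (\<Sum>i<n. (v i - cavg n c v (c i))\<^sup>2) + (\<Sum>i<n. (cavg n c v (c i) - h (c i))\<^sup>2)"
proof -
  define k where "k = (\<lambda>j. cavg n c v j - h j)"
  have "(\<Sum>i<n. (v i - cavg n c v (c i)) * k (c i)) = 0"
    using sum_mult_cavg[of v k] by (simp add: left_diff_distrib sum_subtractf)
  moreover have "(\<Sum>i<n. (v i - h (c i))\<^sup>2) = (\<Sum>i<n. (v i - cavg n c v (c i))\<^sup>2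
      + (cavg n c v (c i) - h (c i))\<^sup>2 + 2 * ((v i - cavg n c v (c i)) * k (c i)))"
    by (intro sum.cong) (auto simp: k_def power2_eq_square algebra_simps)
  ultimately show ?thesis by (simp add: sum.distrib sum_distrib_left[symmetric])
qed

lemma sum_nonneg_le_sum_comp:
  fixes n :: nat
  assumes "finite S" "\<And>j. 0 \<le> u j" "\<And>j. j \<notin> c ` {..<n} \<Longrightarrow> u j = (0::real)"
  shows "(\<Sum>j\<in>S. u j) \<le> (\<Sum>i<n. u (c i))"
proof -
  have "(\<Sum>j\<in>S. u j) = (\<Sum>j\<in>S \<inter> c ` {..<n}. u j)"
    using assms by (intro sum.mono_neutral_right) auto
  also have "\<dots> \<le> (\<Sum>j\<in>c ` {..<n}. u j)"
    using assms(2) by (intro sum_mono2) simp_all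
  also have "\<dots> \<le> (\<Sum>i<n. u (c i))"
    using sum_image_le[of "{..<n}" u c] assms by (simp add: o_def)
  finally show ?thesis .
qed

text \<open>On the right each cell is weighted by its number of points, which is at least 1 unless
  the cell is empty and its average is 0. This controls the size of the fitted coefficients, which
  enters the Gaussian prior density.\<close>

lemma sum_cavg_sq_le:
  assumes "finite S"
  shows "(\<Sum>j\<in>S. (cavg n c v j)\<^sup>2) \<le> (\<Sum>i<n. (cavg n c v (c i))\<^sup>2)"
proof (rule sum_nonneg_le_sum_comp[OF assms])
  fix j assume "j \<notin> c ` {..<n}"
  then have "{i. i < n \<and> c i = j} = {}" by auto
  then show "(cavg n c v j)\<^sup>2 = 0" by (simp add: cavg_def)
qed auto

lemma cavg_le:
  assumes "\<And>i. i < n \<Longrightarrow> c i = j \<Longrightarrow> v i \<le> b" "i < n" "c i = j"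
  shows "cavg n c v j \<le> b"
proof -
  have ne: "card {i. i < n \<and> c i = j} > 0" using assms(2,3) by (auto simp: card_gt_0_iff)
  have "(\<Sum>i | i < n \<and> c i = j. v i) \<le> (\<Sum>i | i < n \<and> c i = j. b)"
    using assms by (intro sum_mono) auto
  then show ?thesis using ne by (simp add: cavg_def field_simps)
qed

lemma cavg_ge:
  assumes "\<And>i. i < n \<Longrightarrow> c i = j \<Longrightarrow> b \<le> v i" "i < n" "c i = j"
  shows "b \<le> cavg n c v j"
proof -
  have ne: "card {i. i < n \<and> c i = j} > 0" using assms(2,3) by (auto simp: card_gt_0_iff)
  have "(\<Sum>i | i < n \<and> c i = j. b) \<le> (\<Sum>i | i < n \<and> c i = j. v i)"
    using assms by (intro sum_mono) auto
  then show ?thesis using ne by (simp add: cavg_def field_simps)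
qed

lemma abs_cavg_le:
  assumes "\<And>i. i < n \<Longrightarrow> \<bar>v i\<bar> \<le> K" "0 \<le> K"
  shows "\<bar>cavg n c v j\<bar> \<le> K"
proof (cases "\<exists>i<n. c i = j")
  case True
  then obtain i where i: "i < n" "c i = j" by auto
  show ?thesis
    using cavg_le[of n c j v K, OF _ i] cavg_ge[of n c j "-K" v, OF _ i] assms(1)
    by (fastforce simp: abs_le_iff)
next
  case False
  then have "{i. i < n \<and> c i = j} = {}" by auto
  then have "cavg n c v j = 0" unfolding cavg_def by (simp only:) simp
  then show ?thesis using assms(2) by simp
qed

lemma cavg_cong:
  assumes "\<And>i. i < n \<Longrightarrow> c i = c' i" "\<And>i. i < n \<Longrightarrow> v i = v' i"
  shows "cavg n c v j = cavg n c' v' j"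
proof -
  have "{i. i < n \<and> c i = j} = {i. i < n \<and> c' i = j}" using assms by auto
  then show ?thesis using assms unfolding cavg_def by (auto intro!: arg_cong2[where f = "(/)"] sum.cong)
qed

subsection \<open>Product measures\<close>

text \<open>Separates design points from errors, so that the errors can be integrated with the
  design fixed, when the partition of the sample into cells is deterministic. The two measures agree
  on rectangles.\<close>

lemma PiM_pair_eq_distr:
  assumes "prob_space M" "prob_space N" "finite I"
  shows "(\<Pi>\<^sub>M i\<in>I. M \<Otimes>\<^sub>M N) = distr ((\<Pi>\<^sub>M i\<in>I. M) \<Otimes>\<^sub>M (\<Pi>\<^sub>M i\<in>I. N)) (\<Pi>\<^sub>M i\<in>I. M \<Otimes>\<^sub>M N)
    (\<lambda>(x, e). \<lambda>i\<in>I. (x i, e i))"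
proof -
  interpret M: prob_space M by fact
  interpret N: prob_space N by fact
  interpret MN: pair_prob_space M N ..
  interpret pM: product_prob_space "\<lambda>_. M" ..
  interpret pN: product_prob_space "\<lambda>_. N" ..
  interpret pMN: product_prob_space "\<lambda>_. M \<Otimes>\<^sub>M N"
    by (intro product_prob_spaceI MN.prob_space_axioms)
  interpret PM: prob_space "\<Pi>\<^sub>M i\<in>I. M" by (intro prob_space_PiM assms)
  interpret PN: prob_space "\<Pi>\<^sub>M i\<in>I. N" by (intro prob_space_PiM assms)
  have sf: "sigma_finite_measure (\<Pi>\<^sub>M i\<in>I. N)"
    by (intro prob_space_imp_sigma_finite prob_space_PiM assms)
  let ?T = "\<lambda>(x, e). \<lambda>i\<in>I. (x i, e i)"
  have T[measurable]: "?T \<in> measurable ((\<Pi>\<^sub>M i\<in>I. M) \<Otimes>\<^sub>M (\<Pi>\<^sub>M i\<in>I. N)) (\<Pi>\<^sub>M i\<in>I. M \<Otimes>\<^sub>M N)"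
    unfolding case_prod_beta by measurable
  show ?thesis
  proof (rule pMN.PiM_eqI[symmetric, OF \<open>finite I\<close>])
    fix A assume A[measurable]: "\<And>i. i \<in> I \<Longrightarrow> A i \<in> sets (M \<Otimes>\<^sub>M N)"
    have ind: "indicator (?T -` Pi\<^sub>E I A \<inter> space ((\<Pi>\<^sub>M i\<in>I. M) \<Otimes>\<^sub>M (\<Pi>\<^sub>M i\<in>I. N))) (x, e) =
      (\<Prod>i\<in>I. indicator (A i) (x i, e i) :: ennreal)"
      if "x \<in> space (\<Pi>\<^sub>M i\<in>I. M)" "e \<in> space (\<Pi>\<^sub>M i\<in>I. N)" for x e
    proof (cases "\<forall>i\<in>I. (x i, e i) \<in> A i")
      case True
      then show ?thesis using that by (auto simp: indicator_def space_pair_measure PiE_def)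
    next
      case False
      then obtain i where "i \<in> I" "(x i, e i) \<notin> A i" by auto
      then have "(\<Prod>i\<in>I. indicator (A i) (x i, e i) :: ennreal) = 0"
        using \<open>finite I\<close> by (intro prod_zero) (auto simp: indicator_def)
      moreover have "?T (x, e) \<notin> Pi\<^sub>E I A" using \<open>i \<in> I\<close> \<open>(x i, e i) \<notin> A i\<close> by (force simp: PiE_def Pi_def)
      ultimately show ?thesis by (auto simp: indicator_def)
    qed
    have "emeasure (distr ((\<Pi>\<^sub>M i\<in>I. M) \<Otimes>\<^sub>M (\<Pi>\<^sub>M i\<in>I. N)) (\<Pi>\<^sub>M i\<in>I. M \<Otimes>\<^sub>M N) ?T) (Pi\<^sub>E I A) =
      emeasure ((\<Pi>\<^sub>M i\<in>I. M) \<Otimes>\<^sub>M (\<Pi>\<^sub>M i\<in>I. N)) (?T -` Pi\<^sub>E I A \<inter> space ((\<Pi>\<^sub>M i\<in>I. M) \<Otimes>\<^sub>M (\<Pi>\<^sub>M i\<in>I. N)))"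
      using A \<open>finite I\<close> by (intro emeasure_distr T sets_PiM_I_finite) auto
    also have "\<dots> = (\<integral>\<^sup>+x. \<integral>\<^sup>+e. indicator (?T -` Pi\<^sub>E I A \<inter> space ((\<Pi>\<^sub>M i\<in>I. M) \<Otimes>\<^sub>M (\<Pi>\<^sub>M i\<in>I. N))) (x, e)
      \<partial>(\<Pi>\<^sub>M i\<in>I. N) \<partial>(\<Pi>\<^sub>M i\<in>I. M))"
      using A \<open>finite I\<close> by (intro sigma_finite_measure.emeasure_pair_measure[OF sf] measurable_sets[OF T] sets_PiM_I_finite) auto
    also have "\<dots> = (\<integral>\<^sup>+x. \<integral>\<^sup>+e. (\<Prod>i\<in>I. indicator (A i) (x i, e i)) \<partial>(\<Pi>\<^sub>M i\<in>I. N) \<partial>(\<Pi>\<^sub>M i\<in>I. M))"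
      by (intro nn_integral_cong ind)
    also have "\<dots> = (\<integral>\<^sup>+x. (\<Prod>i\<in>I. \<integral>\<^sup>+e. indicator (A i) (x i, e) \<partial>N) \<partial>(\<Pi>\<^sub>M i\<in>I. M))"
    proof (intro nn_integral_cong)
      fix x assume x: "x \<in> space (\<Pi>\<^sub>M i\<in>I. M)"
      show "(\<integral>\<^sup>+e. (\<Prod>i\<in>I. indicator (A i) (x i, e i)) \<partial>(\<Pi>\<^sub>M i\<in>I. N)) = (\<Prod>i\<in>I. \<integral>\<^sup>+e. indicator (A i) (x i, e) \<partial>N)"
      proof (rule pN.product_nn_integral_prod[OF \<open>finite I\<close>, of "\<lambda>i e. indicator (A i) (x i, e)"])
        fix i assume i: "i \<in> I"
        then have [measurable]: "x i \<in> space M" using x by (auto simp: space_PiM PiE_iff)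
        show "(\<lambda>e. indicator (A i) (x i, e) :: ennreal) \<in> borel_measurable N"
          using A[OF i] by measurable
      qed
    qed
    also have "\<dots> = (\<Prod>i\<in>I. \<integral>\<^sup>+x. \<integral>\<^sup>+e. indicator (A i) (x, e) \<partial>N \<partial>M)"
    proof (rule pM.product_nn_integral_prod[OF \<open>finite I\<close>, of "\<lambda>i x. \<integral>\<^sup>+e. indicator (A i) (x, e) \<partial>N"])
      fix i assume i: "i \<in> I"
      show "(\<lambda>x. \<integral>\<^sup>+e. indicator (A i) (x, e) \<partial>N) \<in> borel_measurable M"
        using A[OF i] by (intro N.borel_measurable_nn_integral) auto
    qed
    also have "\<dots> = (\<Prod>i\<in>I. emeasure (M \<Otimes>\<^sub>M N) (A i))"
      using A by (intro prod.cong refl N.emeasure_pair_measure[symmetric]) auto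
    finally show "emeasure (distr ((\<Pi>\<^sub>M i\<in>I. M) \<Otimes>\<^sub>M (\<Pi>\<^sub>M i\<in>I. N)) (\<Pi>\<^sub>M i\<in>I. M \<Otimes>\<^sub>M N) ?T) (Pi\<^sub>E I A) =
      (\<Prod>i\<in>I. emeasure (M \<Otimes>\<^sub>M N) (A i))" .
  qed simp
qed

text \<open>A bound on the conditional expectation given the design, uniform in the design, bounds
  the full expectation.\<close>

lemma nn_integral_PiM_pair_le:
  assumes "prob_space M" "prob_space N" "finite I"
    and f: "f \<in> borel_measurable (\<Pi>\<^sub>M i\<in>I. M \<Otimes>\<^sub>M N)"
    and le: "\<And>x. x \<in> space (\<Pi>\<^sub>M i\<in>I. M) \<Longrightarrow> (\<integral>\<^sup>+e. f (\<lambda>i\<in>I. (x i, e i)) \<partial>(\<Pi>\<^sub>M i\<in>I. N)) \<le> B"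
  shows "(\<integral>\<^sup>+\<omega>. f \<omega> \<partial>(\<Pi>\<^sub>M i\<in>I. M \<Otimes>\<^sub>M N)) \<le> B"
proof -
  let ?T = "\<lambda>(x, e). \<lambda>i\<in>I. (x i, e i)"
  have T[measurable]: "?T \<in> measurable ((\<Pi>\<^sub>M i\<in>I. M) \<Otimes>\<^sub>M (\<Pi>\<^sub>M i\<in>I. N)) (\<Pi>\<^sub>M i\<in>I. M \<Otimes>\<^sub>M N)"
    unfolding case_prod_beta by measurable
  interpret PM: prob_space "\<Pi>\<^sub>M i\<in>I. M" by (intro prob_space_PiM assms)
  interpret PN: prob_space "\<Pi>\<^sub>M i\<in>I. N" by (intro prob_space_PiM assms)
  have "(\<integral>\<^sup>+\<omega>. f \<omega> \<partial>(\<Pi>\<^sub>M i\<in>I. M \<Otimes>\<^sub>M N)) =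
    (\<integral>\<^sup>+p. f (?T p) \<partial>((\<Pi>\<^sub>M i\<in>I. M) \<Otimes>\<^sub>M (\<Pi>\<^sub>M i\<in>I. N)))"
    by (subst PiM_pair_eq_distr[OF assms(1-3)]) (rule nn_integral_distr[OF T], use f in simp)
  also have "\<dots> = (\<integral>\<^sup>+x. \<integral>\<^sup>+e. f (?T (x, e)) \<partial>(\<Pi>\<^sub>M i\<in>I. N) \<partial>(\<Pi>\<^sub>M i\<in>I. M))"
    using measurable_compose[OF T f] by (intro PN.nn_integral_fst[symmetric]) simp
  also have "\<dots> \<le> (\<integral>\<^sup>+x. B \<partial>(\<Pi>\<^sub>M i\<in>I. M))"
    using le by (intro nn_integral_mono) auto
  finally show ?thesis by (simp add: PM.emeasure_space_1)
qed

text \<open>The exponential moment of a sum factorises by independence; this is the common core of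
  the Chernoff bounds below.\<close>

lemma nn_integral_exp_sum_le:
  assumes "prob_space M" "finite I" "\<And>i. i \<in> I \<Longrightarrow> h i \<in> borel_measurable M"
    and le: "\<And>i. i \<in> I \<Longrightarrow> (\<integral>\<^sup>+x. ennreal (exp (h i x)) \<partial>M) \<le> ennreal (exp (b i))"
  shows "(\<integral>\<^sup>+\<omega>. ennreal (exp (\<Sum>i\<in>I. h i (\<omega> i))) \<partial>(\<Pi>\<^sub>M i\<in>I. M)) \<le> ennreal (exp (\<Sum>i\<in>I. b i))"
proof -
  interpret product_prob_space "\<lambda>_. M"
    by (intro product_prob_spaceI assms)
  have "(\<integral>\<^sup>+\<omega>. ennreal (exp (\<Sum>i\<in>I. h i (\<omega> i))) \<partial>(\<Pi>\<^sub>M i\<in>I. M)) =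
    (\<integral>\<^sup>+\<omega>. (\<Prod>i\<in>I. ennreal (exp (h i (\<omega> i)))) \<partial>(\<Pi>\<^sub>M i\<in>I. M))"
    by (simp add: exp_sum[OF \<open>finite I\<close>] prod_ennreal)
  also have "\<dots> = (\<Prod>i\<in>I. \<integral>\<^sup>+x. ennreal (exp (h i x)) \<partial>M)"
    using assms(3) by (intro product_nn_integral_prod[OF \<open>finite I\<close>, of "\<lambda>i x. ennreal (exp (h i x))"]) auto
  also have "\<dots> \<le> (\<Prod>i\<in>I. ennreal (exp (b i)))"
    using le by (intro prod_mono_ennreal) auto
  also have "\<dots> = ennreal (exp (\<Sum>i\<in>I. b i))"
    by (simp add: exp_sum[OF \<open>finite I\<close>] prod_ennreal)
  finally show ?thesis .
qed

subsection \<open>Sub-Gaussian quadratic forms\<close>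

abbreviation std_normal :: "real measure" where
  "std_normal \<equiv> density lborel (\<lambda>z. ennreal (normal_density 0 1 z))"

lemma std_normal_mgf: "(\<integral>\<^sup>+z. ennreal (exp (t * z)) \<partial>std_normal) = ennreal (exp (t\<^sup>2 / 2))"
proof -
  interpret prob_space "density lborel (\<lambda>z. ennreal (normal_density t 1 z))"
    by (rule prob_space_normal_density) simp
  have eq: "normal_density 0 1 z * exp (t * z) = exp (t\<^sup>2 / 2) * normal_density t 1 z" for z
    by (simp add: normal_density_def exp_add[symmetric] power2_eq_square field_simps)
  have "(\<integral>\<^sup>+z. ennreal (exp (t * z)) \<partial>std_normal) = (\<integral>\<^sup>+z. ennreal (exp (t\<^sup>2 / 2)) * ennreal (normal_density t 1 z) \<partial>lborel)"
    by (subst nn_integral_density) (auto simp: ennreal_mult[symmetric] eq)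
  also have "\<dots> = ennreal (exp (t\<^sup>2 / 2)) * emeasure (density lborel (\<lambda>z. ennreal (normal_density t 1 z))) UNIV"
    by (simp add: nn_integral_cmult emeasure_density)
  finally show ?thesis using emeasure_space_1 by simp
qed

text \<open>The integrand times the standard normal density is sqrt 2 times the density of N(0, 2),
  so the exact value is sqrt 2. It is rounded up to 2 to give powers of 2 over the cells.\<close>

lemma std_normal_exp_square: "(\<integral>\<^sup>+z. ennreal (exp (z\<^sup>2 / 4)) \<partial>std_normal) \<le> 2"
proof -
  interpret prob_space "density lborel (\<lambda>z. ennreal (normal_density 0 (sqrt 2) z))"
    by (rule prob_space_normal_density) simp
  have eq: "normal_density 0 1 z * exp (z\<^sup>2 / 4) = sqrt 2 * normal_density 0 (sqrt 2) z" for z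
    by (simp add: normal_density_def exp_add[symmetric] real_sqrt_mult field_simps)
  have "(\<integral>\<^sup>+z. ennreal (exp (z\<^sup>2 / 4)) \<partial>std_normal) = (\<integral>\<^sup>+z. ennreal (sqrt 2) * ennreal (normal_density 0 (sqrt 2) z) \<partial>lborel)"
    by (subst nn_integral_density) (auto simp: ennreal_mult[symmetric] eq)
  also have "\<dots> = ennreal (sqrt 2) * emeasure (density lborel (\<lambda>z. ennreal (normal_density 0 (sqrt 2) z))) UNIV"
    by (simp add: nn_integral_cmult emeasure_density)
  also have "\<dots> = ennreal (sqrt 2)" using emeasure_space_1 by simp
  also have "\<dots> \<le> ennreal 2" by (intro ennreal_leI) (simp add: real_le_lsqrt real_sqrt_le_iff)
  finally show ?thesis by simp
qed

lemma measurable_cavg_fixed [measurable]: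
  assumes "sets N = sets borel"
  shows "(\<lambda>e. cavg n c e j) \<in> borel_measurable (\<Pi>\<^sub>M i\<in>{..<n}. N)"
proof -
  have "(\<lambda>e. e i) \<in> borel_measurable (\<Pi>\<^sub>M i\<in>{..<n}. N)" if "i < n" for i
    using that assms by (subst measurable_cong_sets[OF refl assms[symmetric]]) (intro measurable_component_singleton, auto)
  then show ?thesis unfolding cavg_def by (intro borel_measurable_divide borel_measurable_sum) auto
qed

text \<open>Writing \<open>exp (u\<^sup>2 / (4 s\<^sup>2))\<close> as a Gaussian mixture of the exponentials \<open>exp (z u / (\<surd>2 s))\<close> reduces
  the quadratic form to a linear one, to which the sub-Gaussian bound applies.\<close>

lemma subgaussian_quadratic:
  fixes n :: nat and s :: real
  assumes Q: "prob_space Q" "sets Q = sets borel" and s: "0 < s"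
    and mgf: "\<And>t. (\<integral>\<^sup>+e. ennreal (exp (t * e)) \<partial>Q) \<le> ennreal (exp (s\<^sup>2 * t\<^sup>2 / 2))"
    and S: "finite S" "c ` {..<n} \<subseteq> S"
  shows "(\<integral>\<^sup>+e. ennreal (exp ((\<Sum>i<n. (cavg n c e (c i))\<^sup>2) / (4 * s\<^sup>2))) \<partial>(\<Pi>\<^sub>M i\<in>{..<n}. Q)) \<le> 2 ^ card S"
proof -
  note Q(2)[measurable_cong]
  define N where "N j = real (card {i. i < n \<and> c i = j})" for j
  \<comment> \<open>Chosen so that (\<tau> u)^2 / 2 = u^2 / (4 s^2). Below, \<open>u e j\<close> is
    the sum of the errors in cell j divided by the square root of their number.\<close>
  define \<tau> where "\<tau> = 1 / (sqrt 2 * s)"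
  define u where "u e j = sqrt (N j) * cavg n c e j" for e j
  let ?E = "\<Pi>\<^sub>M i\<in>{..<n}. Q" and ?Z = "\<Pi>\<^sub>M j\<in>S. std_normal"
  interpret E: prob_space ?E by (intro prob_space_PiM Q)
  have std: "prob_space std_normal" by (rule prob_space_normal_density) simp
  interpret Z: prob_space ?Z by (intro prob_space_PiM std)
  interpret PZ: product_prob_space "\<lambda>_. std_normal" by (intro product_prob_spaceI std)
  interpret EZ: pair_sigma_finite ?E ?Z ..
  have [measurable]: "(\<lambda>e. u e j) \<in> borel_measurable ?E" for j
    unfolding u_def using Q(2) by measurable
  have lin: "(\<Sum>j\<in>S. z j * u e j) = (\<Sum>i<n. z (c i) / sqrt (N (c i)) * e i)" for z e
  proof -
    have "(\<Sum>i | i < n \<and> c i = j. z (c i) / sqrt (N (c i)) * e i) = z j * u e j" for j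
    proof -
      have "(\<Sum>i | i < n \<and> c i = j. z (c i) / sqrt (N (c i)) * e i) = z j / sqrt (N j) * (\<Sum>i | i < n \<and> c i = j. e i)"
        by (simp add: sum_distrib_left)
      also have "\<dots> = z j * (N j / sqrt (N j)) * cavg n c e j"
        unfolding sum_fibre by (simp add: N_def)
      also have "N j / sqrt (N j) = sqrt (N j)" by (rule real_div_sqrt) (simp add: N_def)
      finally show ?thesis by (simp add: u_def)
    qed
    then show ?thesis unfolding sum_by_fibres[OF S, of "\<lambda>i. z (c i) / sqrt (N (c i)) * e i"] by simp
  qed
  have quad: "(\<Sum>i<n. (cavg n c e (c i))\<^sup>2) = (\<Sum>j\<in>S. (u e j)\<^sup>2)" for e
    unfolding sum_comp_fibres[OF S, of "\<lambda>j. (cavg n c e j)\<^sup>2"] by (simp add: u_def N_def power_mult_distrib)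
  have mix: "ennreal (exp ((\<Sum>i<n. (cavg n c e (c i))\<^sup>2) / (4 * s\<^sup>2))) =
    (\<integral>\<^sup>+z. ennreal (exp (\<Sum>j\<in>S. \<tau> * u e j * z j)) \<partial>?Z)" for e
  proof -
    have "(u e j)\<^sup>2 / (4 * s\<^sup>2) = (\<tau> * u e j)\<^sup>2 / 2" for j
      by (simp add: \<tau>_def power_mult_distrib power_divide)
    then have "ennreal (exp ((\<Sum>i<n. (cavg n c e (c i))\<^sup>2) / (4 * s\<^sup>2))) = ennreal (exp (\<Sum>j\<in>S. (\<tau> * u e j)\<^sup>2 / 2))"
      by (simp only: quad sum_divide_distrib)
    also have "\<dots> = (\<Prod>j\<in>S. \<integral>\<^sup>+z. ennreal (exp (\<tau> * u e j * z)) \<partial>std_normal)"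
      by (simp add: std_normal_mgf exp_sum[OF S(1)] prod_ennreal)
    also have "\<dots> = (\<integral>\<^sup>+z. (\<Prod>j\<in>S. ennreal (exp (\<tau> * u e j * z j))) \<partial>?Z)"
      by (intro PZ.product_nn_integral_prod[OF S(1), symmetric, of "\<lambda>j z. ennreal (exp (\<tau> * u e j * z))"]) measurable
    finally show ?thesis by (simp add: exp_sum[OF S(1)] prod_ennreal)
  qed
  have inner: "(\<integral>\<^sup>+e. ennreal (exp (\<Sum>j\<in>S. \<tau> * u e j * z j)) \<partial>?E) \<le> ennreal (exp (\<Sum>j\<in>S. (z j)\<^sup>2 / 4))" for z
  proof -
    define a where "a i = z (c i) / sqrt (N (c i))" for i
    have "(\<Sum>j\<in>S. \<tau> * u e j * z j) = (\<Sum>i<n. \<tau> * a i * e i)" for e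
      using arg_cong[OF lin[of z e], of "(*) \<tau>"] by (simp add: a_def sum_distrib_left mult.assoc mult.commute mult.left_commute)
    then have "(\<integral>\<^sup>+e. ennreal (exp (\<Sum>j\<in>S. \<tau> * u e j * z j)) \<partial>?E) = (\<integral>\<^sup>+e. ennreal (exp (\<Sum>i\<in>{..<n}. \<tau> * a i * e i)) \<partial>?E)"
      by simp
    also have "\<dots> \<le> ennreal (exp (\<Sum>i\<in>{..<n}. s\<^sup>2 * (\<tau> * a i)\<^sup>2 / 2))"
      by (intro nn_integral_exp_sum_le[OF Q(1), where h = "\<lambda>i e. \<tau> * a i * e"] mgf) auto
    also have "(\<Sum>i\<in>{..<n}. s\<^sup>2 * (\<tau> * a i)\<^sup>2 / 2) = (\<Sum>i<n. (z (c i))\<^sup>2 / N (c i) / 4)"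
      using s by (intro sum.cong) (auto simp: \<tau>_def a_def power_mult_distrib power_divide N_def)
    also have "\<dots> = (\<Sum>j\<in>S. N j * ((z j)\<^sup>2 / N j / 4))"
      unfolding sum_comp_fibres[OF S, of "\<lambda>j. (z j)\<^sup>2 / N j / 4"] by (simp add: N_def)
    \<comment> \<open>Equality on occupied cells. An empty cell contributes 0 on the left, where
      \<open>N j\<close> = 0 is a factor, and a nonnegative term on the right.\<close>
    also have "\<dots> \<le> (\<Sum>j\<in>S. (z j)\<^sup>2 / 4)"
      by (intro sum_mono) (auto simp: N_def)
    finally show ?thesis by (simp add: ennreal_leI order.trans)
  qed
  have "(\<integral>\<^sup>+e. ennreal (exp ((\<Sum>i<n. (cavg n c e (c i))\<^sup>2) / (4 * s\<^sup>2))) \<partial>?E) =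
    (\<integral>\<^sup>+e. \<integral>\<^sup>+z. ennreal (exp (\<Sum>j\<in>S. \<tau> * u e j * z j)) \<partial>?Z \<partial>?E)"
    by (simp add: mix)
  also have "\<dots> = (\<integral>\<^sup>+z. \<integral>\<^sup>+e. ennreal (exp (\<Sum>j\<in>S. \<tau> * u e j * z j)) \<partial>?E \<partial>?Z)"
  proof (rule EZ.Fubini'[symmetric, of "\<lambda>e z. ennreal (exp (\<Sum>j\<in>S. \<tau> * u e j * z j))"])
    have [measurable]: "(\<lambda>p. \<Sum>j\<in>S. \<tau> * u (fst p) j * snd p j) \<in> borel_measurable (?E \<Otimes>\<^sub>M ?Z)"
    proof (intro borel_measurable_sum)
      fix j assume j: "j \<in> S"
      have "(\<lambda>z. z j) \<in> measurable ?Z std_normal" using j by (rule measurable_component_singleton)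
      then have [measurable]: "(\<lambda>z. z j) \<in> borel_measurable ?Z" by simp
      show "(\<lambda>p. \<tau> * u (fst p) j * snd p j) \<in> borel_measurable (?E \<Otimes>\<^sub>M ?Z)" by measurable
    qed
    show "(\<lambda>(e, z). ennreal (exp (\<Sum>j\<in>S. \<tau> * u e j * z j))) \<in> borel_measurable (?E \<Otimes>\<^sub>M ?Z)"
      unfolding case_prod_beta by measurable
  qed
  also have "\<dots> \<le> (\<integral>\<^sup>+z. ennreal (exp (\<Sum>j\<in>S. (z j)\<^sup>2 / 4)) \<partial>?Z)"
    by (intro nn_integral_mono inner)
  also have "\<dots> = (\<integral>\<^sup>+z. (\<Prod>j\<in>S. ennreal (exp ((z j)\<^sup>2 / 4))) \<partial>?Z)"
    by (simp add: exp_sum[OF S(1)] prod_ennreal)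
  also have "\<dots> = (\<Prod>j\<in>S. \<integral>\<^sup>+z. ennreal (exp (z\<^sup>2 / 4)) \<partial>std_normal)"
    by (intro PZ.product_nn_integral_prod[OF S(1), of "\<lambda>j z. ennreal (exp (z\<^sup>2 / 4))"]) measurable
  also have "\<dots> \<le> (\<Prod>j\<in>S. 2)"
    by (intro prod_mono_ennreal std_normal_exp_square)
  finally show ?thesis by simp
qed

subsection \<open>The regression setting\<close>

text \<open>The function may fail to be measurable: the Bochner integral is then 0, and
  \<open>0 \<le> u\<close> covers this case.\<close>

lemma (in prob_space) integral_le_bound:
  assumes "\<And>x. x \<in> space M \<Longrightarrow> f x \<le> (u::real)" "0 \<le> u"
  shows "(\<integral>x. f x \<partial>M) \<le> u"
proof (cases "integrable M f")
  case True
  then have "(\<integral>x. f x \<partial>M) \<le> (\<integral>x. u \<partial>M)"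
    using assms by (intro integral_mono) auto
  then show ?thesis by (simp add: prob_space)
qed (simp add: not_integrable_integral_eq assms)

locale step_regression =
  fixes G :: "(real ^ 'd) measure" and g :: "real ^ 'd \<Rightarrow> real"
    and Q :: "real measure" and \<pi> :: "nat pmf"
    and \<zeta> lam :: "nat \<Rightarrow> nat \<Rightarrow> nat ^ 'd \<Rightarrow> real"
    and \<sigma> g_lo g_hi b1 b2 z_bd lam_lo lam_hi :: real
  assumes sigma: "\<sigma> > 0"
    and G_prob: "prob_space G"
    and G_density: "g \<in> borel_measurable (lebesgue_on (cbox 0 1))"
      "G = density (lebesgue_on (cbox 0 1)) (\<lambda>x. ennreal (g x))"
    and g_bounds: "0 < g_lo"
      "AE x in lebesgue_on (cbox 0 1). g_lo \<le> g x \<and> g x \<le> g_hi"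
    and Q_prob: "prob_space Q" "sets Q = sets borel"
    and Q_subgaussian: "subgaussian Q"
    and zeta_bounded: "\<And>n J j. J \<ge> 1 \<Longrightarrow> j \<in> grid J \<Longrightarrow> \<bar>\<zeta> n J j\<bar> \<le> z_bd"
    and lam_pos: "\<And>n J j. J \<ge> 1 \<Longrightarrow> j \<in> grid J \<Longrightarrow> 0 < lam n J j"
    and lam_bounds: "0 < lam_lo"
      "\<And>n J j. J \<ge> 1 \<Longrightarrow> j \<in> grid J \<Longrightarrow> lam_lo \<le> (lam n J j)\<^sup>2 \<and> (lam n J j)\<^sup>2 \<le> lam_hi"
    and b_pos: "0 < b1" "0 < b2"
    and pi_positive_integers: "pmf \<pi> 0 = 0"
    and pi_tails: "\<And>J. J \<ge> 2 \<Longrightarrow>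
        exp (- b2 * real J ^ CARD('d) * ln (real J)) \<le> pmf \<pi> J
        \<and> pmf \<pi> J \<le> exp (- b1 * real J ^ CARD('d) * ln (real J))"
begin

sublocale G: prob_space G by (rule G_prob)
sublocale Q: prob_space Q by (rule Q_prob)

abbreviation "hell \<equiv> hellinger G \<sigma>"
abbreviation "hell_setdist \<equiv> hellinger_setdist G \<sigma>"
abbreviation "prior n J \<equiv> coef_prior \<sigma> \<zeta> lam n J"
abbreviation "lik n x y J \<theta> \<equiv> likelihood \<sigma> n (\<lambda>i. (x i, y i)) (step_fn J \<theta>)"
abbreviation "pmass n x y \<equiv> posterior_mass \<sigma> \<pi> \<zeta> lam n (\<lambda>i. (x i, y i))"
abbreviation "post_prob \<equiv> posterior \<sigma> \<pi> \<zeta> lam"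
abbreviation "test \<equiv> mono_test G \<sigma> \<pi> \<zeta> lam"
abbreviation "type_II \<gamma> M0 f0 n \<equiv> true_expectation G Q f0 n (\<lambda>D. 1 - test \<gamma> M0 n D)"

declare Q_prob(2)[measurable_cong]

lemma space_G: "space G = cbox 0 1"
  by (simp add: G_density(2))

lemma sets_G: "sets G = sets (lebesgue_on (cbox 0 1))"
  by (simp add: G_density(2))

lemma borel_sets_G: "S \<in> sets borel \<Longrightarrow> S \<subseteq> cbox 0 1 \<Longrightarrow> S \<in> sets G"
  unfolding sets_G sets_restrict_space
  by (rule image_eqI[where x = S]) auto

lemma cell_sets_G: "J \<ge> 1 \<Longrightarrow> j \<in> grid J \<Longrightarrow> cell J j \<in> sets G"
  by (intro borel_sets_G cell_borel cell_subset_unit_cube)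

lemma emeasure_G_bounds:
  assumes "S \<in> sets borel" "S \<subseteq> cbox 0 1"
  shows "ennreal g_lo * emeasure lborel S \<le> emeasure G S"
    and "emeasure G S \<le> ennreal g_hi * emeasure lborel S"
proof -
  let ?L = "lebesgue_on (cbox 0 1) :: (real ^ 'd) measure"
  have S: "S \<in> sets ?L" using borel_sets_G[OF assms] sets_G by simp
  have gm: "(\<lambda>x. ennreal (g x)) \<in> borel_measurable ?L" using G_density(1) by simp
  have "emeasure ?L S = emeasure lborel S"
    using assms by (subst emeasure_restrict_space) auto
  moreover have "emeasure G S = (\<integral>\<^sup>+x. ennreal (g x) * indicator S x \<partial>?L)"
    unfolding G_density(2) using S gm by (subst emeasure_density) auto
  moreover have "(\<integral>\<^sup>+x. ennreal c * indicator S x \<partial>?L) = ennreal c * emeasure ?L S" for c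
    using S by (simp add: nn_integral_cmult_indicator)
  moreover have "(\<integral>\<^sup>+x. ennreal g_lo * indicator S x \<partial>?L) \<le> (\<integral>\<^sup>+x. ennreal (g x) * indicator S x \<partial>?L)"
    using g_bounds(2) by (intro nn_integral_mono_AE) (elim eventually_mono, intro mult_right_mono ennreal_leI, auto)
  moreover have "(\<integral>\<^sup>+x. ennreal (g x) * indicator S x \<partial>?L) \<le> (\<integral>\<^sup>+x. ennreal g_hi * indicator S x \<partial>?L)"
    using g_bounds(2) by (intro nn_integral_mono_AE) (elim eventually_mono, intro mult_right_mono ennreal_leI, auto)
  ultimately show "ennreal g_lo * emeasure lborel S \<le> emeasure G S"
    "emeasure G S \<le> ennreal g_hi * emeasure lborel S" by simp_all
qed

lemma measure_cell_bounds:
  fixes j :: "nat ^ 'd"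
  assumes "J \<ge> 1" "j \<in> grid J"
  shows "g_lo / real J ^ CARD('d) \<le> measure G (cell J j)"
    and "measure G (cell J j) \<le> g_hi / real J ^ CARD('d)"
proof -
  note b = emeasure_G_bounds[OF cell_borel cell_subset_unit_cube[OF assms], unfolded emeasure_cell[OF assms]]
  have p: "0 < 1 / real J ^ CARD('d)" using assms by simp
  have "ennreal (g_lo * (1 / real J ^ CARD('d))) \<le> ennreal (measure G (cell J j))"
    using b(1) g_bounds(1) p by (subst ennreal_mult) (auto simp: G.emeasure_eq_measure)
  then have "g_lo * (1 / real J ^ CARD('d)) \<le> measure G (cell J j)"
    by (rule ennreal_le_iff[THEN iffD1, rotated]) simp
  then show lo: "g_lo / real J ^ CARD('d) \<le> measure G (cell J j)" by simp
  have "0 < g_lo / real J ^ CARD('d)" using g_bounds(1) p by simp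
  with lo have pos: "0 < measure G (cell J j)" by linarith
  have b2: "ennreal (measure G (cell J j)) \<le> ennreal g_hi * ennreal (1 / real J ^ CARD('d))"
    using b(2) by (simp add: G.emeasure_eq_measure)
  \<comment> \<open>\<open>ennreal\<close> sends a negative \<open>g_hi\<close> to 0, which would
    contradict the positive mass of the cell.\<close>
  have "0 < g_hi"
  proof (rule ccontr)
    assume "\<not> 0 < g_hi"
    then show False using b2 pos by (simp add: ennreal_neg not_less)
  qed
  then have "ennreal (measure G (cell J j)) \<le> ennreal (g_hi * (1 / real J ^ CARD('d)))"
    using b2 p by (subst ennreal_mult) auto
  then show "measure G (cell J j) \<le> g_hi / real J ^ CARD('d)"
    using \<open>0 < g_hi\<close> by (simp add: ennreal_le_iff)
qed

lemma g_hi_pos: "0 < g_hi"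
proof -
  have "(\<chi> k. 1) \<in> (grid 1 :: (nat ^ 'd) set)" by (simp add: grid_def)
  from measure_cell_bounds[OF _ this] g_bounds(1) show ?thesis by simp
qed

lemma cidx_measurable:
  assumes "J \<ge> 1"
  shows "cidx J \<in> measurable G (count_space (grid J))"
proof (subst measurable_count_space_eq2[OF finite_grid], intro conjI ballI)
  show "cidx J \<in> space G \<rightarrow> grid J" using cidx_in_grid[OF assms] by (auto simp: space_G)
  fix j :: "nat ^ 'd" assume j: "j \<in> grid J"
  have "cidx J -` {j} \<inter> space G = cell J j"
    using cell_subset_fibre[OF assms j] by (auto simp: space_G)
  then show "cidx J -` {j} \<inter> space G \<in> sets G" using cell_sets_G[OF assms j] by simp
qed

lemma comp_cidx_measurable [measurable]:
  assumes "J \<ge> 1"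
  shows "(\<lambda>x. u (cidx J x)) \<in> measurable G (borel :: real measure)"
  by (rule measurable_compose[OF cidx_measurable[OF assms]]) simp

lemma comp_cidx_eq_sum:
  assumes "J \<ge> 1" "x \<in> cbox 0 1"
  shows "(u (cidx J x) :: real) = (\<Sum>j\<in>grid J. indicator (cell J j) x * u j)"
  using step_fn_eq[OF assms, of u] by (simp add: step_fn_def mult.commute)

lemma integrable_comp_cidx:
  assumes "J \<ge> 1"
  shows "integrable G (\<lambda>x. (u (cidx J x) :: real))"
proof -
  have "integrable G (\<lambda>x. \<Sum>j\<in>grid J. indicator (cell J j) x * u j)"
    using assms by (intro Bochner_Integration.integrable_sum integrable_mult_left integrable_real_indicator)
      (auto simp: cell_sets_G less_top[symmetric])
  then show ?thesis
    by (subst Bochner_Integration.integrable_cong[OF refl comp_cidx_eq_sum[OF assms]]) (simp_all add: space_G)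
qed

lemma integral_comp_cidx:
  assumes "J \<ge> 1"
  shows "(\<integral>x. u (cidx J x) \<partial>G) = (\<Sum>j\<in>grid J. measure G (cell J j) * (u j :: real))"
proof -
  have "(\<integral>x. u (cidx J x) \<partial>G) = (\<integral>x. (\<Sum>j\<in>grid J. indicator (cell J j) x * u j) \<partial>G)"
    using assms by (intro Bochner_Integration.integral_cong) (auto simp: space_G comp_cidx_eq_sum)
  also have "\<dots> = (\<Sum>j\<in>grid J. (\<integral>x. indicator (cell J j) x * u j \<partial>G))"
    using assms by (intro Bochner_Integration.integral_sum integrable_mult_left integrable_real_indicator)
      (auto simp: cell_sets_G less_top[symmetric])
  also have "\<dots> = (\<Sum>j\<in>grid J. measure G (cell J j) * u j)"
    using assms by (intro sum.cong) (auto simp: cell_sets_G)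
  finally show ?thesis .
qed

subsection \<open>Marginal likelihoods and posterior mass\<close>

text \<open>The standard normal law outside the grid makes every index carry a probability measure,
  as the locale \<open>product_prob_space\<close> demands, without changing the product over the
  grid.\<close>

definition coef_marginal :: "nat \<Rightarrow> nat \<Rightarrow> nat ^ 'd \<Rightarrow> real measure" where
  "coef_marginal n J j = density lborel (\<lambda>t. ennreal (if j \<in> grid J
      then normal_density (\<zeta> n J j) (\<sigma> * lam n J j) t else normal_density 0 1 t))"

lemma grid_index_pos: "(j :: nat ^ 'd) \<in> grid J \<Longrightarrow> J \<ge> 1"
  unfolding grid_def by (auto intro: order_trans)

lemma prob_space_coef_marginal: "prob_space (coef_marginal n J j)"
proof (cases "j \<in> grid J")
  case True
  then have "0 < \<sigma> * lam n J j" using sigma lam_pos[OF grid_index_pos] by simp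
  from prob_space_normal_density[OF this] True show ?thesis by (simp add: coef_marginal_def)
next
  case False
  then show ?thesis using prob_space_normal_density[of 1 0] by (simp add: coef_marginal_def)
qed

lemma coef_prior_eq: "prior n J = (\<Pi>\<^sub>M j\<in>grid J. coef_marginal n J j)"
  unfolding coef_prior_def coef_marginal_def by (intro PiM_cong) auto

lemma sets_coef_marginal [simp, measurable_cong]: "sets (coef_marginal n J j) = sets borel"
  by (simp add: coef_marginal_def)

lemma prob_space_coef_prior: "prob_space (prior n J)"
  unfolding coef_prior_eq by (intro prob_space_PiM prob_space_coef_marginal)

lemma sets_coef_prior [measurable_cong]:
  "sets (prior n J) = sets (\<Pi>\<^sub>M j\<in>grid J. borel)"
  unfolding coef_prior_eq by (intro sets_PiM_cong) auto

definition rss :: "nat \<Rightarrow> (nat \<Rightarrow> real ^ 'd) \<Rightarrow> (nat \<Rightarrow> real) \<Rightarrow> nat \<Rightarrow> (nat ^ 'd \<Rightarrow> real) \<Rightarrow> real" where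
  "rss n x y J \<theta> = (\<Sum>i<n. (y i - \<theta> (cidx J (x i)))\<^sup>2)"

definition lik_const :: "nat \<Rightarrow> real" where
  "lik_const n = (1 / sqrt (2 * pi * \<sigma>\<^sup>2)) ^ n"

lemma lik_const_pos: "0 < lik_const n"
  using sigma by (simp add: lik_const_def)

lemma likelihood_eq:
  assumes "J \<ge> 1" "\<forall>i<n. x i \<in> cbox 0 1"
  shows "lik n x y J \<theta> =
    lik_const n * exp (- rss n x y J \<theta> / (2 * \<sigma>\<^sup>2))"
proof -
  have "lik n x y J \<theta> =
    (\<Prod>i<n. 1 / sqrt (2 * pi * \<sigma>\<^sup>2) * exp (- (y i - \<theta> (cidx J (x i)))\<^sup>2 / (2 * \<sigma>\<^sup>2)))"
    unfolding likelihood_def using assms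
    by (intro prod.cong) (auto simp: normal_density_def step_fn_eq)
  also have "\<dots> = lik_const n * exp (\<Sum>i<n. - (y i - \<theta> (cidx J (x i)))\<^sup>2 / (2 * \<sigma>\<^sup>2))"
    by (subst prod.distrib) (simp add: exp_sum lik_const_def)
  finally show ?thesis
    by (simp add: rss_def sum_divide_distrib sum_negf)
qed

lemma likelihood_nonneg: "0 \<le> likelihood \<sigma> n D f"
  unfolding likelihood_def by (intro prod_nonneg) auto

lemma rss_nonneg: "0 \<le> rss n x y J \<theta>"
  unfolding rss_def by (intro sum_nonneg) auto

lemma rss_measurable [measurable]:
  assumes "J \<ge> 1" "\<forall>i<n. x i \<in> cbox 0 1"
  shows "rss n x y J \<in> borel_measurable (prior n' J)"
proof -
  have "(\<lambda>\<theta>. (y i - \<theta> (cidx J (x i)))\<^sup>2) \<in> borel_measurable (prior n' J)" if "i < n" for i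
  proof -
    have [measurable]: "(\<lambda>\<theta>. \<theta> (cidx J (x i))) \<in> borel_measurable (prior n' J)"
      using cidx_in_grid[OF assms(1) assms(2)[rule_format, OF that]]
      by (subst measurable_cong_sets[OF sets_coef_prior refl]) (rule measurable_component_singleton)
    show ?thesis by measurable
  qed
  then show ?thesis unfolding rss_def[abs_def] by (intro borel_measurable_sum) auto
qed

lemma likelihood_measurable:
  assumes "J \<ge> 1" "\<forall>i<n. x i \<in> cbox 0 1"
  shows "(\<lambda>\<theta>. lik n x y J \<theta>) \<in> borel_measurable (prior n' J)"
proof -
  have "(\<lambda>\<theta>. lik n x y J \<theta>) =
    (\<lambda>\<theta>. lik_const n * exp (- rss n x y J \<theta> / (2 * \<sigma>\<^sup>2)))"
    by (intro ext likelihood_eq assms)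
  then show ?thesis using rss_measurable[OF assms, of y n'] by simp
qed

lemma likelihood_le:
  fixes x :: "nat \<Rightarrow> real ^ 'd"
  assumes "J \<ge> 1" "\<forall>i<n. x i \<in> cbox 0 1"
  shows "lik n x y J \<theta> \<le> lik_const n"
  unfolding likelihood_eq[OF assms] using lik_const_pos[of n] rss_nonneg[of n x y J \<theta>] sigma
  by (simp add: mult_le_cancel_left1)

lemma integrable_likelihood:
  assumes "J \<ge> 1" "\<forall>i<n. x i \<in> cbox 0 1"
  shows "integrable (prior n' J) (\<lambda>\<theta>. lik n x y J \<theta>)"
proof -
  interpret prob_space "prior n' J" by (rule prob_space_coef_prior)
  show ?thesis
    using likelihood_le[OF assms, of y] likelihood_nonneg[of n "\<lambda>i. (x i, y i)"]
    by (intro integrable_const_bound[where B = "lik_const n"] likelihood_measurable[OF assms] AE_I2) auto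
qed

text \<open>Two sources of smallness are combined. Levels with a small likelihood are charged to
  \<open>u\<close>, since the prior weights sum to one; levels with a small prior weight are charged
  to the summable \<open>v\<close>. The set \<open>A\<close> may be nonmeasurable: an integral that
  is 0 by convention still obeys an upper bound.\<close>

lemma posterior_mass_le:
  assumes x: "\<forall>i<n. x i \<in> cbox 0 1" and u: "0 \<le> u" "\<And>J. 0 \<le> v J" "summable v"
    and le: "\<And>J \<theta>. J \<ge> 1 \<Longrightarrow> (J, step_fn J \<theta>) \<in> A \<Longrightarrow>
      pmf \<pi> J * lik n x y J \<theta> \<le> pmf \<pi> J * u + v J"
  shows "pmass n x y A \<le> u + suminf v"
proof -
  define F where "F J = (\<integral>\<theta>. indicator A (J, step_fn J \<theta>) *
    lik n x y J \<theta> \<partial>prior n J)" for J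
  have F_nonneg: "0 \<le> F J" for J
    unfolding F_def by (intro Bochner_Integration.integral_nonneg mult_nonneg_nonneg likelihood_nonneg) auto
  have F_le: "pmf \<pi> J * F J \<le> pmf \<pi> J * u + v J" for J
  proof (cases "J \<ge> 1")
    case True
    interpret prob_space "prior n J" by (rule prob_space_coef_prior)
    have "pmf \<pi> J * F J = (\<integral>\<theta>. pmf \<pi> J * (indicator A (J, step_fn J \<theta>) *
      lik n x y J \<theta>) \<partial>prior n J)"
      unfolding F_def by simp
    also have "\<dots> \<le> pmf \<pi> J * u + v J"
      using le[OF True] u by (intro integral_le_bound) (auto simp: indicator_def)
    finally show ?thesis .
  next
    case False
    then have "J = 0" by simp
    then show ?thesis using pi_positive_integers u by simp
  qed
  have "ennreal (\<integral>J. F J \<partial>measure_pmf \<pi>) \<le> (\<integral>\<^sup>+J. ennreal (F J) \<partial>measure_pmf \<pi>)"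
  proof (cases "integrable (measure_pmf \<pi>) F")
    case True
    then show ?thesis using F_nonneg by (subst nn_integral_eq_integral) auto
  qed (simp add: not_integrable_integral_eq)
  also have "\<dots> = (\<Sum>J. ennreal (pmf \<pi> J) * ennreal (F J))"
    by (simp add: nn_integral_measure_pmf nn_integral_count_space_nat)
  also have "\<dots> \<le> (\<Sum>J. ennreal (pmf \<pi> J * u + v J))"
    using F_le F_nonneg by (intro suminf_le) (auto simp: ennreal_mult[symmetric] intro!: ennreal_leI)
  also have "\<dots> = (\<Sum>J. ennreal (pmf \<pi> J) * ennreal u + ennreal (v J))"
    using u by (intro suminf_cong) (simp add: ennreal_mult)
  also have "\<dots> = (\<Sum>J. ennreal (pmf \<pi> J)) * ennreal u + (\<Sum>J. ennreal (v J))"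
    by (subst suminf_add[symmetric]) auto
  also have "(\<Sum>J. ennreal (pmf \<pi> J)) = 1"
    using nn_integral_pmf[where p = \<pi> and A = UNIV] measure_pmf.emeasure_space_1[of \<pi>] by (simp only: nn_integral_count_space_nat space_measure_pmf)
  also have "1 * ennreal u + (\<Sum>J. ennreal (v J)) = ennreal (u + suminf v)"
    using u by (simp add: suminf_ennreal2 ennreal_plus suminf_nonneg)
  finally have "(\<integral>J. F J \<partial>measure_pmf \<pi>) \<le> u + suminf v"
    using u by (subst (asm) ennreal_le_iff) (auto intro: add_nonneg_nonneg suminf_nonneg)
  then show ?thesis unfolding posterior_mass_def F_def .
qed

lemma posterior_mass_UNIV_ge:
  assumes x: "\<forall>i<n. x i \<in> cbox 0 1"
  shows "pmf \<pi> J * (\<integral>\<theta>. lik n x y J \<theta> \<partial>prior n J)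
    \<le> pmass n x y UNIV"
proof (cases "J = 0")
  case True
  have "0 \<le> pmass n x y UNIV"
    unfolding posterior_mass_def
    by (intro Bochner_Integration.integral_nonneg mult_nonneg_nonneg likelihood_nonneg) auto
  then show ?thesis using True pi_positive_integers by simp
next
  case False
  define F where "F J = (\<integral>\<theta>. lik n x y J \<theta> \<partial>prior n J)" for J
  have F: "0 \<le> F J" for J
    unfolding F_def by (intro Bochner_Integration.integral_nonneg likelihood_nonneg)
  have F1: "F J \<le> lik_const n" if "J \<ge> 1" for J
    unfolding F_def
    by (intro prob_space.integral_le_bound[OF prob_space_coef_prior] likelihood_le[OF that x] less_imp_le[OF lik_const_pos])
  have int: "integrable (measure_pmf \<pi>) F"
  proof (rule measure_pmf.integrable_const_bound[where B = "lik_const n"])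
    have "J \<ge> 1" if "J \<in> set_pmf \<pi>" for J
      using that pi_positive_integers by (cases J) (auto simp: set_pmf_iff)
    then show "AE J in measure_pmf \<pi>. norm (F J) \<le> lik_const n"
      using F F1 by (intro AE_pmfI) auto
  qed simp
  have "pmf \<pi> J * F J = (\<integral>J'. indicator {J} J' * F J \<partial>measure_pmf \<pi>)"
    by (simp add: measure_pmf_single)
  also have "\<dots> \<le> (\<integral>J'. F J' \<partial>measure_pmf \<pi>)"
    using F
    by (intro integral_mono int integrable_mult_left integrable_real_indicator)
      (auto simp: indicator_def measure_pmf.emeasure_eq_measure)
  finally show ?thesis unfolding posterior_mass_def F_def by simp
qed

text \<open>Turns an upper bound on the mass of the complement into a lower bound on the mass of the
  event. Additivity is where measurability of the event matters.\<close>

lemma posterior_mass_split: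
  assumes x: "\<forall>i<n. x i \<in> cbox 0 1"
    and A: "\<And>J. J \<ge> 1 \<Longrightarrow> {\<theta> \<in> space (prior n J). (J, step_fn J \<theta>) \<in> A} \<in> sets (prior n J)"
  shows "pmass n x y A + pmass n x y (- A)
    = pmass n x y UNIV"
proof -
  define F where "F B J = (\<integral>\<theta>. indicator B (J, step_fn J \<theta>) *
    lik n x y J \<theta> \<partial>prior n J)" for B J
  have pos: "J \<ge> 1" if "J \<in> set_pmf \<pi>" for J
    using that pi_positive_integers by (cases J) (auto simp: set_pmf_iff)
  have int: "integrable (measure_pmf \<pi>) (F B)" for B
  proof (rule measure_pmf.integrable_const_bound[where B = "lik_const n"])
    have "\<bar>F B J\<bar> \<le> lik_const n" if "J \<ge> 1" for J
    proof -
      have "0 \<le> F B J"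
        unfolding F_def by (intro Bochner_Integration.integral_nonneg mult_nonneg_nonneg likelihood_nonneg) auto
      moreover have "F B J \<le> lik_const n"
        unfolding F_def using likelihood_le[OF that x] lik_const_pos[of n]
        by (intro prob_space.integral_le_bound[OF prob_space_coef_prior]) (auto simp: indicator_def)
      ultimately show ?thesis by simp
    qed
    then show "AE J in measure_pmf \<pi>. norm (F B J) \<le> lik_const n"
      using pos by (intro AE_pmfI) auto
  qed simp
  have "F A J + F (- A) J = F UNIV J" if J: "J \<ge> 1" for J
  proof -
    have i: "integrable (prior n J) (\<lambda>\<theta>. indicator B (J, step_fn J \<theta>) *
      lik n x y J \<theta>)"
      if B: "{\<theta> \<in> space (prior n J). (J, step_fn J \<theta>) \<in> B} \<in> sets (prior n J)" for B
    proof -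
      have "integrable (prior n J) (\<lambda>\<theta>. indicator {\<theta> \<in> space (prior n J). (J, step_fn J \<theta>) \<in> B} \<theta> *
        lik n x y J \<theta>)"
        using integrable_mult_indicator[OF B integrable_likelihood[OF J x, of n y]] by simp
      then show ?thesis
        by (subst Bochner_Integration.integrable_cong[OF refl]) (auto simp: indicator_def)
    qed
    have "{\<theta> \<in> space (prior n J). (J, step_fn J \<theta>) \<in> - A} =
      space (prior n J) - {\<theta> \<in> space (prior n J). (J, step_fn J \<theta>) \<in> A}" by auto
    then have A': "{\<theta> \<in> space (prior n J). (J, step_fn J \<theta>) \<in> - A} \<in> sets (prior n J)"
      using A[OF J] by (simp only: sets.compl_sets)
    show ?thesis
      unfolding F_def Bochner_Integration.integral_add[OF i[OF A[OF J]] i[OF A'], symmetric]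
      by (intro Bochner_Integration.integral_cong) (auto simp: indicator_def)
  qed
  then have "(\<integral>J. F A J + F (- A) J \<partial>measure_pmf \<pi>) = (\<integral>J. F UNIV J \<partial>measure_pmf \<pi>)"
    using pos by (intro integral_cong_AE AE_pmfI) auto
  then show ?thesis
    unfolding Bochner_Integration.integral_add[OF int int] unfolding posterior_mass_def F_def by simp
qed

section \<open>Least squares and the marginal likelihood of one level\<close>

abbreviation fit :: "nat \<Rightarrow> (nat \<Rightarrow> real ^ 'd) \<Rightarrow> (nat \<Rightarrow> real) \<Rightarrow> nat \<Rightarrow> nat ^ 'd \<Rightarrow> real" where
  "fit n x y J \<equiv> cavg n (\<lambda>i. cidx J (x i)) y"

lemma rss_pythagoras:
  "rss n x y J \<theta> = rss n x y J (fit n x y J) + (\<Sum>i<n. (fit n x y J (cidx J (x i)) - \<theta> (cidx J (x i)))\<^sup>2)"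
  unfolding rss_def by (rule cavg_pythagoras[where c = "\<lambda>i. cidx J (x i)"])

text \<open>Interval length times the smallest density on the interval. The exponent grows like the
  square of the centre \<open>c\<close>, which is why squared fitted coefficients appear in the
  evidence bound.\<close>

lemma measure_coef_marginal_ge:
  assumes j: "j \<in> grid J" and r: "0 \<le> r" "r \<le> 1"
  shows "2 * r * (1 / sqrt (2 * pi * (\<sigma>\<^sup>2 * lam_hi)) * exp (- (3 * (c\<^sup>2 + 1 + z_bd\<^sup>2) / (2 * \<sigma>\<^sup>2 * lam_lo))))
    \<le> measure (coef_marginal n J j) {c - r .. c + r}"
proof -
  interpret M: prob_space "coef_marginal n J j" by (rule prob_space_coef_marginal)
  note J = grid_index_pos[OF j]
  define s where "s = \<sigma> * lam n J j"
  define K where "K = 1 / sqrt (2 * pi * (\<sigma>\<^sup>2 * lam_hi)) * exp (- (3 * (c\<^sup>2 + 1 + z_bd\<^sup>2) / (2 * \<sigma>\<^sup>2 * lam_lo)))"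
  have lam: "0 < lam n J j" "lam_lo \<le> (lam n J j)\<^sup>2" "(lam n J j)\<^sup>2 \<le> lam_hi"
    using lam_pos[OF J j] lam_bounds(2)[OF J j] by auto
  have z: "\<bar>\<zeta> n J j\<bar> \<le> z_bd" by (rule zeta_bounded[OF J j])
  have s2: "\<sigma>\<^sup>2 * lam_lo \<le> s\<^sup>2" "s\<^sup>2 \<le> \<sigma>\<^sup>2 * lam_hi" "0 < s"
    using lam sigma by (auto simp: s_def power_mult_distrib)
  have lo_pos: "0 < \<sigma>\<^sup>2 * lam_lo" using sigma lam_bounds(1) by simp
  have dens: "K \<le> normal_density (\<zeta> n J j) s t" if t: "t \<in> {c - r .. c + r}" for t
  proof -
    have "\<bar>t - \<zeta> n J j\<bar> \<le> \<bar>c\<bar> + 1 + z_bd" using t r z by auto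
    then have "(t - \<zeta> n J j)\<^sup>2 \<le> (\<bar>c\<bar> + 1 + z_bd)\<^sup>2"
      by (metis abs_ge_zero power2_abs power_mono)
    also have "\<dots> \<le> 3 * (c\<^sup>2 + 1 + z_bd\<^sup>2)"
    proof -
      \<comment> \<open>Three times the sum of three squares minus the square of the sum is the sum
        of the squared differences.\<close>
      have "0 \<le> (\<bar>c\<bar> - 1)\<^sup>2 + (\<bar>c\<bar> - z_bd)\<^sup>2 + (1 - z_bd)\<^sup>2" by simp
      then show ?thesis by (simp add: power2_eq_square algebra_simps)
    qed
    finally have num: "(t - \<zeta> n J j)\<^sup>2 \<le> 3 * (c\<^sup>2 + 1 + z_bd\<^sup>2)" .
    have "(t - \<zeta> n J j)\<^sup>2 / (2 * s\<^sup>2) \<le> 3 * (c\<^sup>2 + 1 + z_bd\<^sup>2) / (2 * \<sigma>\<^sup>2 * lam_lo)"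
      using num s2 lo_pos by (intro frac_le) (auto simp: mult.commute)
    then have "exp (- (3 * (c\<^sup>2 + 1 + z_bd\<^sup>2) / (2 * \<sigma>\<^sup>2 * lam_lo))) \<le> exp (- (t - \<zeta> n J j)\<^sup>2 / (2 * s\<^sup>2))"
      by simp
    moreover have "1 / sqrt (2 * pi * (\<sigma>\<^sup>2 * lam_hi)) \<le> 1 / sqrt (2 * pi * s\<^sup>2)"
      using s2 by (intro divide_left_mono real_sqrt_le_mono mult_left_mono mult_pos_pos)
        (auto intro!: mult_pos_pos simp: order_less_le_trans[OF _ s2(2)])
    ultimately show ?thesis
      unfolding K_def normal_density_def by (intro mult_mono) auto
  qed
  have "ennreal (2 * r * K) = (\<integral>\<^sup>+t. ennreal K * indicator {c - r .. c + r} t \<partial>lborel)"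
    using r by (subst nn_integral_cmult_indicator) (auto simp: ennreal_mult'[symmetric] K_def mult.commute)
  also have "\<dots> \<le> (\<integral>\<^sup>+t. ennreal (normal_density (\<zeta> n J j) s t) * indicator {c - r .. c + r} t \<partial>lborel)"
    using dens by (intro nn_integral_mono) (auto simp: indicator_def intro!: ennreal_leI)
  also have "\<dots> = emeasure (coef_marginal n J j) {c - r .. c + r}"
    using j unfolding coef_marginal_def s_def by (subst emeasure_density) auto
  also have "\<dots> = ennreal (measure (coef_marginal n J j) {c - r .. c + r})"
    by (simp add: M.emeasure_eq_measure)
  finally show ?thesis unfolding K_def by (subst (asm) ennreal_le_iff) auto
qed

text \<open>The 1 covers the factor n^(-1/2) per coordinate from the radius of the box, the second
  term multiplies the squared fitted coefficients, the absolute value bounds the constant factor of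
  the prior density, and the last term pays for a residual sum of squares that is larger by
  1.\<close>

definition evidence_const :: real where
  "evidence_const = 1 + 3 / (2 * \<sigma>\<^sup>2 * lam_lo)
     + \<bar>3 / (2 * \<sigma>\<^sup>2 * lam_lo) * (1 + z_bd\<^sup>2) - ln (2 * (1 / sqrt (2 * pi * (\<sigma>\<^sup>2 * lam_hi))))\<bar> + 1 / (2 * \<sigma>\<^sup>2)"

lemma evidence_const_pos: "0 < evidence_const"
proof -
  have "0 \<le> 3 / (2 * \<sigma>\<^sup>2 * lam_lo)" using sigma lam_bounds(1) by simp
  then show ?thesis unfolding evidence_const_def by (intro add_pos_nonneg) auto
qed

text \<open>The prior puts mass at least \<open>n\<close> to the power \<open>- O(J^d)\<close> on the box of radius \<open>1 / \<surd>n\<close> around the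
  least squares coefficients, and on this box the residual sum of squares exceeds its minimum by at most \<open>1\<close>.\<close>

lemma evidence_lower:
  assumes n: "n \<ge> 1" and J: "J \<ge> 1" and x: "\<forall>i<n. x i \<in> cbox 0 1"
  shows "lik_const n * exp (- rss n x y J (fit n x y J) / (2 * \<sigma>\<^sup>2)
        - evidence_const * (real J ^ CARD('d) * (1 + ln (real n)) + (\<Sum>j\<in>grid J. (fit n x y J j)\<^sup>2)))
    \<le> (\<integral>\<theta>. lik n x y J \<theta> \<partial>prior n J)"
proof -
  define a0 where "a0 = 1 / sqrt (2 * pi * (\<sigma>\<^sup>2 * lam_hi))"
  define \<kappa> where "\<kappa> = 3 / (2 * \<sigma>\<^sup>2 * lam_lo)"
  define C1 where "C1 = \<bar>\<kappa> * (1 + z_bd\<^sup>2) - ln (2 * a0)\<bar>"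
  define C where "C = evidence_const"
  have C_eq: "C = 1 + \<kappa> + C1 + 1 / (2 * \<sigma>\<^sup>2)"
    by (simp add: C_def evidence_const_def C1_def \<kappa>_def a0_def)
  have \<kappa>: "0 < \<kappa>" using sigma lam_bounds(1) by (simp add: \<kappa>_def)
  have "(\<chi> k. 1) \<in> (grid 1 :: (nat ^ 'd) set)" by (simp add: grid_def)
  from lam_bounds(2)[OF _ this] lam_bounds(1) have "0 < lam_hi" by force
  then have a0: "0 < a0" using sigma by (simp add: a0_def)
  define c where "c = fit n x y J"
  define r where "r = 1 / sqrt (real n)"
  define B where "B = (\<Pi>\<^sub>E j\<in>grid J. {c j - r .. c j + r})"
  define LL where "LL = lik_const n * exp (- (rss n x y J c + 1) / (2 * \<sigma>\<^sup>2))"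
  have r: "0 < r" "r \<le> 1" using n by (auto simp: r_def)
  have LL: "0 < LL" using lik_const_pos by (simp add: LL_def)
  interpret P: prob_space "prior n J" by (rule prob_space_coef_prior)
  interpret PS: product_prob_space "coef_marginal n J"
    by (intro product_prob_spaceI prob_space_coef_marginal)
  interpret PP: finite_product_prob_space "coef_marginal n J" "grid J"
    by unfold_locales (rule finite_grid)
  have Bsets: "B \<in> sets (prior n J)"
    unfolding B_def coef_prior_eq by (intro sets_PiM_I_finite finite_grid) auto
  have lik_ge: "LL \<le> lik n x y J \<theta>" if \<theta>: "\<theta> \<in> B" for \<theta>
  proof -
    have "(c (cidx J (x i)) - \<theta> (cidx J (x i)))\<^sup>2 \<le> 1 / real n" if i: "i < n" for i
    proof -
      have "cidx J (x i) \<in> grid J" using cidx_in_grid[OF J] x i by auto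
      then have "\<theta> (cidx J (x i)) \<in> {c (cidx J (x i)) - r .. c (cidx J (x i)) + r}"
        using \<theta> unfolding B_def by (auto simp: PiE_iff)
      then have "\<bar>c (cidx J (x i)) - \<theta> (cidx J (x i))\<bar> \<le> r" by auto
      then have "(c (cidx J (x i)) - \<theta> (cidx J (x i)))\<^sup>2 \<le> r\<^sup>2"
        by (metis abs_ge_zero power2_abs power_mono)
      then show ?thesis by (simp add: r_def power_divide)
    qed
    then have "(\<Sum>i<n. (c (cidx J (x i)) - \<theta> (cidx J (x i)))\<^sup>2) \<le> (\<Sum>i<n. 1 / real n)"
      by (intro sum_mono) auto
    also have "\<dots> = 1" using n by simp
    finally have "rss n x y J \<theta> \<le> rss n x y J c + 1"
      using rss_pythagoras[of n x y J \<theta>] by (simp add: c_def)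
    then have "- (rss n x y J c + 1) / (2 * \<sigma>\<^sup>2) \<le> - rss n x y J \<theta> / (2 * \<sigma>\<^sup>2)"
      using sigma by (intro divide_right_mono) auto
    then show ?thesis
      unfolding LL_def likelihood_eq[OF J x] using lik_const_pos[of n] by simp
  qed
  \<comment> \<open>On the logarithmic scale: half of log n from the radius, \<open>C1\<close> from
    the constant factor of the density, and \<kappa> times the squared centre from its
    exponent.\<close>
  have meas: "exp (- (1 / 2 + C1) * (1 + ln (real n)) - \<kappa> * (c j)\<^sup>2) \<le> measure (coef_marginal n J j) {c j - r .. c j + r}"
    if j: "j \<in> grid J" for j
  proof -
    have ln_n: "0 \<le> ln (real n)" using n by simp
    have "r = exp (- (1 / 2) * ln (real n))"
    proof -
      have "sqrt (real n) = exp (ln (real n) / 2)"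
        using n by (simp add: ln_sqrt[symmetric])
      then show ?thesis by (simp add: r_def exp_minus inverse_eq_divide)
    qed
    then have "2 * r * (a0 * exp (- (3 * ((c j)\<^sup>2 + 1 + z_bd\<^sup>2) / (2 * \<sigma>\<^sup>2 * lam_lo)))) =
      exp (ln (2 * a0)) * exp (- (1 / 2) * ln (real n)) * exp (- \<kappa> * ((c j)\<^sup>2 + 1 + z_bd\<^sup>2))"
      using a0 by (simp add: \<kappa>_def)
    also have "\<dots> = exp (ln (2 * a0) - (1 / 2) * ln (real n) - \<kappa> * ((c j)\<^sup>2 + 1 + z_bd\<^sup>2))"
      by (simp only: exp_add[symmetric]) simp
    finally have eq: "2 * r * (a0 * exp (- (3 * ((c j)\<^sup>2 + 1 + z_bd\<^sup>2) / (2 * \<sigma>\<^sup>2 * lam_lo)))) =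
      exp (ln (2 * a0) - (1 / 2) * ln (real n) - \<kappa> * ((c j)\<^sup>2 + 1 + z_bd\<^sup>2))" .
    have "C1 * 1 \<le> C1 * (1 + ln (real n))" using ln_n by (intro mult_left_mono) (auto simp: C1_def)
    moreover have "\<kappa> * (1 + z_bd\<^sup>2) - ln (2 * a0) \<le> C1" unfolding C1_def by simp
    ultimately have "- (1 / 2 + C1) * (1 + ln (real n)) - \<kappa> * (c j)\<^sup>2 \<le>
        ln (2 * a0) - (1 / 2) * ln (real n) - \<kappa> * ((c j)\<^sup>2 + 1 + z_bd\<^sup>2)"
      using ln_n by (simp add: algebra_simps add_divide_distrib)
    then have "exp (- (1 / 2 + C1) * (1 + ln (real n)) - \<kappa> * (c j)\<^sup>2) \<le>
        2 * r * (a0 * exp (- (3 * ((c j)\<^sup>2 + 1 + z_bd\<^sup>2) / (2 * \<sigma>\<^sup>2 * lam_lo))))"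
      unfolding eq by simp
    also have "\<dots> \<le> measure (coef_marginal n J j) {c j - r .. c j + r}"
      unfolding a0_def using r by (intro measure_coef_marginal_ge[OF j]) auto
    finally show ?thesis .
  qed
  have ln1: "1 \<le> real J ^ CARD('d) * (1 + ln (real n))"
  proof -
    have "1 \<le> real J ^ CARD('d)" "1 \<le> 1 + ln (real n)" using J n by auto
    then show ?thesis by (metis mult_mono' mult_1 zero_le_one)
  qed
  have "exp (- (1 / 2 + C1) * (real J ^ CARD('d) * (1 + ln (real n))) - \<kappa> * (\<Sum>j\<in>grid J. (c j)\<^sup>2)) =
    (\<Prod>j\<in>(grid J :: (nat ^ 'd) set). exp (- (1 / 2 + C1) * (1 + ln (real n)) - \<kappa> * (c j)\<^sup>2))"
    by (simp only: exp_sum[OF finite_grid, symmetric] sum_subtractf sum_distrib_left[symmetric] sum_constant card_grid)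
      (simp add: algebra_simps)
  also have "\<dots> \<le> (\<Prod>j\<in>grid J. measure (coef_marginal n J j) {c j - r .. c j + r})"
    using meas by (intro prod_mono) auto
  also have "\<dots> = measure (prior n J) B"
    unfolding B_def coef_prior_eq by (subst PP.prob_times) auto
  finally have mB: "exp (- (1 / 2 + C1) * (real J ^ CARD('d) * (1 + ln (real n))) - \<kappa> * (\<Sum>j\<in>grid J. (c j)\<^sup>2))
    \<le> measure (prior n J) B" .
  have S: "0 \<le> (\<Sum>j\<in>grid J. (c j)\<^sup>2)" by (intro sum_nonneg) auto
  have "C * (real J ^ CARD('d) * (1 + ln (real n)) + (\<Sum>j\<in>grid J. (c j)\<^sup>2))
    \<ge> 1 / (2 * \<sigma>\<^sup>2) + ((1 / 2 + C1) * (real J ^ CARD('d) * (1 + ln (real n))) + \<kappa> * (\<Sum>j\<in>grid J. (c j)\<^sup>2))"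
  proof -
    have "\<kappa> * (\<Sum>j\<in>grid J. (c j)\<^sup>2) \<le> C * (\<Sum>j\<in>grid J. (c j)\<^sup>2)"
      using S by (intro mult_right_mono) (auto simp: C_eq C1_def)
    moreover have "1 / (2 * \<sigma>\<^sup>2) * 1 \<le> 1 / (2 * \<sigma>\<^sup>2) * (real J ^ CARD('d) * (1 + ln (real n)))"
      using ln1 by (intro mult_left_mono) auto
    moreover have "(1 / (2 * \<sigma>\<^sup>2) + (1 / 2 + C1)) * (real J ^ CARD('d) * (1 + ln (real n)))
       \<le> C * (real J ^ CARD('d) * (1 + ln (real n)))"
      using ln1 \<kappa> by (intro mult_right_mono) (auto simp: C_eq)
    ultimately show ?thesis by (simp only: distrib_left distrib_right)
  qed
  then have "- rss n x y J c / (2 * \<sigma>\<^sup>2) - C * (real J ^ CARD('d) * (1 + ln (real n)) + (\<Sum>j\<in>grid J. (c j)\<^sup>2))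
     \<le> - (rss n x y J c + 1) / (2 * \<sigma>\<^sup>2) + (- (1 / 2 + C1) * (real J ^ CARD('d) * (1 + ln (real n))) - \<kappa> * (\<Sum>j\<in>grid J. (c j)\<^sup>2))"
    by (simp only: diff_divide_distrib add_divide_distrib minus_add_distrib left_diff_distrib) (simp add: algebra_simps)
  then have "lik_const n * exp (- rss n x y J c / (2 * \<sigma>\<^sup>2) - C * (real J ^ CARD('d) * (1 + ln (real n)) + (\<Sum>j\<in>grid J. (c j)\<^sup>2)))
    \<le> LL * exp (- (1 / 2 + C1) * (real J ^ CARD('d) * (1 + ln (real n))) - \<kappa> * (\<Sum>j\<in>grid J. (c j)\<^sup>2))"
    unfolding LL_def using lik_const_pos[of n] by (simp add: exp_add[symmetric] mult.assoc)
  also have "\<dots> \<le> LL * measure (prior n J) B"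
    using mB LL by simp
  also have "\<dots> = (\<integral>\<theta>. indicator B \<theta> * LL \<partial>prior n J)"
    using Bsets by simp
  also have "\<dots> \<le> (\<integral>\<theta>. lik n x y J \<theta> \<partial>prior n J)"
    using lik_ge likelihood_nonneg Bsets
    by (intro integral_mono integrable_likelihood[OF J x] integrable_mult_left integrable_real_indicator)
      (auto simp: indicator_def P.emeasure_eq_measure)
  finally show ?thesis unfolding c_def C_def .
qed

subsection \<open>The Hellinger distance\<close>

lemma hellinger_integral_bounds:
  "0 \<le> (\<integral>x. exp (- ((f1 x - f2 x)\<^sup>2 / (8 * \<sigma>\<^sup>2))) \<partial>G)"
  "(\<integral>x. exp (- ((f1 x - f2 x)\<^sup>2 / (8 * \<sigma>\<^sup>2))) \<partial>G) \<le> 1"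
  by (auto intro!: Bochner_Integration.integral_nonneg G.integral_le_bound)

lemma hellinger_nonneg: "0 \<le> hell f1 f2"
  unfolding hellinger_def using hellinger_integral_bounds(2)[of f1 f2] by simp

lemma hellinger_sq: "(hell f1 f2)\<^sup>2 = 2 * (1 - (\<integral>x. exp (- ((f1 x - f2 x)\<^sup>2 / (8 * \<sigma>\<^sup>2))) \<partial>G))"
  unfolding hellinger_def using hellinger_integral_bounds(2)[of f1 f2] by simp

lemma hellinger_le_sqrt2: "hell f1 f2 \<le> sqrt 2"
  unfolding hellinger_def using hellinger_integral_bounds(1)[of f1 f2] by simp

lemma bdd_below_hellinger: "bdd_below (hell f ` A)"
  by (rule bdd_belowI2[of _ 0]) (rule hellinger_nonneg)

lemma hellinger_setdist_le: "h \<in> A \<Longrightarrow> hell_setdist f A \<le> hell f h"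
  unfolding hellinger_setdist_def by (rule cINF_lower[OF bdd_below_hellinger])

lemma hellinger_setdist_less_iff:
  "A \<noteq> {} \<Longrightarrow> hell_setdist f A < r \<longleftrightarrow> (\<exists>h\<in>A. hell f h < r)"
  unfolding hellinger_setdist_def by (rule cINF_less_iff[OF _ bdd_below_hellinger])

lemma mono_step_fns_nonempty: "mono_step_fns J \<noteq> ({} :: (real ^ 'd \<Rightarrow> real) set)"
proof -
  have "(\<lambda>x. 0) = step_fn J (\<lambda>j. 0)" by (simp add: step_fn_def)
  then have "(\<lambda>x. 0) \<in> mono_step_fns J"
    unfolding mono_step_fns_def step_fns_def mono_fns_def by (auto simp: monotone_on_def)
  then show ?thesis by blast
qed

text \<open>With p and q the two exponentials on the right, (a + b)^2 \<le> 2 a^2 + 2 b^2 bounds the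
  left side by 1 - p^2 q^2, which is at most (1 - p^2) + (1 - q^2), and 1 - p^2 \<le> 2 (1 -
  p).\<close>

lemma one_minus_exp_subadditive:
  assumes "0 < s"
  shows "1 - exp (- ((a + b)\<^sup>2 / s)) \<le> 2 * (1 - exp (- (a\<^sup>2 / s))) + 2 * (1 - exp (- (b\<^sup>2 / s :: real)))"
proof -
  define p q where "p = exp (- (a\<^sup>2 / s))" and "q = exp (- (b\<^sup>2 / s))"
  have pq: "0 \<le> p" "p \<le> 1" "0 \<le> q" "q \<le> 1" using assms by (auto simp: p_def q_def)
  have "(a + b)\<^sup>2 \<le> 2 * a\<^sup>2 + 2 * b\<^sup>2"
    using sum_squares_bound[of a b] by (simp add: power2_sum)
  then have "(a + b)\<^sup>2 / s \<le> 2 * (a\<^sup>2 / s) + 2 * (b\<^sup>2 / s)"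
    using assms by (simp add: field_simps)
  then have "exp (- (2 * (a\<^sup>2 / s)) - 2 * (b\<^sup>2 / s)) \<le> exp (- ((a + b)\<^sup>2 / s))" by simp
  moreover have "exp (- (2 * (a\<^sup>2 / s)) - 2 * (b\<^sup>2 / s)) = p\<^sup>2 * q\<^sup>2"
    unfolding p_def q_def by (simp add: exp_diff exp_minus power2_eq_square exp_add[symmetric] divide_inverse)
      (simp add: exp_minus[symmetric] exp_add[symmetric] mult.assoc)
  moreover have "1 - p\<^sup>2 * q\<^sup>2 \<le> 2 * (1 - p) + 2 * (1 - q)"
  proof -
    have "1 - p\<^sup>2 \<le> 2 * (1 - p)" "1 - q\<^sup>2 \<le> 2 * (1 - q)"
      using zero_le_power2[of "1 - p"] zero_le_power2[of "1 - q"] by (auto simp: power2_eq_square algebra_simps)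
    moreover have "0 \<le> (1 - p\<^sup>2) * (1 - q\<^sup>2)"
      using pq by (intro mult_nonneg_nonneg) (auto simp: power_le_one)
    ultimately show ?thesis by (simp add: algebra_simps)
  qed
  ultimately show ?thesis unfolding p_def q_def by linarith
qed

lemma integrable_hellinger [simp]:
  assumes "f1 \<in> borel_measurable G" "f2 \<in> borel_measurable G"
  shows "integrable G (\<lambda>x. exp (- ((f1 x - f2 x)\<^sup>2 / (8 * \<sigma>\<^sup>2))))"
  using assms by (intro G.integrable_const_bound[where B = 1]) auto

text \<open>A triangle inequality for squares up to the factor 2, obtained by integrating a
  pointwise inequality in the values of the regression functions.\<close>

lemma hellinger_quasi_triangle:
  assumes [measurable]: "f1 \<in> borel_measurable G" "f2 \<in> borel_measurable G" "f3 \<in> borel_measurable G"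
  shows "(hell f1 f3)\<^sup>2 \<le> 2 * (hell f1 f2)\<^sup>2 + 2 * (hell f2 f3)\<^sup>2"
proof -
  let ?e = "\<lambda>f g x. 1 - exp (- ((f x - g x)\<^sup>2 / (8 * \<sigma>\<^sup>2)))"
  have eq: "(\<integral>x. ?e f g x \<partial>G) = 1 - (\<integral>x. exp (- ((f x - g x)\<^sup>2 / (8 * \<sigma>\<^sup>2))) \<partial>G)"
    if "f \<in> borel_measurable G" "g \<in> borel_measurable G" for f g
    using that by (subst Bochner_Integration.integral_diff) (auto simp: G.prob_space)
  have "?e f1 f3 x \<le> 2 * ?e f1 f2 x + 2 * ?e f2 f3 x" for x
    using one_minus_exp_subadditive[of "8 * \<sigma>\<^sup>2" "f1 x - f2 x" "f2 x - f3 x"] sigma by simp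
  then have "(\<integral>x. ?e f1 f3 x \<partial>G) \<le> (\<integral>x. 2 * ?e f1 f2 x + 2 * ?e f2 f3 x \<partial>G)"
    by (intro integral_mono) auto
  also have "\<dots> = 2 * (\<integral>x. ?e f1 f2 x \<partial>G) + 2 * (\<integral>x. ?e f2 f3 x \<partial>G)"
    by (subst Bochner_Integration.integral_add) auto
  finally have "1 - (\<integral>x. exp (- ((f1 x - f3 x)\<^sup>2 / (8 * \<sigma>\<^sup>2))) \<partial>G) \<le>
    2 * (1 - (\<integral>x. exp (- ((f1 x - f2 x)\<^sup>2 / (8 * \<sigma>\<^sup>2))) \<partial>G)) +
    2 * (1 - (\<integral>x. exp (- ((f2 x - f3 x)\<^sup>2 / (8 * \<sigma>\<^sup>2))) \<partial>G))"
    by (simp only: eq assms)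
  then show ?thesis unfolding hellinger_sq by (simp add: algebra_simps)
qed

text \<open>From exp(-t) \<ge> 1 - t. This direction survives unbounded functions: Hellinger
  separation forces L2 separation.\<close>

lemma hellinger_sq_le:
  assumes "integrable G (\<lambda>x. (f1 x - f2 x)\<^sup>2)" "f1 \<in> borel_measurable G" "f2 \<in> borel_measurable G"
  shows "(hell f1 f2)\<^sup>2 \<le> (\<integral>x. (f1 x - f2 x)\<^sup>2 \<partial>G) / (4 * \<sigma>\<^sup>2)"
proof -
  have "(\<integral>x. 1 - (f1 x - f2 x)\<^sup>2 / (8 * \<sigma>\<^sup>2) \<partial>G) \<le> (\<integral>x. exp (- ((f1 x - f2 x)\<^sup>2 / (8 * \<sigma>\<^sup>2))) \<partial>G)"
  proof (intro integral_mono)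
    show "1 - (f1 x - f2 x)\<^sup>2 / (8 * \<sigma>\<^sup>2) \<le> exp (- ((f1 x - f2 x)\<^sup>2 / (8 * \<sigma>\<^sup>2)))" for x
      using exp_ge_add_one_self[of "- ((f1 x - f2 x)\<^sup>2 / (8 * \<sigma>\<^sup>2))"] by simp
  qed (use assms in auto)
  moreover have "(\<integral>x. 1 - (f1 x - f2 x)\<^sup>2 / (8 * \<sigma>\<^sup>2) \<partial>G) = 1 - (\<integral>x. (f1 x - f2 x)\<^sup>2 \<partial>G) / (8 * \<sigma>\<^sup>2)"
    using assms by (subst Bochner_Integration.integral_diff) (auto simp: G.prob_space)
  ultimately show ?thesis unfolding hellinger_sq by simp
qed

lemma step_fn_measurable [measurable]:
  assumes "J \<ge> 1"
  shows "step_fn J \<theta> \<in> borel_measurable G"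
proof -
  have "(\<lambda>x. \<theta> (cidx J x)) \<in> borel_measurable G" by (rule comp_cidx_measurable[OF assms])
  then show ?thesis
    by (subst measurable_cong[where g = "\<lambda>x. \<theta> (cidx J x)"]) (auto simp: space_G step_fn_eq[OF assms])
qed

text \<open>Between step functions of one level the distance is an explicit continuous function of
  finitely many coefficients, which gives measurability in \<theta>.\<close>

lemma hellinger_step_fn:
  assumes "J \<ge> 1"
  shows "hell (step_fn J \<theta>) (step_fn J h) =
    sqrt (2 * (1 - (\<Sum>j\<in>grid J. measure G (cell J j) * exp (- ((\<theta> j - h j)\<^sup>2 / (8 * \<sigma>\<^sup>2))))))"
proof -
  have "(\<integral>x. exp (- ((step_fn J \<theta> x - step_fn J h x)\<^sup>2 / (8 * \<sigma>\<^sup>2))) \<partial>G) =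
    (\<integral>x. exp (- ((\<theta> (cidx J x) - h (cidx J x))\<^sup>2 / (8 * \<sigma>\<^sup>2))) \<partial>G)"
    by (intro Bochner_Integration.integral_cong) (auto simp: space_G step_fn_eq[OF assms])
  also have "\<dots> = (\<Sum>j\<in>grid J. measure G (cell J j) * exp (- ((\<theta> j - h j)\<^sup>2 / (8 * \<sigma>\<^sup>2))))"
    by (rule integral_comp_cidx[OF assms, of "\<lambda>j. exp (- ((\<theta> j - h j)\<^sup>2 / (8 * \<sigma>\<^sup>2)))"])
  finally show ?thesis by (simp add: hellinger_def)
qed

lemma tendsto_floor_grid: "(\<lambda>m. of_int \<lfloor>real (Suc m) * t\<rfloor> / real (Suc m)) \<longlonglongrightarrow> t"
proof (rule real_tendsto_sandwich[where f = "\<lambda>m. t - 1 / real (Suc m)" and h = "\<lambda>m. t"])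
  have "t - 1 / real (Suc m) \<le> of_int \<lfloor>real (Suc m) * t\<rfloor> / real (Suc m)" for m
  proof -
    have "real (Suc m) * t - 1 \<le> of_int \<lfloor>real (Suc m) * t\<rfloor>" by linarith
    then have "(real (Suc m) * t - 1) / real (Suc m) \<le> of_int \<lfloor>real (Suc m) * t\<rfloor> / real (Suc m)"
      by (rule divide_right_mono) simp
    then show ?thesis by (simp add: diff_divide_distrib del: of_nat_Suc)
  qed
  then show "\<forall>\<^sub>F m in sequentially. t - 1 / real (Suc m) \<le> of_int \<lfloor>real (Suc m) * t\<rfloor> / real (Suc m)"
    by simp
  have "of_int \<lfloor>real (Suc m) * t\<rfloor> / real (Suc m) \<le> t" for m
    by (simp add: divide_le_eq mult.commute del: of_nat_Suc)
  then show "\<forall>\<^sub>F m in sequentially. of_int \<lfloor>real (Suc m) * t\<rfloor> / real (Suc m) \<le> t" by simp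
  have "(\<lambda>m. t - inverse (real (Suc m))) \<longlonglongrightarrow> t - 0"
    by (intro tendsto_diff tendsto_const LIMSEQ_inverse_real_of_nat)
  then show "(\<lambda>m. t - 1 / real (Suc m)) \<longlonglongrightarrow> t" by (simp add: inverse_eq_divide)
qed simp

text \<open>Rounding down to a multiple of \<open>1 / m\<close> preserves monotonicity, so the infimum over the monotone step
  functions may be restricted to rational coefficients.\<close>

lemma hellinger_setdist_measurable:
  assumes J: "J \<ge> 1"
  shows "(\<lambda>\<theta>. hell_setdist (step_fn J \<theta>) (mono_step_fns J)) \<in> borel_measurable (prior n J)"
proof (subst borel_measurable_iff_less, intro allI)
  fix r :: real
  let ?M = "prior n J"
  define S where "S = {h \<in> (\<Pi>\<^sub>E j\<in>(grid J :: (nat ^ 'd) set). \<rat>). step_fn J h \<in> mono_fns}"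
  have "countable (\<Pi>\<^sub>E j\<in>(grid J :: (nat ^ 'd) set). (\<rat> :: real set))"
    by (intro countable_PiE finite_grid countable_rat)
  then have "countable S" by (rule countable_subset[rotated]) (auto simp: S_def)
  have "{\<theta> \<in> space ?M. hell_setdist (step_fn J \<theta>) (mono_step_fns J) < r} =
    (\<Union>h\<in>S. {\<theta> \<in> space ?M. hell (step_fn J \<theta>) (step_fn J h) < r})"
  proof (intro equalityI subsetI)
    fix \<theta> assume "\<theta> \<in> (\<Union>h\<in>S. {\<theta> \<in> space ?M. hell (step_fn J \<theta>) (step_fn J h) < r})"
    then obtain h where h: "h \<in> S" "\<theta> \<in> space ?M" "hell (step_fn J \<theta>) (step_fn J h) < r" by auto
    then have "step_fn J h \<in> mono_step_fns J" by (auto simp: S_def mono_step_fns_def step_fns_def)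
    with h show "\<theta> \<in> {\<theta> \<in> space ?M. hell_setdist (step_fn J \<theta>) (mono_step_fns J) < r}"
      by (auto simp: hellinger_setdist_less_iff[OF mono_step_fns_nonempty])
  next
    fix \<theta> assume "\<theta> \<in> {\<theta> \<in> space ?M. hell_setdist (step_fn J \<theta>) (mono_step_fns J) < r}"
    then have \<theta>: "\<theta> \<in> space ?M" and "\<exists>f\<in>mono_step_fns J. hell (step_fn J \<theta>) f < r"
      by (auto simp: hellinger_setdist_less_iff[OF mono_step_fns_nonempty])
    then obtain h where h: "step_fn J h \<in> mono_fns" "hell (step_fn J \<theta>) (step_fn J h) < r"
      by (auto simp: mono_step_fns_def step_fns_def)
    \<comment> \<open>The distance is continuous in the coefficients and the inequality
      \<open>< r\<close> is strict, so a fine enough rounding of \<open>h\<close> keeps it.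
      \<open>restrict\<close> makes the rounded vector an element of the countable set of
      extensional rational vectors.\<close>
    define hm where "hm m = restrict (\<lambda>j. of_int \<lfloor>real (Suc m) * h j\<rfloor> / real (Suc m)) (grid J)" for m
    have "(\<lambda>m. hell (step_fn J \<theta>) (step_fn J (hm m))) \<longlonglongrightarrow> hell (step_fn J \<theta>) (step_fn J h)"
      unfolding hellinger_step_fn[OF J]
    proof (intro tendsto_intros)
      fix j :: "nat ^ 'd" assume "j \<in> grid J"
      then show "(\<lambda>m. hm m j) \<longlonglongrightarrow> h j" using tendsto_floor_grid[of "h j"] by (simp add: hm_def)
    qed (use sigma in auto)
    from order_tendstoD(2)[OF this h(2)] obtain m where m: "hell (step_fn J \<theta>) (step_fn J (hm m)) < r"
      by (auto simp: eventually_sequentially)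
    have "step_fn J (hm m) \<in> mono_fns"
      unfolding mono_fns_def mem_Collect_eq monotone_on_def
    proof (intro ballI impI)
      fix x y :: "real ^ 'd" assume xy: "x \<in> cbox 0 1" "y \<in> cbox 0 1" "x \<le> y"
      have "step_fn J h x \<le> step_fn J h y"
        using h(1) xy by (auto simp: mono_fns_def monotone_on_def)
      then show "step_fn J (hm m) x \<le> step_fn J (hm m) y"
        using cidx_in_grid[OF J xy(1)] cidx_in_grid[OF J xy(2)] xy
        by (auto simp: step_fn_eq[OF J] hm_def simp del: of_nat_Suc intro!: divide_right_mono floor_mono mult_left_mono)
    qed
    moreover have "hm m \<in> (\<Pi>\<^sub>E j\<in>grid J. \<rat>)"
      by (auto simp: hm_def simp del: of_nat_Suc)
    ultimately show "\<theta> \<in> (\<Union>h\<in>S. {\<theta> \<in> space ?M. hell (step_fn J \<theta>) (step_fn J h) < r})"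
      using m \<theta> by (auto simp: S_def)
  qed
  also have "\<dots> \<in> sets ?M"
  proof (intro sets.countable_UN'' \<open>countable S\<close>)
    fix h
    have [measurable]: "(\<lambda>\<theta>. \<theta> j) \<in> borel_measurable ?M" if "j \<in> grid J" for j
      using that by (subst measurable_cong_sets[OF sets_coef_prior refl]) (rule measurable_component_singleton)
    have "(\<lambda>\<theta>. \<Sum>j\<in>grid J. measure G (cell J j) * exp (- ((\<theta> j - h j)\<^sup>2 / (8 * \<sigma>\<^sup>2)))) \<in> borel_measurable ?M"
      by (intro borel_measurable_sum) measurable
    then show "{\<theta> \<in> space ?M. hell (step_fn J \<theta>) (step_fn J h) < r} \<in> sets ?M"
      unfolding hellinger_step_fn[OF J] by measurable
  qed
  finally show "{\<theta> \<in> space ?M. hell_setdist (step_fn J \<theta>) (mono_step_fns J) < r} \<in> sets ?M" .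
qed

subsection \<open>Good events\<close>

text \<open>A sub-Gaussian parameter of the true errors, kept apart from the \<sigma> of the working
  likelihood.\<close>

definition sg :: real where
  "sg = (SOME s. s > 0 \<and> (\<forall>t. integrable Q (\<lambda>e. exp (t * e)) \<and> (\<integral>e. exp (t * e) \<partial>Q) \<le> exp (s\<^sup>2 * t\<^sup>2 / 2)))"

lemma sg: "sg > 0" "integrable Q (\<lambda>e. exp (t * e))" "(\<integral>e. exp (t * e) \<partial>Q) \<le> exp (sg\<^sup>2 * t\<^sup>2 / 2)"
proof -
  have "\<exists>s. s > 0 \<and> (\<forall>t. integrable Q (\<lambda>e. exp (t * e)) \<and> (\<integral>e. exp (t * e) \<partial>Q) \<le> exp (s\<^sup>2 * t\<^sup>2 / 2))"
    using Q_subgaussian unfolding subgaussian_def by blast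
  from someI_ex[OF this] show "sg > 0" "integrable Q (\<lambda>e. exp (t * e))"
    "(\<integral>e. exp (t * e) \<partial>Q) \<le> exp (sg\<^sup>2 * t\<^sup>2 / 2)"
    unfolding sg_def by blast+
qed

lemma sg_mgf: "(\<integral>\<^sup>+e. ennreal (exp (t * e)) \<partial>Q) \<le> ennreal (exp (sg\<^sup>2 * t\<^sup>2 / 2))"
  using sg(2,3)[of t] by (subst nn_integral_eq_integral) (auto intro: ennreal_leI)

abbreviation sample :: "nat \<Rightarrow> (nat \<Rightarrow> (real ^ 'd) \<times> real) measure" where
  "sample n \<equiv> \<Pi>\<^sub>M i\<in>{..<n}. G \<Otimes>\<^sub>M Q"

abbreviation pts :: "(nat \<Rightarrow> (real ^ 'd) \<times> real) \<Rightarrow> nat \<Rightarrow> real ^ 'd" where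
  "pts \<omega> \<equiv> \<lambda>i. fst (\<omega> i)"

abbreviation errs :: "(nat \<Rightarrow> (real ^ 'd) \<times> real) \<Rightarrow> nat \<Rightarrow> real" where
  "errs \<omega> \<equiv> \<lambda>i. snd (\<omega> i)"

lemma prob_space_GQ: "prob_space (G \<Otimes>\<^sub>M Q)"
proof -
  interpret GQ: pair_prob_space G Q ..
  show ?thesis by (rule GQ.prob_space_axioms)
qed

lemma pts_in_cube: "\<omega> \<in> space (sample n) \<Longrightarrow> i < n \<Longrightarrow> pts \<omega> i \<in> cbox 0 1"
  by (auto simp: space_PiM PiE_iff space_pair_measure space_G mem_Times_iff)

lemma nn_integral_fst_G:
  assumes [measurable]: "f \<in> borel_measurable G"
  shows "(\<integral>\<^sup>+p. f (fst p) \<partial>(G \<Otimes>\<^sub>M Q)) = (\<integral>\<^sup>+x. f x \<partial>G)"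
  by (subst Q.nn_integral_fst[symmetric]) (auto simp: Q.emeasure_space_1)

text \<open>A good event is encoded by a penalty \<open>\<Psi>\<close> with small integral that is at least \<open>1\<close> off the event. No
  measurability of \<open>\<Phi>\<close> is needed: the Bochner integral of a nonmeasurable function is \<open>0\<close>.\<close>

lemma true_expectation_le:
  assumes \<Phi>: "\<And>D. 0 \<le> \<Phi> D" "\<And>D. \<Phi> D \<le> (1 :: real)"
    and good: "\<And>\<omega>. \<omega> \<in> space (sample n) \<Longrightarrow> \<Psi> \<omega> < (1 :: ennreal) \<Longrightarrow>
      \<Phi> (\<lambda>i. (pts \<omega> i, f0 (pts \<omega> i) + errs \<omega> i)) = 0"
  shows "ennreal (true_expectation G Q f0 n \<Phi>) \<le> (\<integral>\<^sup>+\<omega>. \<Psi> \<omega> \<partial>sample n)"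
proof -
  let ?F = "\<lambda>\<omega>. \<Phi> (\<lambda>i. (pts \<omega> i, f0 (pts \<omega> i) + errs \<omega> i))"
  show ?thesis
  proof (cases "integrable (sample n) ?F")
    case True
    then have "ennreal (true_expectation G Q f0 n \<Phi>) = (\<integral>\<^sup>+\<omega>. ennreal (?F \<omega>) \<partial>sample n)"
      unfolding true_expectation_def using \<Phi> by (intro nn_integral_eq_integral[symmetric]) auto
    also have "\<dots> \<le> (\<integral>\<^sup>+\<omega>. \<Psi> \<omega> \<partial>sample n)"
    proof (intro nn_integral_mono)
      fix \<omega> assume "\<omega> \<in> space (sample n)"
      then show "ennreal (?F \<omega>) \<le> \<Psi> \<omega>"
        using good[of \<omega>] \<Phi>(2)[of "\<lambda>i. (pts \<omega> i, f0 (pts \<omega> i) + errs \<omega> i)"]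
        by (cases "\<Psi> \<omega> < 1") (auto simp: not_less intro: order.trans[of _ 1])
    qed
    finally show ?thesis .
  qed (simp add: true_expectation_def not_integrable_integral_eq)
qed

lemma observation_measurable: "i < n \<Longrightarrow> (\<lambda>\<omega>. \<omega> i) \<in> measurable (sample n) (G \<Otimes>\<^sub>M Q)"
  by (rule measurable_component_singleton) simp

lemma pts_measurable [measurable]: "i < n \<Longrightarrow> (\<lambda>\<omega>. fst (\<omega> i)) \<in> measurable (sample n) G"
  by (rule measurable_compose[OF observation_measurable measurable_fst])

lemma errs_measurable [measurable]: "i < n \<Longrightarrow> (\<lambda>\<omega>. snd (\<omega> i)) \<in> borel_measurable (sample n)"
  using measurable_compose[OF observation_measurable measurable_snd]
  by (simp add: measurable_cong_sets[OF refl Q_prob(2)])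

text \<open>A coefficient evaluated at a random cell index is measurable because the index takes
  finitely many values.\<close>

lemma select_cell_measurable:
  assumes "m \<ge> 1" "i < n" "\<And>j. F j \<in> borel_measurable (sample n)"
  shows "(\<lambda>\<omega>. F (cidx m (pts \<omega> i)) \<omega>) \<in> measurable (sample n) (borel :: real measure)"
proof (rule measurable_compose_countable'[where I = "grid m"])
  show "(\<lambda>\<omega>. cidx m (pts \<omega> i)) \<in> measurable (sample n) (count_space (grid m))"
    by (rule measurable_compose[OF pts_measurable[OF assms(2)] cidx_measurable[OF assms(1)]])
qed (use assms in \<open>auto intro: countable_finite finite_grid\<close>)

lemma cavg_measurable:
  assumes m: "m \<ge> 1" and v: "\<And>i. i < n \<Longrightarrow> v i \<in> borel_measurable (sample n)"
  shows "(\<lambda>\<omega>. cavg n (\<lambda>i. cidx m (pts \<omega> i)) (\<lambda>i. v i \<omega>) j) \<in> borel_measurable (sample n)"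
proof -
  have eq: "cavg n (\<lambda>i. cidx m (pts \<omega> i)) (\<lambda>i. v i \<omega>) j =
    (\<Sum>i<n. if cidx m (pts \<omega> i) = j then v i \<omega> else 0) / (\<Sum>i<n. if cidx m (pts \<omega> i) = j then 1 else 0)" for \<omega>
  proof -
    have set: "{i. i < n \<and> cidx m (pts \<omega> i) = j} = {i\<in>{..<n}. cidx m (pts \<omega> i) = j}" by auto
    have "real (card {i\<in>{..<n}. cidx m (pts \<omega> i) = j}) = (\<Sum>i<n. if cidx m (pts \<omega> i) = j then 1 else 0)"
      by (subst sum.inter_filter[OF finite_lessThan, symmetric]) simp
    then show ?thesis
      unfolding cavg_def set by (simp only: sum.inter_filter[OF finite_lessThan])
  qed
  have "(\<lambda>\<omega>. if cidx m (pts \<omega> i) = j then v i \<omega> else 0) \<in> borel_measurable (sample n)"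
    "(\<lambda>\<omega>. if cidx m (pts \<omega> i) = j then 1 else 0 :: real) \<in> borel_measurable (sample n)" if "i < n" for i
    using select_cell_measurable[OF m that, of "\<lambda>k \<omega>. if k = j then v i \<omega> else 0"]
      select_cell_measurable[OF m that, of "\<lambda>k \<omega>. if k = j then 1 else 0"] v[OF that] by auto
  then show ?thesis unfolding eq by (intro borel_measurable_divide borel_measurable_sum) auto
qed

section \<open>Lower bounds on cell counts\<close>

lemma ln_exp_inverse: "n \<ge> (1 :: nat) \<Longrightarrow> exp (- ln (real n)) = 1 / real n"
  by (simp add: exp_minus inverse_eq_divide)

text \<open>If m^d \<open>occ_const\<close> log n \<le> n, every cell of level m has expected count
  at least 16 log n, so a Chernoff bound gives n^(-4) per cell. The added 1 makes the constant at
  least 1, which keeps such levels below n.\<close>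

definition occ_const :: real where "occ_const = 16 / g_lo + 1"

definition occupied :: "nat \<Rightarrow> (nat \<Rightarrow> real ^ 'd) \<Rightarrow> bool" where
  "occupied n x \<longleftrightarrow> (\<forall>m\<ge>1. real m ^ CARD('d) * occ_const * ln (real n) \<le> real n \<longrightarrow>
     (\<forall>j\<in>grid m. real n * measure G (cell m j) / 4 \<le> real (card {i. i < n \<and> cidx m (x i) = j})))"

text \<open>Lower-tail Chernoff bound with exponential parameter 1. For a cell of mass p the moment
  per point is at most exp(-p / 2), and asking only for a quarter of the expected count leaves
  exp(-n p / 4).\<close>

lemma cell_penalty:
  assumes m: "m \<ge> 1" and j: "j \<in> grid m"
  shows "(\<integral>\<^sup>+\<omega>. ennreal (exp (real n * measure G (cell m j) / 4 - (\<Sum>i<n. indicator (cell m j) (pts \<omega> i)))) \<partial>sample n)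
    \<le> ennreal (exp (- (real n * measure G (cell m j) / 4)))"
proof -
  let ?p = "measure G (cell m j)"
  note cell_sets_G[OF m j, measurable]
  have [simp]: "integrable G (indicator (cell m j) :: _ \<Rightarrow> real)"
    by (intro integrable_real_indicator) (auto simp: less_top[symmetric])
  \<comment> \<open>Both sides agree off the cell; on it the claim is exp(-1) \<le> 1 / 2.\<close>
  have e1: "exp (- indicator (cell m j) x) \<le> 1 - indicator (cell m j) x / (2 :: real)" for x
    using exp_ge_add_one_self[of 1] by (auto simp: indicator_def exp_minus field_simps)
  have "(\<integral>\<^sup>+x. ennreal (exp (- indicator (cell m j) x)) \<partial>G) \<le> (\<integral>\<^sup>+x. ennreal (1 - indicator (cell m j) x / 2) \<partial>G)"
    using e1 by (intro nn_integral_mono ennreal_leI)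
  also have "\<dots> = ennreal (\<integral>x. 1 - indicator (cell m j) x / 2 \<partial>G)"
    by (intro nn_integral_eq_integral) (auto split: split_indicator)
  also have "(\<integral>x. 1 - indicator (cell m j) x / 2 \<partial>G) = 1 - ?p / 2"
    by (subst Bochner_Integration.integral_diff) (auto simp: G.prob_space)
  also have "ennreal (1 - ?p / 2) \<le> ennreal (exp (- ?p / 2))"
    using exp_ge_add_one_self[of "- ?p / 2"] by (intro ennreal_leI) simp
  finally have "(\<integral>\<^sup>+p. ennreal (exp (- indicator (cell m j) (fst p))) \<partial>(G \<Otimes>\<^sub>M Q)) \<le> ennreal (exp (- ?p / 2))"
    by (subst nn_integral_fst_G) auto
  then have *: "(\<integral>\<^sup>+\<omega>. ennreal (exp (\<Sum>i<n. - indicator (cell m j) (pts \<omega> i))) \<partial>sample n) \<le> ennreal (exp (\<Sum>i<n. - ?p / 2))"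
    by (intro nn_integral_exp_sum_le[OF prob_space_GQ, where h = "\<lambda>i p. - indicator (cell m j) (fst p)"]) auto
  have "(\<integral>\<^sup>+\<omega>. ennreal (exp (real n * ?p / 4 - (\<Sum>i<n. indicator (cell m j) (pts \<omega> i)))) \<partial>sample n) =
    (\<integral>\<^sup>+\<omega>. ennreal (exp (real n * ?p / 4)) * ennreal (exp (\<Sum>i<n. - indicator (cell m j) (pts \<omega> i))) \<partial>sample n)"
    by (simp add: ennreal_mult[symmetric] exp_add[symmetric] sum_negf)
  also have "\<dots> = ennreal (exp (real n * ?p / 4)) * (\<integral>\<^sup>+\<omega>. ennreal (exp (\<Sum>i<n. - indicator (cell m j) (pts \<omega> i))) \<partial>sample n)"
  proof (intro nn_integral_cmult)
    have "(\<lambda>\<omega>. indicator (cell m j) (pts \<omega> i) :: real) \<in> borel_measurable (sample n)" if "i < n" for i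
      using that by measurable
    then have [measurable]: "(\<lambda>\<omega>. \<Sum>i<n. - indicator (cell m j) (pts \<omega> i) :: real) \<in> borel_measurable (sample n)"
      by (intro borel_measurable_sum borel_measurable_uminus) auto
    show "(\<lambda>\<omega>. ennreal (exp (\<Sum>i<n. - indicator (cell m j) (pts \<omega> i)))) \<in> borel_measurable (sample n)"
      by measurable
  qed
  also have "\<dots> \<le> ennreal (exp (real n * ?p / 4)) * ennreal (exp (\<Sum>i<n. - ?p / 2))"
    by (intro mult_left_mono *) auto
  also have "\<dots> = ennreal (exp (- (real n * ?p / 4)))"
    by (simp add: ennreal_mult[symmetric] exp_add[symmetric] sum_negf)
  finally show ?thesis .
qed

lemma occupied_penalty:
  assumes n: "n \<ge> 1" "ln (real n) \<ge> 1"
  shows "\<exists>\<Psi>\<in>borel_measurable (sample n). (\<integral>\<^sup>+\<omega>. \<Psi> \<omega> \<partial>sample n) \<le> ennreal (1 / real n) \<and>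
    (\<forall>\<omega>\<in>space (sample n). \<Psi> \<omega> < 1 \<longrightarrow> occupied n (pts \<omega>))"
proof -
  \<comment> \<open>The upper end n makes the union bound finite. It excludes no relevant level,
    because the displayed condition already forces m \<le> n.\<close>
  define W where "W = {m \<in> {1..n}. real m ^ CARD('d) * occ_const * ln (real n) \<le> real n}"
  define F where "F m j \<omega> = ennreal (exp (real n * measure G (cell m j) / 4 - (\<Sum>i<n. indicator (cell m j) (pts \<omega> i))))" for m j \<omega>
  define \<Psi> where "\<Psi> \<omega> = (\<Sum>m\<in>W. \<Sum>j\<in>grid m. F m j \<omega>)" for \<omega>
  have occ: "1 \<le> occ_const" "16 \<le> g_lo * occ_const" using g_bounds(1) by (auto simp: occ_const_def field_simps)
  have Fm: "F m j \<in> borel_measurable (sample n)" if "m \<in> W" "j \<in> grid m" for m j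
  proof -
    note cell_sets_G[OF _ that(2), measurable]
    have "m \<ge> 1" using that by (auto simp: W_def)
    then have "(\<lambda>\<omega>. indicator (cell m j) (pts \<omega> i) :: real) \<in> borel_measurable (sample n)" if "i < n" for i
      using that by measurable
    then have [measurable]: "(\<lambda>\<omega>. \<Sum>i<n. indicator (cell m j) (pts \<omega> i) :: real) \<in> borel_measurable (sample n)"
      by (intro borel_measurable_sum) auto
    show ?thesis unfolding F_def by measurable
  qed
  \<comment> \<open>At most n levels, each with at most n cells, so n^(-4) per cell leaves more than
    enough room for a total of 1 / n.\<close>
  have Fi: "(\<integral>\<^sup>+\<omega>. F m j \<omega> \<partial>sample n) \<le> ennreal (exp (- (4 * ln (real n))))" if mj: "m \<in> W" "j \<in> grid m" for m j
  proof -
    have m: "m \<ge> 1" "real m ^ CARD('d) * occ_const * ln (real n) \<le> real n" using mj by (auto simp: W_def)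
    then have mp: "0 < real m ^ CARD('d)" by simp
    have "16 * ln (real n) \<le> g_lo * occ_const * ln (real n)" using occ n by (intro mult_right_mono) auto
    also have "\<dots> \<le> real n * (g_lo / real m ^ CARD('d))"
      using mult_left_mono[OF m(2), of g_lo] g_bounds(1) mp by (simp add: field_simps)
    also have "\<dots> \<le> real n * measure G (cell m j)"
      by (intro mult_left_mono measure_cell_bounds m mj) auto
    finally have "4 * ln (real n) \<le> real n * measure G (cell m j) / 4" by simp
    then have "ennreal (exp (- (real n * measure G (cell m j) / 4))) \<le> ennreal (exp (- (4 * ln (real n))))"
      by (intro ennreal_leI) simp
    then show ?thesis unfolding F_def by (rule order.trans[OF cell_penalty[OF m(1) mj(2)]])
  qed
  have cardg: "real (card (grid m :: (nat ^ 'd) set)) \<le> real n" if "m \<in> W" for m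
  proof -
    have "real m ^ CARD('d) * 1 \<le> real m ^ CARD('d) * (occ_const * ln (real n))"
      using occ n by (intro mult_left_mono) (auto intro: order.trans[OF _ mult_mono[of 1 _ 1]])
    also have "\<dots> \<le> real n" using that by (simp add: W_def mult.assoc)
    finally show ?thesis by (simp add: card_grid)
  qed
  have "\<Psi> \<in> borel_measurable (sample n)"
    unfolding \<Psi>_def using Fm by (intro borel_measurable_sum) auto
  moreover have "(\<integral>\<^sup>+\<omega>. \<Psi> \<omega> \<partial>sample n) \<le> ennreal (1 / real n)"
  proof -
    have "(\<integral>\<^sup>+\<omega>. \<Psi> \<omega> \<partial>sample n) = (\<Sum>m\<in>W. \<Sum>j\<in>grid m. \<integral>\<^sup>+\<omega>. F m j \<omega> \<partial>sample n)"
      unfolding \<Psi>_def using Fm by (subst nn_integral_sum, (auto intro!: borel_measurable_sum)[1], intro sum.cong refl nn_integral_sum) auto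
    also have "\<dots> \<le> (\<Sum>m\<in>W. \<Sum>j\<in>(grid m :: (nat ^ 'd) set). ennreal (exp (- (4 * ln (real n)))))"
      by (intro sum_mono Fi)
    also have "\<dots> \<le> (\<Sum>m\<in>W. ennreal (real n * exp (- (4 * ln (real n)))))"
    proof (intro sum_mono)
      fix m assume "m \<in> W"
      have "(\<Sum>j\<in>(grid m :: (nat ^ 'd) set). ennreal (exp (- (4 * ln (real n))))) =
        ennreal (real (card (grid m :: (nat ^ 'd) set)) * exp (- (4 * ln (real n))))"
        by (simp add: ennreal_mult ennreal_of_nat_eq_real_of_nat)
      also have "\<dots> \<le> ennreal (real n * exp (- (4 * ln (real n))))"
        using cardg[OF \<open>m \<in> W\<close>] by (intro ennreal_leI mult_right_mono) auto
      finally show "(\<Sum>j\<in>(grid m :: (nat ^ 'd) set). ennreal (exp (- (4 * ln (real n))))) \<le> ennreal (real n * exp (- (4 * ln (real n))))" .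
    qed
    also have "\<dots> = ennreal (real (card W) * (real n * exp (- (4 * ln (real n)))))"
      by (simp add: ennreal_mult ennreal_of_nat_eq_real_of_nat)
    also have "\<dots> \<le> ennreal (1 / real n)"
    proof (intro ennreal_leI)
      have "card W \<le> card {1..n}" unfolding W_def by (intro card_mono) auto
      then have "real (card W) * (real n * exp (- (4 * ln (real n)))) \<le> real n * (real n * exp (- (4 * ln (real n))))"
        by (intro mult_right_mono) auto
      also have "\<dots> = exp (ln (real n)) * exp (ln (real n)) * exp (- (4 * ln (real n)))" using n by simp
      also have "\<dots> \<le> exp (- ln (real n))" unfolding exp_add[symmetric] using n by simp
      finally show "real (card W) * (real n * exp (- (4 * ln (real n)))) \<le> 1 / real n"
        using n by (simp add: ln_exp_inverse)
    qed
    finally show ?thesis .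
  qed
  moreover have "occupied n (pts \<omega>)" if \<omega>: "\<omega> \<in> space (sample n)" "\<Psi> \<omega> < 1" for \<omega>
    unfolding occupied_def
  proof (intro allI impI ballI)
    fix m :: nat and j :: "nat ^ 'd"
    assume m: "1 \<le> m" "real m ^ CARD('d) * occ_const * ln (real n) \<le> real n" and j: "j \<in> grid m"
    have "real m ^ CARD('d) * 1 \<le> real m ^ CARD('d) * (occ_const * ln (real n))"
      using occ n by (intro mult_left_mono) (auto intro: order.trans[OF _ mult_mono[of 1 _ 1]])
    moreover have "real m \<le> real m ^ CARD('d)" using m(1) by (intro self_le_power) auto
    ultimately have "real m \<le> real n" using m(2) unfolding mult.assoc by linarith
    then have mW: "m \<in> W" using m by (simp add: W_def)
    have "F m j \<omega> \<le> (\<Sum>j\<in>grid m. F m j \<omega>)" using j by (intro member_le_sum finite_grid) auto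
    also have "\<dots> \<le> \<Psi> \<omega>" unfolding \<Psi>_def using mW by (intro member_le_sum[of m W "\<lambda>m. \<Sum>j\<in>grid m. F m j \<omega>"]) (auto simp: W_def)
    finally have "F m j \<omega> < 1" using \<omega>(2) by simp
    then have "exp (real n * measure G (cell m j) / 4 - (\<Sum>i<n. indicator (cell m j) (pts \<omega> i))) < exp 0"
      unfolding F_def by (simp add: ennreal_less_one_iff)
    then have "real n * measure G (cell m j) / 4 < (\<Sum>i<n. indicator (cell m j) (pts \<omega> i))" by simp
    also have "\<dots> = (\<Sum>i<n. if cidx m (pts \<omega> i) = j then 1 else 0)"
      using pts_in_cube[OF \<omega>(1)] m(1) j by (intro sum.cong) (auto simp: indicator_def cell_iff_cidx)
    also have "\<dots> = real (card {i. i < n \<and> cidx m (pts \<omega> i) = j})"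
      by (simp add: sum.inter_filter[symmetric])
    finally show "real n * measure G (cell m j) / 4 \<le> real (card {i. i < n \<and> cidx m (pts \<omega> i) = j})" by simp
  qed
  ultimately show ?thesis by blast
qed

section \<open>Noise terms, uniformly over all levels\<close>

definition noise_small :: "nat \<Rightarrow> (nat \<Rightarrow> real ^ 'd) \<Rightarrow> (nat \<Rightarrow> real) \<Rightarrow> bool" where
  "noise_small n x e \<longleftrightarrow> (\<forall>m\<ge>1. (\<Sum>i<n. (fit n x e m (cidx m (x i)))\<^sup>2)
     \<le> 12 * sg\<^sup>2 * (real m ^ CARD('d) + ln (real n)))"

text \<open>Given the design, the part of v orthogonal to level m is a single direction, so log n is
  the true order and the summand m only makes the probabilities summable over the levels. Doubled in
  the expansion of a square, the fraction 1/8 costs a quarter of the squared residual.\<close>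

definition cross_small :: "nat \<Rightarrow> (nat \<Rightarrow> real ^ 'd) \<Rightarrow> (nat \<Rightarrow> real) \<Rightarrow> (nat \<Rightarrow> real) \<Rightarrow> bool" where
  "cross_small n x e v \<longleftrightarrow> (\<forall>m\<ge>1. \<bar>\<Sum>i<n. e i * (v i - fit n x v m (cidx m (x i)))\<bar>
     \<le> (\<Sum>i<n. (v i - fit n x v m (cidx m (x i)))\<^sup>2) / 8 + 4 * sg\<^sup>2 * (3 * ln (real n) + real m))"

text \<open>The union bound over all levels at once, with weights (1/2)^(k+1); index k stands for
  level k + 1.\<close>

lemma geometric_penalty:
  assumes F: "\<And>k. F k \<in> borel_measurable (sample n)"
    and le: "\<And>k. (\<integral>\<^sup>+\<omega>. F k \<omega> \<partial>sample n) \<le> ennreal ((1 / 2) ^ Suc k * B)" and B: "0 \<le> B"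
  shows "(\<lambda>\<omega>. \<Sum>k. F k \<omega>) \<in> borel_measurable (sample n)"
    and "(\<integral>\<^sup>+\<omega>. (\<Sum>k. F k \<omega>) \<partial>sample n) \<le> ennreal B"
proof -
  show "(\<lambda>\<omega>. \<Sum>k. F k \<omega>) \<in> borel_measurable (sample n)" using F by measurable
  have "(\<integral>\<^sup>+\<omega>. (\<Sum>k. F k \<omega>) \<partial>sample n) = (\<Sum>k. \<integral>\<^sup>+\<omega>. F k \<omega> \<partial>sample n)"
    using F by (intro nn_integral_suminf) auto
  also have "\<dots> \<le> (\<Sum>k. ennreal ((1 / 2) ^ Suc k * B))" by (intro suminf_le le) auto
  also have "\<dots> = ennreal B"
    using B sums_mult2[OF power_half_series, of B]
    by (subst suminf_ennreal_eq[where x = B]) auto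
  finally show "(\<integral>\<^sup>+\<omega>. (\<Sum>k. F k \<omega>) \<partial>sample n) \<le> ennreal B" .
qed

lemma exp_minus3_le: "exp (- 3) \<le> 1 / (4 :: real)"
  using exp_ge_add_one_self[of "3 :: real"] by (simp add: exp_minus field_simps)

text \<open>Chernoff bound for the quadratic form with the design fixed: the exponential moment is
  at most 2^(m^d).\<close>

lemma noise_penalty:
  assumes n: "n \<ge> 1"
  shows "\<exists>\<Psi>\<in>borel_measurable (sample n). (\<integral>\<^sup>+\<omega>. \<Psi> \<omega> \<partial>sample n) \<le> ennreal (1 / real n) \<and>
    (\<forall>\<omega>\<in>space (sample n). \<Psi> \<omega> < 1 \<longrightarrow> noise_small n (pts \<omega>) (errs \<omega>))"
proof -
  define V where "V m \<omega> = (\<Sum>i<n. (fit n (pts \<omega>) (errs \<omega>) m (cidx m (pts \<omega> i)))\<^sup>2)" for m \<omega>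
  \<comment> \<open>The 3 in front of m^d beats 2^(m^d), since exp(-3) \<le> 1/4 leaves (1/2)^(m^d).
    Multiplied by 4 \<open>sg\<close>^2 it gives the 12 of \<open>noise_small\<close>.\<close>
  define c where "c m = 3 * real m ^ CARD('d) + 3 * ln (real n)" for m
  define F where "F k \<omega> = ennreal (exp (V (Suc k) \<omega> / (4 * sg\<^sup>2) - c (Suc k)))" for k \<omega>
  have V[measurable]: "V (Suc k) \<in> borel_measurable (sample n)" for k
    unfolding V_def[abs_def]
  proof (intro borel_measurable_sum borel_measurable_power)
    fix i assume i: "i \<in> {..<n}"
    show "(\<lambda>\<omega>. fit n (pts \<omega>) (errs \<omega>) (Suc k) (cidx (Suc k) (pts \<omega> i))) \<in> borel_measurable (sample n)"
      using i by (intro select_cell_measurable[where F = "\<lambda>j \<omega>. fit n (pts \<omega>) (errs \<omega>) (Suc k) j"]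
        cavg_measurable[where v = "\<lambda>i \<omega>. errs \<omega> i"]) auto
  qed
  have F_meas: "F k \<in> borel_measurable (sample n)" for k unfolding F_def[abs_def] by measurable
  have F_int: "(\<integral>\<^sup>+\<omega>. F k \<omega> \<partial>sample n) \<le> ennreal ((1 / 2) ^ Suc k * (1 / real n))" for k
  proof -
    define m where "m = Suc k"
    have "(\<integral>\<^sup>+\<omega>. F k \<omega> \<partial>sample n) \<le> 2 ^ (m ^ CARD('d)) * ennreal (exp (- c m))"
    proof (rule nn_integral_PiM_pair_le[OF G_prob Q_prob(1) _ F_meas])
      fix x assume x: "x \<in> space (\<Pi>\<^sub>M i\<in>{..<n}. G)"
      have cube: "x i \<in> cbox 0 1" if "i < n" for i
        using x that by (auto simp: space_PiM PiE_iff space_G)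
      let ?c = "\<lambda>i. cidx m (x i)"
      let ?V = "\<lambda>e. \<Sum>i<n. (cavg n ?c e (?c i))\<^sup>2"
      have [measurable]: "?V \<in> borel_measurable (\<Pi>\<^sub>M i\<in>{..<n}. Q)"
        using measurable_cavg_fixed[OF Q_prob(2)] by (intro borel_measurable_sum borel_measurable_power)
      have Veq: "V m (\<lambda>i\<in>{..<n}. (x i, e i)) = ?V e" for e
        unfolding V_def by (intro sum.cong refl arg_cong[where f = "\<lambda>a. a\<^sup>2"]) (auto intro!: cavg_cong)
      have "(\<integral>\<^sup>+e. F k (\<lambda>i\<in>{..<n}. (x i, e i)) \<partial>(\<Pi>\<^sub>M i\<in>{..<n}. Q)) =
        (\<integral>\<^sup>+e. ennreal (exp (?V e / (4 * sg\<^sup>2))) * ennreal (exp (- c m)) \<partial>(\<Pi>\<^sub>M i\<in>{..<n}. Q))"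
        unfolding F_def m_def[symmetric] Veq by (simp add: ennreal_mult[symmetric] exp_add[symmetric])
      also have "\<dots> = (\<integral>\<^sup>+e. ennreal (exp (?V e / (4 * sg\<^sup>2))) \<partial>(\<Pi>\<^sub>M i\<in>{..<n}. Q)) * ennreal (exp (- c m))"
        by (intro nn_integral_multc) measurable
      also have "\<dots> \<le> 2 ^ card (grid m :: (nat ^ 'd) set) * ennreal (exp (- c m))"
        using cidx_in_grid[OF _ cube] sg(1)
        by (intro mult_right_mono subgaussian_quadratic[OF Q_prob _ _ finite_grid] sg_mgf) (auto simp: m_def)
      finally show "(\<integral>\<^sup>+e. F k (\<lambda>i\<in>{..<n}. (x i, e i)) \<partial>(\<Pi>\<^sub>M i\<in>{..<n}. Q)) \<le> 2 ^ (m ^ CARD('d)) * ennreal (exp (- c m))"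
        by (simp add: card_grid)
    qed simp
    also have "\<dots> = ennreal (2 ^ (m ^ CARD('d)) * exp (- c m))"
      by (simp add: ennreal_mult ennreal_power[symmetric])
    also have "\<dots> \<le> ennreal ((1 / 2) ^ Suc k * (1 / real n))"
    proof (intro ennreal_leI)
      have "exp (- c m) = exp (- 3) ^ (m ^ CARD('d)) * exp (- (3 * ln (real n)))"
        by (simp add: c_def exp_of_nat_mult[symmetric] exp_add[symmetric])
      also have "\<dots> \<le> (1 / 4) ^ (m ^ CARD('d)) * exp (- ln (real n))"
        using n by (intro mult_mono power_mono exp_minus3_le) auto
      finally have "exp (- c m) \<le> (1 / 4) ^ (m ^ CARD('d)) * (1 / real n)"
        using n by (simp add: ln_exp_inverse)
      then have "2 ^ (m ^ CARD('d)) * exp (- c m) \<le> 2 ^ (m ^ CARD('d)) * ((1 / 4) ^ (m ^ CARD('d)) * (1 / real n))"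
        by (rule mult_left_mono) simp
      also have "\<dots> = (1 / 2) ^ (m ^ CARD('d)) * (1 / real n)"
        by (simp add: power_mult_distrib[symmetric] mult.assoc[symmetric] del: mult_numeral_1_right)
      also have "\<dots> \<le> (1 / 2) ^ Suc k * (1 / real n)"
        unfolding m_def by (intro mult_right_mono power_decreasing self_le_power) auto
      finally show "2 ^ (m ^ CARD('d)) * exp (- c m) \<le> (1 / 2) ^ Suc k * (1 / real n)" .
    qed
    finally show ?thesis .
  qed
  have "noise_small n (pts \<omega>) (errs \<omega>)" if "\<omega> \<in> space (sample n)" "(\<Sum>k. F k \<omega>) < 1" for \<omega>
    unfolding noise_small_def
  proof (intro allI impI)
    fix m :: nat assume "m \<ge> 1"
    then obtain k where k: "m = Suc k" by (cases m) auto
    have "F k \<omega> < 1" by (rule ennreal_suminf_lessD[OF that(2)])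
    then have "V m \<omega> / (4 * sg\<^sup>2) < c m" by (simp add: F_def k ennreal_less_one_iff)
    then have "V m \<omega> < 4 * sg\<^sup>2 * c m" using sg(1) by (simp add: field_simps)
    then show "(\<Sum>i<n. (fit n (pts \<omega>) (errs \<omega>) m (cidx m (pts \<omega> i)))\<^sup>2) \<le> 12 * sg\<^sup>2 * (real m ^ CARD('d) + ln (real n))"
      by (simp add: V_def c_def algebra_simps)
  qed
  then show ?thesis
    using geometric_penalty[OF F_meas F_int] by (intro bexI[where x = "\<lambda>\<omega>. \<Sum>k. F k \<omega>"]) auto
qed

text \<open>With the design fixed the cross term is linear in the errors, so the sub-Gaussian bound
  applies directly. The signs b = 1 and b = -1 give the absolute value and the total 2 / n.\<close>

lemma cross_penalty:
  assumes n: "n \<ge> 1" and v: "v \<in> borel_measurable G"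
  shows "\<exists>\<Psi>\<in>borel_measurable (sample n). (\<integral>\<^sup>+\<omega>. \<Psi> \<omega> \<partial>sample n) \<le> ennreal (2 / real n) \<and>
    (\<forall>\<omega>\<in>space (sample n). \<Psi> \<omega> < 1 \<longrightarrow> cross_small n (pts \<omega>) (errs \<omega>) (\<lambda>i. v (pts \<omega> i)))"
proof -
  note v[measurable]
  define a where "a m \<omega> i = v (pts \<omega> i) - fit n (pts \<omega>) (\<lambda>i. v (pts \<omega> i)) m (cidx m (pts \<omega> i))" for m \<omega> i
  \<comment> \<open>After division by t the variance term \<open>sg\<close>^2 t / 2 becomes 1/8 and
    the threshold is multiplied by 1 / t = 4 \<open>sg\<close>^2.\<close>
  define t where "t = 1 / (4 * sg\<^sup>2)"
  define c where "c m = 3 * ln (real n) + real m" for m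
  define H where "H b k \<omega> = ennreal (exp (b * t * (\<Sum>i<n. errs \<omega> i * a (Suc k) \<omega> i)
     - sg\<^sup>2 * t\<^sup>2 / 2 * (\<Sum>i<n. (a (Suc k) \<omega> i)\<^sup>2) - c (Suc k)))" for b :: real and k \<omega>
  define F where "F k \<omega> = H 1 k \<omega> + H (- 1) k \<omega>" for k \<omega>
  have a_meas: "(\<lambda>\<omega>. a (Suc k) \<omega> i) \<in> borel_measurable (sample n)" if i: "i < n" for k i
  proof -
    have 1: "(\<lambda>\<omega>. v (pts \<omega> i)) \<in> borel_measurable (sample n)" if "i < n" for i
      using that by measurable
    have "(\<lambda>\<omega>. fit n (pts \<omega>) (\<lambda>i. v (pts \<omega> i)) (Suc k) (cidx (Suc k) (pts \<omega> i))) \<in> borel_measurable (sample n)"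
      using i 1 by (intro select_cell_measurable[where F = "\<lambda>j \<omega>. fit n (pts \<omega>) (\<lambda>i. v (pts \<omega> i)) (Suc k) j"]
        cavg_measurable[where v = "\<lambda>i \<omega>. v (pts \<omega> i)"]) auto
    then show ?thesis unfolding a_def using 1[OF i] by measurable
  qed
  have H_meas: "H b k \<in> borel_measurable (sample n)" for b k
  proof -
    have [measurable]: "(\<lambda>\<omega>. \<Sum>i<n. errs \<omega> i * a (Suc k) \<omega> i) \<in> borel_measurable (sample n)"
      "(\<lambda>\<omega>. \<Sum>i<n. (a (Suc k) \<omega> i)\<^sup>2) \<in> borel_measurable (sample n)"
      using a_meas errs_measurable by (auto intro!: borel_measurable_sum borel_measurable_times borel_measurable_power)
    show ?thesis unfolding H_def[abs_def] by measurable
  qed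
  have H_int: "(\<integral>\<^sup>+\<omega>. H b k \<omega> \<partial>sample n) \<le> ennreal ((1 / 2) ^ Suc k * (1 / real n))" if b: "b\<^sup>2 = 1" for b k
  proof -
    define m where "m = Suc k"
    have "(\<integral>\<^sup>+\<omega>. H b k \<omega> \<partial>sample n) \<le> ennreal (exp (- c m))"
    proof (rule nn_integral_PiM_pair_le[OF G_prob Q_prob(1) _ H_meas])
      fix x assume x: "x \<in> space (\<Pi>\<^sub>M i\<in>{..<n}. G)"
      define \<alpha> where "\<alpha> i = v (x i) - fit n x (\<lambda>i. v (x i)) m (cidx m (x i))" for i
      define S where "S = sg\<^sup>2 * t\<^sup>2 / 2 * (\<Sum>i<n. (\<alpha> i)\<^sup>2)"
      have aeq: "a m (\<lambda>i\<in>{..<n}. (x i, e i)) i = \<alpha> i" if "i < n" for i e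
        unfolding a_def \<alpha>_def using that by (auto intro!: cavg_cong)
      have [measurable]: "(\<lambda>e. \<Sum>i<n. b * t * \<alpha> i * e i) \<in> borel_measurable (\<Pi>\<^sub>M i\<in>{..<n}. Q)"
      proof (intro borel_measurable_sum borel_measurable_times borel_measurable_const)
        fix i assume "i \<in> {..<n}"
        then have "(\<lambda>e. e i) \<in> measurable (\<Pi>\<^sub>M i\<in>{..<n}. Q) Q" by (intro measurable_component_singleton)
        then show "(\<lambda>e. e i) \<in> borel_measurable (\<Pi>\<^sub>M i\<in>{..<n}. Q)"
          by (simp add: measurable_cong_sets[OF refl Q_prob(2)])
      qed
      have "H b k (\<lambda>i\<in>{..<n}. (x i, e i)) = ennreal (exp (\<Sum>i<n. b * t * \<alpha> i * e i)) * ennreal (exp (- S - c m))" for e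
      proof -
        have "(\<Sum>i<n. errs (\<lambda>i\<in>{..<n}. (x i, e i)) i * a m (\<lambda>i\<in>{..<n}. (x i, e i)) i) = (\<Sum>i<n. e i * \<alpha> i)"
          using aeq by (intro sum.cong) auto
        moreover have "(\<Sum>i<n. (a m (\<lambda>i\<in>{..<n}. (x i, e i)) i)\<^sup>2) = (\<Sum>i<n. (\<alpha> i)\<^sup>2)"
          using aeq by (intro sum.cong) auto
        moreover have "b * t * (\<Sum>i<n. e i * \<alpha> i) = (\<Sum>i<n. b * t * \<alpha> i * e i)"
          by (simp add: sum_distrib_left algebra_simps)
        ultimately show ?thesis
          unfolding H_def m_def[symmetric] S_def by (simp add: ennreal_mult[symmetric] exp_add[symmetric] diff_diff_eq)
      qed
      then have "(\<integral>\<^sup>+e. H b k (\<lambda>i\<in>{..<n}. (x i, e i)) \<partial>(\<Pi>\<^sub>M i\<in>{..<n}. Q)) =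
        (\<integral>\<^sup>+e. ennreal (exp (\<Sum>i<n. b * t * \<alpha> i * e i)) \<partial>(\<Pi>\<^sub>M i\<in>{..<n}. Q)) * ennreal (exp (- S - c m))"
        by (simp add: nn_integral_multc)
      also have "\<dots> \<le> ennreal (exp (\<Sum>i<n. sg\<^sup>2 * (b * t * \<alpha> i)\<^sup>2 / 2)) * ennreal (exp (- S - c m))"
        by (intro mult_right_mono nn_integral_exp_sum_le[OF Q_prob(1), where h = "\<lambda>i e. b * t * \<alpha> i * e"] sg_mgf) auto
      also have "(\<Sum>i<n. sg\<^sup>2 * (b * t * \<alpha> i)\<^sup>2 / 2) = S"
        unfolding S_def by (simp add: sum_distrib_left power_mult_distrib b algebra_simps)
      also have "ennreal (exp S) * ennreal (exp (- S - c m)) = ennreal (exp (- c m))"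
        by (simp add: ennreal_mult[symmetric] exp_add[symmetric])
      finally show "(\<integral>\<^sup>+e. H b k (\<lambda>i\<in>{..<n}. (x i, e i)) \<partial>(\<Pi>\<^sub>M i\<in>{..<n}. Q)) \<le> ennreal (exp (- c m))" .
    qed simp
    also have "\<dots> \<le> ennreal ((1 / 2) ^ Suc k * (1 / real n))"
    proof (intro ennreal_leI)
      have half: "exp (- 1) \<le> 1 / (2 :: real)"
        using exp_ge_add_one_self[of "1 :: real"] by (simp add: exp_minus field_simps)
      have "exp (- c m) = exp (- 1) ^ m * exp (- (3 * ln (real n)))"
        by (simp add: c_def exp_of_nat_mult[symmetric] exp_add[symmetric])
      also have "\<dots> \<le> (1 / 2) ^ m * exp (- ln (real n))"
        using n by (intro mult_mono power_mono half) auto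
      finally show "exp (- c m) \<le> (1 / 2) ^ Suc k * (1 / real n)"
        using n by (simp add: ln_exp_inverse m_def)
    qed
    finally show ?thesis .
  qed
  have F_meas: "F k \<in> borel_measurable (sample n)" for k
    unfolding F_def[abs_def] using H_meas by measurable
  have F_int: "(\<integral>\<^sup>+\<omega>. F k \<omega> \<partial>sample n) \<le> ennreal ((1 / 2) ^ Suc k * (2 / real n))" for k
  proof -
    have "(\<integral>\<^sup>+\<omega>. F k \<omega> \<partial>sample n) = (\<integral>\<^sup>+\<omega>. H 1 k \<omega> \<partial>sample n) + (\<integral>\<^sup>+\<omega>. H (- 1) k \<omega> \<partial>sample n)"
      unfolding F_def by (intro nn_integral_add H_meas)
    also have "\<dots> \<le> ennreal ((1 / 2) ^ Suc k * (1 / real n)) + ennreal ((1 / 2) ^ Suc k * (1 / real n))"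
      by (intro add_mono H_int) auto
    also have "\<dots> = ennreal ((1 / 2) ^ Suc k * (2 / real n))"
      by (simp add: ennreal_plus[symmetric] del: ennreal_plus power_Suc)
    finally show ?thesis .
  qed
  have "cross_small n (pts \<omega>) (errs \<omega>) (\<lambda>i. v (pts \<omega> i))" if "\<omega> \<in> space (sample n)" "(\<Sum>k. F k \<omega>) < 1" for \<omega>
    unfolding cross_small_def
  proof (intro allI impI)
    fix m :: nat assume "m \<ge> 1"
    then obtain k where k: "m = Suc k" by (cases m) auto
    have "F k \<omega> < 1" by (rule ennreal_suminf_lessD[OF that(2)])
    then have "H 1 k \<omega> < 1" "H (- 1) k \<omega> < 1"
      unfolding F_def by (auto intro: le_less_trans[rotated])
    then have *: "b * t * (\<Sum>i<n. errs \<omega> i * a m \<omega> i) < sg\<^sup>2 * t\<^sup>2 / 2 * (\<Sum>i<n. (a m \<omega> i)\<^sup>2) + c m" if "b = 1 \<or> b = - 1" for b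
      using that by (auto simp: H_def k ennreal_less_one_iff)
    have s4: "0 < 4 * sg\<^sup>2" using sg(1) by simp
    have "b * (\<Sum>i<n. errs \<omega> i * a m \<omega> i) \<le> (\<Sum>i<n. (a m \<omega> i)\<^sup>2) / 8 + 4 * sg\<^sup>2 * c m" if "b = 1 \<or> b = - 1" for b
    proof -
      have "(4 * sg\<^sup>2) * (b * t * (\<Sum>i<n. errs \<omega> i * a m \<omega> i)) \<le> (4 * sg\<^sup>2) * (sg\<^sup>2 * t\<^sup>2 / 2 * (\<Sum>i<n. (a m \<omega> i)\<^sup>2) + c m)"
        using *[OF that] s4 by (intro mult_left_mono) auto
      moreover have "(4 * sg\<^sup>2) * (b * t * z) = b * z" for z
        using sg(1) by (simp add: t_def)
      moreover have "(4 * sg\<^sup>2) * (sg\<^sup>2 * t\<^sup>2 / 2 * z + c m) = z / 8 + 4 * sg\<^sup>2 * c m" for z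
        using sg(1) by (simp add: t_def power2_eq_square field_simps)
      ultimately show ?thesis by simp
    qed
    from this[of 1] this[of "-1"]
    show "\<bar>\<Sum>i<n. errs \<omega> i * (v (pts \<omega> i) - fit n (pts \<omega>) (\<lambda>i. v (pts \<omega> i)) m (cidx m (pts \<omega> i)))\<bar>
     \<le> (\<Sum>i<n. (v (pts \<omega> i) - fit n (pts \<omega>) (\<lambda>i. v (pts \<omega> i)) m (cidx m (pts \<omega> i)))\<^sup>2) / 8 + 4 * sg\<^sup>2 * (3 * ln (real n) + real m)"
      by (simp add: a_def c_def abs_le_iff)
  qed
  then show ?thesis
    using geometric_penalty[OF F_meas F_int] by (intro bexI[where x = "\<lambda>\<omega>. \<Sum>k. F k \<omega>"]) auto
qed

text \<open>For u in [0, 1], exp(u) \<le> 1 + 2 u, so the exponential moment of w / B is at most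
  exp(2 \<kappa> / B). A threshold of four times the bound on the mean doubles this exponent and
  leaves an exponentially small probability.\<close>

lemma empirical_mean_penalty:
  assumes w: "w \<in> borel_measurable G" "\<And>x. x \<in> cbox 0 1 \<Longrightarrow> 0 \<le> w x \<and> w x \<le> B"
    and B: "0 < B" and \<kappa>: "(\<integral>x. w x \<partial>G) \<le> \<kappa>" "0 \<le> \<kappa>"
  shows "\<exists>\<Psi>\<in>borel_measurable (sample n). (\<integral>\<^sup>+\<omega>. \<Psi> \<omega> \<partial>sample n) \<le> ennreal (exp (- (2 * \<kappa> / B * real n))) \<and>
    (\<forall>\<omega>\<in>space (sample n). \<Psi> \<omega> < 1 \<longrightarrow> (\<Sum>i<n. w (pts \<omega> i)) \<le> 4 * \<kappa> * real n)"
proof -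
  note w(1)[measurable]
  have int: "integrable G w"
    using w(2) by (intro G.integrable_const_bound[where B = B] AE_I2) (auto simp: space_G)
  have [measurable]: "(\<lambda>\<omega>. \<Sum>i<n. w (pts \<omega> i) / B) \<in> borel_measurable (sample n)"
    by (intro borel_measurable_sum) simp
  define \<Psi> where "\<Psi> \<omega> = ennreal (exp ((\<Sum>i<n. w (pts \<omega> i) / B) - 4 * \<kappa> / B * real n))" for \<omega>
  have "(\<integral>\<^sup>+x. ennreal (exp (w x / B)) \<partial>G) \<le> (\<integral>\<^sup>+x. ennreal (1 + 2 * (w x / B)) \<partial>G)"
  proof (intro nn_integral_mono ennreal_leI)
    fix x assume "x \<in> space G"
    then have u: "0 \<le> w x / B" "w x / B \<le> 1" using w(2) B by (auto simp: space_G)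
    have "exp (w x / B) \<le> 1 + w x / B + (w x / B)\<^sup>2" by (rule exp_bound[OF u])
    moreover have "(w x / B)\<^sup>2 \<le> w x / B" unfolding power2_eq_square by (rule mult_left_le[OF u(2) u(1)])
    ultimately show "exp (w x / B) \<le> 1 + 2 * (w x / B)" by simp
  qed
  also have "\<dots> = ennreal (\<integral>x. 1 + 2 * (w x / B) \<partial>G)"
    using int w(2) B by (intro nn_integral_eq_integral AE_I2) (auto simp: space_G)
  also have "(\<integral>x. 1 + 2 * (w x / B) \<partial>G) = 1 + 2 * ((\<integral>x. w x \<partial>G) / B)"
    using int by (subst Bochner_Integration.integral_add) (auto simp: G.prob_space)
  also have "ennreal (1 + 2 * ((\<integral>x. w x \<partial>G) / B)) \<le> ennreal (exp (2 * \<kappa> / B))"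
  proof (intro ennreal_leI)
    have "1 + 2 * ((\<integral>x. w x \<partial>G) / B) \<le> 1 + 2 * \<kappa> / B"
      using \<kappa> B by (simp add: divide_right_mono)
    also have "\<dots> \<le> exp (2 * \<kappa> / B)" by (rule exp_ge_add_one_self)
    finally show "1 + 2 * ((\<integral>x. w x \<partial>G) / B) \<le> exp (2 * \<kappa> / B)" .
  qed
  finally have "(\<integral>\<^sup>+p. ennreal (exp (w (fst p) / B)) \<partial>(G \<Otimes>\<^sub>M Q)) \<le> ennreal (exp (2 * \<kappa> / B))"
    by (subst nn_integral_fst_G) auto
  then have *: "(\<integral>\<^sup>+\<omega>. ennreal (exp (\<Sum>i<n. w (pts \<omega> i) / B)) \<partial>sample n) \<le> ennreal (exp (\<Sum>i<n. 2 * \<kappa> / B))"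
    by (intro nn_integral_exp_sum_le[OF prob_space_GQ, where h = "\<lambda>i p. w (fst p) / B"]) auto
  have "(\<integral>\<^sup>+\<omega>. \<Psi> \<omega> \<partial>sample n) = (\<integral>\<^sup>+\<omega>. ennreal (exp (\<Sum>i<n. w (pts \<omega> i) / B)) * ennreal (exp (- (4 * \<kappa> / B * real n))) \<partial>sample n)"
    by (simp add: \<Psi>_def ennreal_mult[symmetric] exp_add[symmetric])
  also have "\<dots> = (\<integral>\<^sup>+\<omega>. ennreal (exp (\<Sum>i<n. w (pts \<omega> i) / B)) \<partial>sample n) * ennreal (exp (- (4 * \<kappa> / B * real n)))"
    by (intro nn_integral_multc) measurable
  also have "\<dots> \<le> ennreal (exp (\<Sum>i<n. 2 * \<kappa> / B)) * ennreal (exp (- (4 * \<kappa> / B * real n)))"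
    by (intro mult_right_mono *) auto
  also have "\<dots> = ennreal (exp (- (2 * \<kappa> / B * real n)))"
    by (simp add: ennreal_mult[symmetric] exp_add[symmetric] algebra_simps)
  finally have "(\<integral>\<^sup>+\<omega>. \<Psi> \<omega> \<partial>sample n) \<le> ennreal (exp (- (2 * \<kappa> / B * real n)))" .
  moreover have "\<Psi> \<in> borel_measurable (sample n)" unfolding \<Psi>_def[abs_def] by measurable
  moreover have "(\<Sum>i<n. w (pts \<omega> i)) \<le> 4 * \<kappa> * real n" if "\<Psi> \<omega> < 1" for \<omega>
  proof -
    have "(\<Sum>i<n. w (pts \<omega> i)) / B < 4 * \<kappa> / B * real n"
      using that by (simp add: \<Psi>_def ennreal_less_one_iff sum_divide_distrib)
    then show ?thesis using B by (simp add: field_simps)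
  qed
  ultimately show ?thesis by blast
qed

text \<open>A population integral of a nonnegative function of the cell index is at most 4 times its
  empirical mean, for all such functions simultaneously. This replaces a uniform law of large
  numbers.\<close>

lemma occupied_sum_le:
  assumes occ: "occupied n x" and x: "\<forall>i<n. x i \<in> cbox 0 1" and n: "n \<ge> 1"
    and m: "m \<ge> 1" "real m ^ CARD('d) * occ_const * ln (real n) \<le> real n" and u: "\<And>j. 0 \<le> u j"
  shows "(\<Sum>j\<in>grid m. measure G (cell m j) * u j) \<le> 4 / real n * (\<Sum>i<n. u (cidx m (x i)))"
proof -
  have im: "(\<lambda>i. cidx m (x i)) ` {..<n} \<subseteq> grid m" using x cidx_in_grid[OF m(1)] by auto
  have "(\<Sum>j\<in>grid m. measure G (cell m j) * u j) \<le> (\<Sum>j\<in>grid m. 4 / real n * (real (card {i. i < n \<and> cidx m (x i) = j}) * u j))"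
  proof (intro sum_mono)
    fix j :: "nat ^ 'd" assume "j \<in> grid m"
    then have "real n * measure G (cell m j) / 4 \<le> real (card {i. i < n \<and> cidx m (x i) = j})"
      using occ m unfolding occupied_def by blast
    then have "measure G (cell m j) \<le> 4 / real n * real (card {i. i < n \<and> cidx m (x i) = j})"
      using n by (simp add: field_simps)
    from mult_right_mono[OF this u[of j]]
    show "measure G (cell m j) * u j \<le> 4 / real n * (real (card {i. i < n \<and> cidx m (x i) = j}) * u j)"
      by (simp add: mult.assoc)
  qed
  also have "\<dots> = 4 / real n * (\<Sum>i<n. u (cidx m (x i)))"
    unfolding sum_comp_fibres[OF finite_grid im, of u] by (simp add: sum_distrib_left)
  finally show ?thesis .
qed

section \<open>Lower bound on the normalising constant of the posterior\<close>

lemma add_le_twice_mult: "1 \<le> a \<Longrightarrow> 1 \<le> b \<Longrightarrow> a + b \<le> 2 * (a * b :: real)"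
proof -
  assume "1 \<le> a" "1 \<le> b"
  then have "0 \<le> (a - 1) * (b - 1)" "a * 1 \<le> a * b" by (auto intro!: mult_left_mono)
  moreover have "1 * b \<le> a * b" using \<open>1 \<le> a\<close> \<open>1 \<le> b\<close> by (intro mult_right_mono) auto
  ultimately show ?thesis by simp
qed

lemma noise_small_le:
  assumes "noise_small n x e" "J \<ge> 1" "1 \<le> ln (real n)"
  shows "(\<Sum>i<n. (fit n x e J (cidx J (x i)))\<^sup>2) \<le> 24 * sg\<^sup>2 * (real J ^ CARD('d) * ln (real n))"
proof -
  have "(\<Sum>i<n. (fit n x e J (cidx J (x i)))\<^sup>2) \<le> 12 * sg\<^sup>2 * (real J ^ CARD('d) + ln (real n))"
    using assms unfolding noise_small_def by blast
  also have "\<dots> \<le> 12 * sg\<^sup>2 * (2 * (real J ^ CARD('d) * ln (real n)))"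
    using assms by (intro mult_left_mono add_le_twice_mult) auto
  finally show ?thesis by simp
qed

text \<open>In units of J^d log n: 2 from 1 + log n \<le> 2 log n, another 2 and 48
  \<open>sg\<close>^2 from the squared fitted coefficients of signal and noise, and
  \<open>b2\<close> from the prior weight of the level.\<close>

definition mass_const :: real where
  "mass_const = evidence_const * (4 + 48 * sg\<^sup>2) + b2"

lemma mass_const_pos: "0 < mass_const"
  using evidence_const_pos b_pos(2) by (simp add: mass_const_def add_pos_pos add_pos_nonneg)

text \<open>Keeps only level J of the mixture. \<open>J \<le> n\<close> replaces log J in the prior
  bound by log n; \<open>K\<close> is fixed in all uses, so its bound by log n holds for large n and
  keeps the signal coefficients within order J^d log n.\<close>

lemma posterior_mass_lower:
  assumes ln: "1 \<le> ln (real n)" and J: "2 \<le> J" "J \<le> n" and x: "\<forall>i<n. x i \<in> cbox 0 1"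
    and noise: "noise_small n x e" and v: "\<forall>i<n. \<bar>v i\<bar> \<le> K" and K: "K\<^sup>2 \<le> ln (real n)"
  shows "lik_const n * exp (- rss n x (\<lambda>i. v i + e i) J (fit n x (\<lambda>i. v i + e i) J) / (2 * \<sigma>\<^sup>2)
      - mass_const * (real J ^ CARD('d) * ln (real n)))
    \<le> pmass n x (\<lambda>i. v i + e i) UNIV"
proof -
  define C0 where "C0 = evidence_const"
  define C where "C = C0 * (4 + 48 * sg\<^sup>2) + b2"
  have C0: "0 < C0" using evidence_const_pos by (simp add: C0_def)
  define y where "y = (\<lambda>i. v i + e i)"
  define R where "R = rss n x y J (fit n x y J) / (2 * \<sigma>\<^sup>2)"
  define T where "T = real J ^ CARD('d) * ln (real n)"
  have n1: "n \<ge> 1" "J \<ge> 1" using J by auto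
  have K0: "0 \<le> K" using v n1 by (meson abs_ge_zero order.trans less_le_trans zero_less_one)
  have Jd: "1 \<le> real J ^ CARD('d)" using J by (intro one_le_power) auto
  have "(\<Sum>j\<in>(grid J :: (nat ^ 'd) set). (fit n x y J j)\<^sup>2) \<le> (\<Sum>j\<in>(grid J :: (nat ^ 'd) set). 2 * K\<^sup>2 + 2 * (fit n x e J j)\<^sup>2)"
  proof (intro sum_mono)
    fix j :: "nat ^ 'd"
    have eq: "fit n x y J j = fit n x v J j + fit n x e J j" by (simp add: y_def cavg_add)
    have "\<bar>fit n x v J j\<bar> \<le> K" using v K0 by (intro abs_cavg_le) auto
    then have "(fit n x v J j)\<^sup>2 \<le> K\<^sup>2" by (metis abs_ge_zero power2_abs power_mono)
    then show "(fit n x y J j)\<^sup>2 \<le> 2 * K\<^sup>2 + 2 * (fit n x e J j)\<^sup>2"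
      unfolding eq power2_sum using sum_squares_bound[of "fit n x v J j" "fit n x e J j"] by simp
  qed
  also have "\<dots> = 2 * K\<^sup>2 * real J ^ CARD('d) + 2 * (\<Sum>j\<in>(grid J :: (nat ^ 'd) set). (fit n x e J j)\<^sup>2)"
    by (simp add: sum.distrib sum_distrib_left card_grid)
  also have "\<dots> \<le> 2 * ln (real n) * real J ^ CARD('d) + 2 * (24 * sg\<^sup>2 * T)"
    using K order.trans[OF sum_cavg_sq_le[OF finite_grid] noise_small_le[OF noise n1(2) ln]] unfolding T_def
    by (intro add_mono mult_right_mono mult_left_mono) auto
  finally have S: "(\<Sum>j\<in>(grid J :: (nat ^ 'd) set). (fit n x y J j)\<^sup>2) \<le> 2 * T + 48 * sg\<^sup>2 * T"
    by (simp add: T_def algebra_simps)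
  have "real J ^ CARD('d) * (1 + ln (real n)) \<le> real J ^ CARD('d) * (2 * ln (real n))"
    using ln by (intro mult_left_mono) auto
  then have "C0 * (real J ^ CARD('d) * (1 + ln (real n)) + (\<Sum>j\<in>grid J. (fit n x y J j)\<^sup>2)) \<le> C0 * ((4 + 48 * sg\<^sup>2) * T)"
    using S C0 by (intro mult_left_mono) (auto simp: T_def algebra_simps)
  then have a: "- R - C0 * ((4 + 48 * sg\<^sup>2) * T) \<le> - R - C0 * (real J ^ CARD('d) * (1 + ln (real n)) + (\<Sum>j\<in>grid J. (fit n x y J j)\<^sup>2))"
    by simp
  have b: "lik_const n * exp (- R - C0 * ((4 + 48 * sg\<^sup>2) * T)) \<le>
    (\<integral>\<theta>. lik n x y J \<theta> \<partial>prior n J)"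
    using lik_const_pos[of n] a by (intro order.trans[OF _ evidence_lower[OF n1 x, of y]]) (auto simp: R_def C0_def)
  have "b2 * (real J ^ CARD('d) * ln (real J)) \<le> b2 * T"
    unfolding T_def using J b_pos by (intro mult_left_mono) auto
  then have "exp (- (b2 * T)) \<le> exp (- b2 * real J ^ CARD('d) * ln (real J))" by simp
  also have "\<dots> \<le> pmf \<pi> J" using pi_tails[OF J(1)] by simp
  finally have p: "exp (- (b2 * T)) \<le> pmf \<pi> J" .
  have "lik_const n * exp (- R - C * T) = exp (- (b2 * T)) * (lik_const n * exp (- R - C0 * ((4 + 48 * sg\<^sup>2) * T)))"
    by (simp add: C_def exp_add[symmetric] algebra_simps)
  also have "\<dots> \<le> pmf \<pi> J * (\<integral>\<theta>. lik n x y J \<theta> \<partial>prior n J)"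
    using p b lik_const_pos[of n] by (intro mult_mono) auto
  also have "\<dots> \<le> pmass n x y UNIV"
    by (rule posterior_mass_UNIV_ge[OF x])
  finally show ?thesis by (simp add: R_def T_def y_def C_def C0_def mass_const_def)
qed

subsection \<open>Monotone truth\<close>

text \<open>The common corner of the 2^d cells of level 2J inside cell j.\<close>

definition centre :: "nat \<Rightarrow> nat ^ 'd \<Rightarrow> real ^ 'd" where
  "centre J j = (\<chi> k. (real (j $ k) - 1 / 2) / real J)"

lemma centre_in_cube: "J \<ge> 1 \<Longrightarrow> j \<in> grid J \<Longrightarrow> centre J j \<in> cbox 0 1"
proof -
  assume J: "J \<ge> 1" and "j \<in> grid J"
  then have j: "1 \<le> j $ k \<and> j $ k \<le> J" for k by (auto simp: grid_def)
  have "0 \<le> (real (j $ k) - 1 / 2) / real J \<and> (real (j $ k) - 1 / 2) / real J \<le> 1" for k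
    using j[of k] J by (auto simp: divide_le_eq)
  then show ?thesis by (simp add: centre_def mem_box_cart)
qed

lemma centre_step_mono:
  assumes f: "f \<in> mono_fns" and J: "J \<ge> 1"
  shows "step_fn J (\<lambda>j. f (centre J j)) \<in> mono_step_fns J"
proof -
  have "step_fn J (\<lambda>j. f (centre J j)) \<in> mono_fns"
    unfolding mono_fns_def mem_Collect_eq monotone_on_def
  proof (intro ballI impI)
    fix x y :: "real ^ 'd" assume xy: "x \<in> cbox 0 1" "y \<in> cbox 0 1" "x \<le> y"
    have "centre J (cidx J x) \<le> centre J (cidx J y)"
      using cidx_mono[OF xy(3), of J] by (auto simp: less_eq_vec_def centre_def intro!: divide_right_mono)
    then show "step_fn J (\<lambda>j. f (centre J j)) x \<le> step_fn J (\<lambda>j. f (centre J j)) y"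
      using f centre_in_cube[OF J cidx_in_grid[OF J xy(1)]] centre_in_cube[OF J cidx_in_grid[OF J xy(2)]] xy
      by (simp add: step_fn_eq[OF J] mono_fns_def monotone_on_def)
  qed
  then show ?thesis by (simp add: mono_step_fns_def step_fns_def)
qed

text \<open>Each cell \<open>j\<close> of level \<open>J\<close> contains subcells \<open>2j - 1\<close> and \<open>2j\<close> of level \<open>2J\<close> lying entirely below
  and above its centre, so the sample means of a monotone function over them enclose its value at the centre.\<close>

lemma centre_approximation:
  assumes f: "f \<in> mono_fns" and J: "J \<ge> 1" and n: "n \<ge> 1" and x: "\<forall>i<n. x i \<in> cbox 0 1"
    and occ: "occupied n x" "real (J * 2) ^ CARD('d) * occ_const * ln (real n) \<le> real n"
  shows "(\<Sum>j\<in>grid J. measure G (cell J j) * (fit n x (\<lambda>i. f (x i)) J j - f (centre J j))\<^sup>2) \<le>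
    8 * (2 ^ CARD('d) * g_hi / g_lo) / real n *
      (\<Sum>i<n. (fit n x (\<lambda>i. f (x i)) (J * 2) (cidx (J * 2) (x i)) - fit n x (\<lambda>i. f (x i)) J (cidx J (x i)))\<^sup>2)"
proof -
  define F where "F m = fit n x (\<lambda>i. f (x i)) m" for m
  define \<kappa> where "\<kappa> = 2 ^ CARD('d) * g_hi / g_lo"
  define D where "D i = (F (J * 2) (cidx (J * 2) (x i)) - F J (cidx J (x i)))\<^sup>2" for i
  have im: "(\<lambda>i. cidx J (x i)) ` {..<n} \<subseteq> grid J" using x cidx_in_grid[OF J] by auto
  have J2: "J * 2 \<ge> 1" using J by simp
  have \<kappa>: "0 < \<kappa>" using g_hi_pos g_bounds(1) by (simp add: \<kappa>_def)
  have cell: "measure G (cell J j) * (F J j - f (centre J j))\<^sup>2 \<le>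
      8 * \<kappa> / real n * (\<Sum>i | i < n \<and> cidx J (x i) = j. D i)" if j: "j \<in> grid J" for j
  proof -
    \<comment> \<open>The subcells at the lowest and highest corner of cell j: every point of the
      first is below the centre, every point of the second above it.\<close>
    define lo hi :: "nat ^ 'd" where "lo = (\<chi> k. 2 * j $ k - 1)" and "hi = (\<chi> k. 2 * j $ k)"
    have jk: "1 \<le> j $ k" "j $ k \<le> J" for k using j by (auto simp: grid_def)
    have "1 \<le> 2 * j $ k - 1 \<and> 2 * j $ k - 1 \<le> J * 2" "1 \<le> 2 * j $ k \<and> 2 * j $ k \<le> J * 2" for k
      using jk[of k] by linarith+
    then have lohi: "lo \<in> grid (J * 2)" "hi \<in> grid (J * 2)"
      by (simp_all add: grid_def lo_def hi_def)
    have co: "coarsen 2 lo = j" "coarsen 2 hi = j"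
      using jk by (auto simp: coarsen_def lo_def hi_def vec_eq_iff)
    have fib: "cidx J (x i) = coarsen 2 (cidx (J * 2) (x i))" for i by (simp add: coarsen_cidx)
    have sub: "measure G (cell J j) * (F (J * 2) s - F J j)\<^sup>2 \<le> 4 * \<kappa> / real n * (\<Sum>i | i < n \<and> cidx J (x i) = j. D i)
      \<and> (\<exists>i<n. cidx (J * 2) (x i) = s)"
      if s: "s \<in> grid (J * 2)" "coarsen 2 s = j" for s
    proof -
      define N where "N = real (card {i. i < n \<and> cidx (J * 2) (x i) = s})"
      have Gs: "real n * measure G (cell (J * 2) s) / 4 \<le> N"
        using occ s J2 unfolding occupied_def N_def by blast
      have p: "0 < real J ^ CARD('d)" using J by simp
      have "measure G (cell J j) \<le> g_hi / real J ^ CARD('d)" by (rule measure_cell_bounds[OF J j])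
      also have "\<dots> = \<kappa> * (g_lo / real (J * 2) ^ CARD('d))"
        using g_bounds(1) by (simp add: \<kappa>_def power_mult_distrib)
      also have "\<dots> \<le> \<kappa> * measure G (cell (J * 2) s)"
        using \<kappa> measure_cell_bounds(1)[OF J2 s(1)] by (intro mult_left_mono) auto
      also have "\<dots> \<le> \<kappa> * (4 / real n * N)"
        using \<kappa> Gs n by (intro mult_left_mono) (auto simp: field_simps)
      finally have GN: "measure G (cell J j) \<le> 4 * \<kappa> / real n * N" by (simp add: mult.commute mult.left_commute)
      \<comment> \<open>The positive mass of the cell forces N > 0, so the averages over the two
        subcells are genuine and not the default value of an empty cell.\<close>
      have "0 < measure G (cell J j)"
        using measure_cell_bounds(1)[OF J j] g_bounds(1) p by (meson divide_pos_pos less_le_trans)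
      then have "N \<noteq> 0" using GN by auto
      then have "{i. i < n \<and> cidx (J * 2) (x i) = s} \<noteq> {}" unfolding N_def by force
      then have ex: "\<exists>i<n. cidx (J * 2) (x i) = s" by auto
      have "N * (F (J * 2) s - F J j)\<^sup>2 = (\<Sum>i | i < n \<and> cidx (J * 2) (x i) = s. D i)"
        unfolding N_def D_def using s(2) by (simp add: fib)
      also have "\<dots> \<le> (\<Sum>i | i < n \<and> cidx J (x i) = j. D i)"
        using s(2) by (intro sum_mono2) (auto simp: fib D_def)
      finally have "4 * \<kappa> / real n * (N * (F (J * 2) s - F J j)\<^sup>2) \<le> 4 * \<kappa> / real n * (\<Sum>i | i < n \<and> cidx J (x i) = j. D i)"
        using \<kappa> by (intro mult_left_mono) auto
      moreover have "measure G (cell J j) * (F (J * 2) s - F J j)\<^sup>2 \<le> 4 * \<kappa> / real n * N * (F (J * 2) s - F J j)\<^sup>2"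
        by (intro mult_right_mono GN) auto
      ultimately show ?thesis using ex by (simp add: mult.assoc)
    qed
    have inc: "f a \<le> f b" if "a \<in> cbox 0 1" "b \<in> cbox 0 1" "a \<le> b" for a b
      using f that by (auto simp: mono_fns_def monotone_on_def)
    have c: "centre J j \<in> cbox 0 1" by (rule centre_in_cube[OF J j])
    obtain i1 where i1: "i1 < n" "cidx (J * 2) (x i1) = lo" using sub[OF lohi(1) co(1)] by auto
    obtain i2 where i2: "i2 < n" "cidx (J * 2) (x i2) = hi" using sub[OF lohi(2) co(2)] by auto
    have "F (J * 2) lo \<le> f (centre J j)"
      unfolding F_def
    proof (rule cavg_le[where c = "\<lambda>i. cidx (J * 2) (x i)" and i = i1])
      fix i assume i: "i < n" "cidx (J * 2) (x i) = lo"
      then have xi: "x i \<in> cell (J * 2) lo" using x cell_iff_cidx[OF J2 _ lohi(1)] by auto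
      have "x i \<le> centre J j"
      proof (unfold less_eq_vec_def, intro allI)
        fix k
        have "x i $ k \<le> real (lo $ k) / real (J * 2)"
          using xi unfolding cell_def by (auto split: if_splits dest!: spec[of _ k])
        also have "\<dots> = centre J j $ k"
          using jk(1)[of k] J by (simp add: lo_def centre_def field_simps of_nat_diff)
        finally show "x i $ k \<le> centre J j $ k" .
      qed
      then show "f (x i) \<le> f (centre J j)" using inc c x i by auto
    qed (use i1 in auto)
    moreover have "f (centre J j) \<le> F (J * 2) hi"
      unfolding F_def
    proof (rule cavg_ge[where c = "\<lambda>i. cidx (J * 2) (x i)" and i = i2])
      fix i assume i: "i < n" "cidx (J * 2) (x i) = hi"
      then have xi: "x i \<in> cell (J * 2) hi" using x cell_iff_cidx[OF J2 _ lohi(2)] by auto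
      have "centre J j \<le> x i"
      proof (unfold less_eq_vec_def, intro allI)
        fix k
        \<comment> \<open>An even index is never 1, so the interval is open at its left end, which
          is the centre.\<close>
        have "hi $ k \<noteq> 1" using jk(1)[of k] by (simp add: hi_def)
        then have "(real (hi $ k) - 1) / real (J * 2) < x i $ k"
          using xi unfolding cell_def by (auto split: if_splits dest!: spec[of _ k])
        moreover have "(real (hi $ k) - 1) / real (J * 2) = centre J j $ k"
          using J by (simp add: hi_def centre_def field_simps)
        ultimately show "centre J j $ k \<le> x i $ k" by simp
      qed
      then show "f (centre J j) \<le> f (x i)" using inc c x i by auto
    qed (use i2 in auto)
    \<comment> \<open>The average over cell j lies on one side of the value at the centre; the
      subcell average on the opposite side of that value is at least as far away.\<close>
    ultimately have "\<bar>F J j - f (centre J j)\<bar> \<le> \<bar>F (J * 2) lo - F J j\<bar> \<or> \<bar>F J j - f (centre J j)\<bar> \<le> \<bar>F (J * 2) hi - F J j\<bar>"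
      by linarith
    then have "(F J j - f (centre J j))\<^sup>2 \<le> (F (J * 2) lo - F J j)\<^sup>2 + (F (J * 2) hi - F J j)\<^sup>2"
      by (metis abs_le_square_iff add.commute add_increasing2 zero_le_power2)
    then have "measure G (cell J j) * (F J j - f (centre J j))\<^sup>2 \<le>
      measure G (cell J j) * ((F (J * 2) lo - F J j)\<^sup>2 + (F (J * 2) hi - F J j)\<^sup>2)"
      by (intro mult_left_mono) auto
    then show ?thesis
      using sub[OF lohi(1) co(1)] sub[OF lohi(2) co(2)] by (simp add: distrib_left)
  qed
  have "(\<Sum>j\<in>grid J. measure G (cell J j) * (F J j - f (centre J j))\<^sup>2) \<le>
    (\<Sum>j\<in>grid J. 8 * \<kappa> / real n * (\<Sum>i | i < n \<and> cidx J (x i) = j. D i))"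
    by (intro sum_mono cell)
  also have "\<dots> = 8 * \<kappa> / real n * (\<Sum>i<n. D i)"
    unfolding sum_by_fibres[OF finite_grid im, of D] by (simp add: sum_distrib_left)
  finally show ?thesis by (simp add: F_def D_def \<kappa>_def)
qed


section \<open>The test event and its complement under a monotone truth\<close>

definition mono_event :: "real \<Rightarrow> nat \<Rightarrow> (nat \<times> (real ^ 'd \<Rightarrow> real)) set" where
  "mono_event M0 n = {(J, f). hell_setdist f (mono_step_fns J)
     \<le> M0 * sqrt (real J ^ CARD('d) * ln (real n) / real n)}"

lemma mono_event_measurable:
  assumes "J \<ge> 1"
  shows "{\<theta> \<in> space (prior n J). (J, step_fn J \<theta>) \<in> mono_event M0 n'}
    \<in> sets (prior n J)"
  unfolding mono_event_def mem_Collect_eq case_prod_conv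
  using hellinger_setdist_measurable[OF assms, of n] by measurable

text \<open>Here \<kappa> compares the mass of a cell with that of a subcell, and CV collects the
  noise at levels J and 2J. The term with \<open>mass_const\<close> is the gain in residual sum of
  squares that pays for the complexity of level 2J and a factor n. The last summand forces level 2J
  to satisfy the occupancy condition, and the leading 1 gives M0 \<ge> 1, so that M0^2 \<ge>
  M0.\<close>

definition level_const :: real where
  "level_const = (let D = 2 ^ CARD('d); \<kappa> = D * g_hi / g_lo;
       CV = 12 * (24 * sg\<^sup>2) + 72 * \<kappa> * (24 * sg\<^sup>2 * D + 24 * sg\<^sup>2)
     in 1 + ((CV + (12 + 72 * \<kappa>) * (2 * \<sigma>\<^sup>2 * (mass_const * D + 1))) / (4 * \<sigma>\<^sup>2) + 2 * D * occ_const))"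

lemma level_const_pos: "0 < level_const"
proof -
  have "0 < mass_const" "1 \<le> occ_const" "0 < g_hi" "0 < g_lo"
    using mass_const_pos g_hi_pos g_bounds(1) by (auto simp: occ_const_def)
  then show ?thesis
    using sigma unfolding level_const_def Let_def
    by (intro add_pos_nonneg add_nonneg_nonneg divide_nonneg_nonneg mult_nonneg_nonneg) auto
qed

text \<open>If \<theta> is far from the step function of centre values, then \<theta> is far from
  the level J fit (\<open>S\<close>), or the fits at levels J and 2J differ
  (\<open>\<Delta>\<close>), up to noise. By Pythagoras both are excess residual sum of squares over
  level 2J.\<close>

lemma monotone_truth_bound:
  assumes M0: "level_const \<le> M0" and ln: "1 \<le> ln (real n)" and x: "\<forall>i<n. x i \<in> cbox 0 1"
    and f: "f \<in> mono_fns" and fK: "\<forall>x\<in>cbox 0 1. \<bar>f x\<bar> \<le> K" and K: "K\<^sup>2 \<le> ln (real n)"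
    and occ: "occupied n x" and noise: "noise_small n x e" and J: "J \<ge> 1"
    and out: "(J, step_fn J \<theta>) \<notin> mono_event M0 n"
  shows "lik n x (\<lambda>i. f (x i) + e i) J \<theta> \<le>
      pmass n x (\<lambda>i. f (x i) + e i) UNIV / real n"
proof -
  define C where "C = mass_const"
  have C: "C > 0" using mass_const_pos by (simp add: C_def)
  define D where "D = (2 :: real) ^ CARD('d)"
  define \<kappa> where "\<kappa> = D * g_hi / g_lo"
  define CV where "CV = 12 * (24 * sg\<^sup>2) + 72 * \<kappa> * (24 * sg\<^sup>2 * D + 24 * sg\<^sup>2)"
  define R where "R = (CV + (12 + 72 * \<kappa>) * (2 * \<sigma>\<^sup>2 * (C * D + 1))) / (4 * \<sigma>\<^sup>2) + 2 * D * occ_const"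
  have D: "0 < D" by (simp add: D_def)
  have \<kappa>: "0 < \<kappa>" using g_hi_pos g_bounds(1) D by (simp add: \<kappa>_def)
  have CV: "0 \<le> CV" using \<kappa> D by (simp add: CV_def)
  have occ1: "1 \<le> occ_const" using g_bounds(1) by (simp add: occ_const_def)
  have R1: "0 \<le> (CV + (12 + 72 * \<kappa>) * (2 * \<sigma>\<^sup>2 * (C * D + 1))) / (4 * \<sigma>\<^sup>2)"
    using CV \<kappa> C D sigma by (intro divide_nonneg_nonneg add_nonneg_nonneg mult_nonneg_nonneg) auto
  have R2: "0 \<le> 2 * D * occ_const" using D occ1 by simp
  have R: "0 \<le> R" unfolding R_def using R1 R2 by simp
  have M0: "1 + R \<le> M0"
    using M0 by (simp add: level_const_def Let_def R_def CV_def \<kappa>_def D_def C_def)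
  define T where "T = real J ^ CARD('d) * ln (real n)"
  define y where "y = (\<lambda>i. f (x i) + e i)"
  define h where "h = (\<lambda>j. f (centre J j))"
  define J2 where "J2 = J * 2"
  define S where "S = (\<Sum>i<n. (fit n x y J (cidx J (x i)) - \<theta> (cidx J (x i)))\<^sup>2)"
  define \<Delta> where "\<Delta> = (\<Sum>i<n. (fit n x y J2 (cidx J2 (x i)) - fit n x y J (cidx J (x i)))\<^sup>2)"
  define V where "V m = (\<Sum>i<n. (fit n x e m (cidx m (x i)))\<^sup>2)" for m
  have n1: "n \<ge> 1" using ln by (cases n) auto
  have np: "0 < real n" using n1 by simp
  have M0sq: "R \<le> M0\<^sup>2"
  proof -
    have "R * 1 \<le> M0 * M0" using M0 R by (intro mult_mono) auto
    then show ?thesis by (simp add: power2_eq_square)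
  qed
  have Jd: "1 \<le> real J ^ CARD('d)" using J by (intro one_le_power) auto
  have "1 * ln (real n) \<le> T" unfolding T_def using ln by (intro mult_right_mono Jd) auto
  then have T: "ln (real n) \<le> T" "1 \<le> T" using ln by auto
  have far: "M0 * sqrt (T / real n) < hell_setdist (step_fn J \<theta>) (mono_step_fns J)"
    using out by (simp add: mono_event_def T_def)
  have far_sq: "M0\<^sup>2 * (T / real n) < (hell (step_fn J \<theta>) g')\<^sup>2" if "g' \<in> mono_step_fns J" for g'
  proof -
    have "M0 * sqrt (T / real n) < hell (step_fn J \<theta>) g'"
      using far hellinger_setdist_le[OF that, of "step_fn J \<theta>"] by simp
    moreover have "0 \<le> M0 * sqrt (T / real n)" using M0 R T np by (intro mult_nonneg_nonneg) auto
    ultimately have "(M0 * sqrt (T / real n))\<^sup>2 < (hell (step_fn J \<theta>) g')\<^sup>2"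
      by (intro power_strict_mono) auto
    then show ?thesis using T np by (simp add: power_mult_distrib)
  qed
  have hm: "step_fn J h \<in> mono_step_fns J" unfolding h_def by (rule centre_step_mono[OF f J])
  \<comment> \<open>A Hellinger distance is at most sqrt 2. A coefficient vector outside the event
    thus has J^d log n at most of order n, which makes level 2J occupied.\<close>
  have "(hell (step_fn J \<theta>) (step_fn J h))\<^sup>2 \<le> (sqrt 2)\<^sup>2"
    by (intro power_mono hellinger_le_sqrt2 hellinger_nonneg)
  then have "M0\<^sup>2 * (T / real n) < 2" using far_sq[OF hm] by simp
  then have "M0\<^sup>2 * T < 2 * real n" using np by (simp add: field_simps)
  moreover have "2 * D * occ_const * T \<le> M0\<^sup>2 * T"
    using M0sq R1 T by (intro mult_right_mono) (auto simp: R_def)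
  ultimately have "D * occ_const * T \<le> real n" by simp
  then have lev: "real J2 ^ CARD('d) * occ_const * ln (real n) \<le> real n"
    by (simp add: J2_def D_def T_def power_mult_distrib mult.assoc mult.commute mult.left_commute)
  have lev1: "real J ^ CARD('d) * occ_const * ln (real n) \<le> real n"
  proof -
    have "real J ^ CARD('d) * occ_const * ln (real n) \<le> real J2 ^ CARD('d) * occ_const * ln (real n)"
      using occ1 ln by (intro mult_right_mono power_mono) (auto simp: J2_def)
    then show ?thesis using lev by simp
  qed
  have J2n: "J2 \<le> n"
  proof -
    have "real J2 \<le> real J2 ^ CARD('d)" using J by (intro self_le_power) (auto simp: J2_def)
    also have "\<dots> \<le> real J2 ^ CARD('d) * (occ_const * ln (real n))"
    proof -
      have "1 * 1 \<le> occ_const * ln (real n)" using occ1 ln by (intro mult_mono) auto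
      then show ?thesis using mult_left_mono[of 1 "occ_const * ln (real n)" "real J2 ^ CARD('d)"] by simp
    qed
    finally have "real J2 \<le> real n" using lev by (simp add: mult.assoc)
    then show ?thesis by simp
  qed
  have V: "V J \<le> 24 * sg\<^sup>2 * T" "V J2 \<le> 24 * sg\<^sup>2 * (D * T)"
    using noise_small_le[OF noise J ln] noise_small_le[OF noise _ ln, of J2] J
    by (auto simp: V_def T_def J2_def D_def power_mult_distrib mult_ac)
  have int: "integrable G (\<lambda>x. (step_fn J \<theta> x - step_fn J h x)\<^sup>2)"
    by (subst Bochner_Integration.integrable_cong[where g = "\<lambda>x. (\<theta> (cidx J x) - h (cidx J x))\<^sup>2"])
      (auto simp: space_G step_fn_eq[OF J] intro: integrable_comp_cidx[OF J, of "\<lambda>j. (\<theta> j - h j)\<^sup>2"])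
  have "M0\<^sup>2 * (T / real n) < (\<integral>x. (step_fn J \<theta> x - step_fn J h x)\<^sup>2 \<partial>G) / (4 * \<sigma>\<^sup>2)"
    using far_sq[OF hm] hellinger_sq_le[OF int] step_fn_measurable[OF J] by (meson less_le_trans)
  also have "(\<integral>x. (step_fn J \<theta> x - step_fn J h x)\<^sup>2 \<partial>G) = (\<integral>x. (\<theta> (cidx J x) - h (cidx J x))\<^sup>2 \<partial>G)"
    by (intro Bochner_Integration.integral_cong) (auto simp: space_G step_fn_eq[OF J])
  also have "\<dots> = (\<Sum>j\<in>grid J. measure G (cell J j) * (\<theta> j - h j)\<^sup>2)"
    by (rule integral_comp_cidx[OF J, of "\<lambda>j. (\<theta> j - h j)\<^sup>2"])
  finally have "4 * \<sigma>\<^sup>2 * M0\<^sup>2 * T / real n < (\<Sum>j\<in>grid J. measure G (cell J j) * (\<theta> j - h j)\<^sup>2)"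
    using sigma by (simp add: field_simps)
  also have "\<dots> \<le> (\<Sum>j\<in>grid J. measure G (cell J j) * (3 * (fit n x y J j - \<theta> j)\<^sup>2)
      + measure G (cell J j) * (3 * (fit n x e J j)\<^sup>2)
      + 3 * (measure G (cell J j) * (fit n x (\<lambda>i. f (x i)) J j - h j)\<^sup>2))"
  proof (intro sum_mono)
    fix j :: "nat ^ 'd"
    have "fit n x y J j = fit n x (\<lambda>i. f (x i)) J j + fit n x e J j" by (simp add: y_def cavg_add)
    \<comment> \<open>Three contributions: noise in the fit, distance of \<theta> from the fit, and
      distance of the averaged truth from the centre values. Squaring costs the factor 3.\<close>
    then have eq: "\<theta> j - h j = (fit n x e J j - (fit n x y J j - \<theta> j)) + (fit n x (\<lambda>i. f (x i)) J j - h j)" by simp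
    have sq3: "(b - a + c)\<^sup>2 \<le> 3 * a\<^sup>2 + 3 * b\<^sup>2 + 3 * c\<^sup>2" for a b c :: real
    proof -
      have "0 \<le> (a + b)\<^sup>2 + (a + c)\<^sup>2 + (b - c)\<^sup>2" by simp
      then show ?thesis by (simp add: power2_eq_square algebra_simps)
    qed
    have "(\<theta> j - h j)\<^sup>2 \<le> 3 * (fit n x y J j - \<theta> j)\<^sup>2 + 3 * (fit n x e J j)\<^sup>2 + 3 * (fit n x (\<lambda>i. f (x i)) J j - h j)\<^sup>2"
      unfolding eq by (rule sq3)
    from mult_left_mono[OF this measure_nonneg[of G "cell J j"]]
    show "measure G (cell J j) * (\<theta> j - h j)\<^sup>2 \<le> measure G (cell J j) * (3 * (fit n x y J j - \<theta> j)\<^sup>2)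
      + measure G (cell J j) * (3 * (fit n x e J j)\<^sup>2)
      + 3 * (measure G (cell J j) * (fit n x (\<lambda>i. f (x i)) J j - h j)\<^sup>2)"
      by (simp add: algebra_simps)
  qed
  also have "\<dots> \<le> 4 / real n * (3 * S) + 4 / real n * (3 * V J) + 3 * (8 * \<kappa> / real n * (3 * \<Delta> + 3 * V J2 + 3 * V J))"
  proof -
    have a: "(\<Sum>j\<in>grid J. measure G (cell J j) * (3 * (fit n x y J j - \<theta> j)\<^sup>2)) \<le> 4 / real n * (3 * S)"
      using occupied_sum_le[OF occ x n1 J lev1, of "\<lambda>j. 3 * (fit n x y J j - \<theta> j)\<^sup>2"]
      by (simp add: S_def sum_distrib_left)
    have b: "(\<Sum>j\<in>grid J. measure G (cell J j) * (3 * (fit n x e J j)\<^sup>2)) \<le> 4 / real n * (3 * V J)"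
      using occupied_sum_le[OF occ x n1 J lev1, of "\<lambda>j. 3 * (fit n x e J j)\<^sup>2"]
      by (simp add: V_def sum_distrib_left)
    \<comment> \<open>Averages of the unknown truth are traded for fits to the data, again at the
      cost of noise terms and a factor 3.\<close>
    have "(\<Sum>i<n. (fit n x (\<lambda>i. f (x i)) J2 (cidx J2 (x i)) - fit n x (\<lambda>i. f (x i)) J (cidx J (x i)))\<^sup>2) \<le>
      (\<Sum>i<n. 3 * (fit n x y J2 (cidx J2 (x i)) - fit n x y J (cidx J (x i)))\<^sup>2 + 3 * (fit n x e J2 (cidx J2 (x i)))\<^sup>2
         + 3 * (fit n x e J (cidx J (x i)))\<^sup>2)"
    proof (intro sum_mono)
      fix i
      have "fit n x y m j = fit n x (\<lambda>i. f (x i)) m j + fit n x e m j" for m j by (simp add: y_def cavg_add)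
      then have eq: "fit n x (\<lambda>i. f (x i)) J2 (cidx J2 (x i)) - fit n x (\<lambda>i. f (x i)) J (cidx J (x i)) =
        (fit n x y J2 (cidx J2 (x i)) - fit n x y J (cidx J (x i))) - fit n x e J2 (cidx J2 (x i)) + fit n x e J (cidx J (x i))"
        by simp
      have sq3: "(a - b + c)\<^sup>2 \<le> 3 * a\<^sup>2 + 3 * b\<^sup>2 + 3 * c\<^sup>2" for a b c :: real
      proof -
        have "0 \<le> (a + b)\<^sup>2 + (a - c)\<^sup>2 + (b + c)\<^sup>2" by simp
        then show ?thesis by (simp add: power2_eq_square algebra_simps)
      qed
      show "(fit n x (\<lambda>i. f (x i)) J2 (cidx J2 (x i)) - fit n x (\<lambda>i. f (x i)) J (cidx J (x i)))\<^sup>2 \<le>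
        3 * (fit n x y J2 (cidx J2 (x i)) - fit n x y J (cidx J (x i)))\<^sup>2 + 3 * (fit n x e J2 (cidx J2 (x i)))\<^sup>2
         + 3 * (fit n x e J (cidx J (x i)))\<^sup>2"
        unfolding eq by (rule sq3)
    qed
    also have "\<dots> = 3 * \<Delta> + 3 * V J2 + 3 * V J"
      by (simp add: sum.distrib sum_distrib_left \<Delta>_def V_def)
    finally have "8 * \<kappa> / real n * (\<Sum>i<n. (fit n x (\<lambda>i. f (x i)) J2 (cidx J2 (x i)) - fit n x (\<lambda>i. f (x i)) J (cidx J (x i)))\<^sup>2)
      \<le> 8 * \<kappa> / real n * (3 * \<Delta> + 3 * V J2 + 3 * V J)"
      using \<kappa> by (intro mult_left_mono) auto
    then have c: "(\<Sum>j\<in>grid J. measure G (cell J j) * (fit n x (\<lambda>i. f (x i)) J j - h j)\<^sup>2) \<le>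
        8 * \<kappa> / real n * (3 * \<Delta> + 3 * V J2 + 3 * V J)"
      using centre_approximation[OF f J n1 x occ lev[unfolded J2_def]] by (simp add: \<kappa>_def D_def h_def J2_def)
    show ?thesis unfolding sum.distrib sum_distrib_left[symmetric] using a b c by linarith
  qed
  also have "\<dots> = (12 * S + 12 * V J + 72 * \<kappa> * (\<Delta> + V J2 + V J)) / real n"
    by (simp add: add_divide_distrib distrib_left algebra_simps)
  finally have "4 * \<sigma>\<^sup>2 * M0\<^sup>2 * T < 12 * S + 12 * V J + 72 * \<kappa> * (\<Delta> + V J2 + V J)"
    using np by (simp only: divide_less_cancel)
  also have "\<dots> \<le> 12 * S + 12 * (24 * sg\<^sup>2 * T) + 72 * \<kappa> * (\<Delta> + 24 * sg\<^sup>2 * (D * T) + 24 * sg\<^sup>2 * T)"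
    using V \<kappa> by (intro add_mono mult_left_mono) auto
  also have "\<dots> = 12 * S + 72 * \<kappa> * \<Delta> + CV * T"
    by (simp add: CV_def algebra_simps)
  also have "\<dots> \<le> (12 + 72 * \<kappa>) * (S + \<Delta>) + CV * T"
  proof -
    have "0 \<le> S" "0 \<le> \<Delta>" by (auto simp: S_def \<Delta>_def intro!: sum_nonneg)
    then have "0 \<le> 72 * \<kappa> * S" "0 \<le> 12 * \<Delta>" using \<kappa> by auto
    then show ?thesis by (simp add: algebra_simps)
  qed
  finally have up: "4 * \<sigma>\<^sup>2 * M0\<^sup>2 * T < (12 + 72 * \<kappa>) * (S + \<Delta>) + CV * T" .
  have "(CV + (12 + 72 * \<kappa>) * (2 * \<sigma>\<^sup>2 * (C * D + 1))) / (4 * \<sigma>\<^sup>2) \<le> M0\<^sup>2"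
    using M0sq R2 by (simp add: R_def)
  then have "CV + (12 + 72 * \<kappa>) * (2 * \<sigma>\<^sup>2 * (C * D + 1)) \<le> 4 * \<sigma>\<^sup>2 * M0\<^sup>2"
    using sigma by (simp add: divide_le_eq mult.commute)
  then have "(CV + (12 + 72 * \<kappa>) * (2 * \<sigma>\<^sup>2 * (C * D + 1))) * T \<le> 4 * \<sigma>\<^sup>2 * M0\<^sup>2 * T"
    using T by (intro mult_right_mono) auto
  then have "(12 + 72 * \<kappa>) * (2 * \<sigma>\<^sup>2 * (C * D + 1) * T) < (12 + 72 * \<kappa>) * (S + \<Delta>)"
    using up by (simp add: algebra_simps)
  then have "2 * \<sigma>\<^sup>2 * (C * D + 1) * T < S + \<Delta>"
    using \<kappa> by (simp add: mult_less_cancel_left_pos)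
  then have gain: "(C * D + 1) * T \<le> (S + \<Delta>) / (2 * \<sigma>\<^sup>2)"
    using sigma by (simp add: le_divide_eq mult_ac)
  have fib: "cidx J (x i) = coarsen 2 (cidx J2 (x i))" for i by (simp add: coarsen_cidx J2_def)
  \<comment> \<open>The level J fit is a function of the level 2J index, so Pythagoras applies at
    level 2J.\<close>
  have "rss n x y J (fit n x y J) = rss n x y J2 (fit n x y J2) + \<Delta>"
    using cavg_pythagoras[of y "\<lambda>s. fit n x y J (coarsen 2 s)" "\<lambda>i. cidx J2 (x i)" n]
    by (simp add: rss_def \<Delta>_def fib)
  then have rss: "rss n x y J \<theta> = rss n x y J2 (fit n x y J2) + (S + \<Delta>)"
    using rss_pythagoras[of n x y J \<theta>] by (simp add: S_def)
  have "lik n x y J \<theta> = lik_const n * exp (- rss n x y J2 (fit n x y J2) / (2 * \<sigma>\<^sup>2) - (S + \<Delta>) / (2 * \<sigma>\<^sup>2))"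
    unfolding likelihood_eq[OF J x] rss by (simp add: diff_divide_distrib add_divide_distrib)
  also have "\<dots> \<le> lik_const n * exp ((- rss n x y J2 (fit n x y J2) / (2 * \<sigma>\<^sup>2) - C * (real J2 ^ CARD('d) * ln (real n))) + (- ln (real n)))"
  proof -
    have "C * (real J2 ^ CARD('d) * ln (real n)) = C * D * T"
      by (simp add: J2_def D_def T_def power_mult_distrib)
    moreover have "(C * D + 1) * T = C * D * T + T" by (simp add: algebra_simps)
    ultimately have "C * (real J2 ^ CARD('d) * ln (real n)) + ln (real n) \<le> (S + \<Delta>) / (2 * \<sigma>\<^sup>2)"
      using gain T by linarith
    then show ?thesis using lik_const_pos[of n] by (intro mult_left_mono) auto
  qed
  also have "\<dots> = lik_const n * exp (- rss n x y J2 (fit n x y J2) / (2 * \<sigma>\<^sup>2) - C * (real J2 ^ CARD('d) * ln (real n))) * (1 / real n)"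
    unfolding exp_add ln_exp_inverse[OF n1] by (simp add: mult.assoc)
  also have "\<dots> \<le> pmass n x y UNIV * (1 / real n)"
    using posterior_mass_lower[OF ln _ J2n x noise, of "\<lambda>i. f (x i)" K] fK x K J
    by (intro mult_right_mono) (auto simp: y_def J2_def C_def)
  finally show ?thesis by (simp add: y_def)
qed

lemma mono_test_eq:
  "test \<gamma> M0 n D =
    (if post_prob n D (mono_event M0 n) < \<gamma> then 1 else 0)"
  by (simp add: mono_test_def mono_event_def)

lemma true_expectation_nonneg: "(\<And>D. 0 \<le> \<Phi> D) \<Longrightarrow> 0 \<le> true_expectation G Q f0 n \<Phi>"
  unfolding true_expectation_def by (intro Bochner_Integration.integral_nonneg)

text \<open>Makes the posterior a genuine quotient. Level 2 is the smallest to which the lower bound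
  on the prior applies.\<close>

lemma posterior_mass_pos:
  fixes x :: "nat \<Rightarrow> real ^ 'd"
  assumes n: "1 \<le> ln (real n)" and x: "\<forall>i<n. x i \<in> cbox 0 1"
  shows "0 < pmass n x y UNIV"
proof -
  have n1: "n \<ge> 1" using n by (cases n) auto
  have pi2: "0 < pmf \<pi> 2" using pi_tails[of 2] by (meson exp_gt_zero less_le_trans order_refl)
  have "0 < pmf \<pi> 2 * (lik_const n * exp (- rss n x y 2 (fit n x y 2) / (2 * \<sigma>\<^sup>2)
        - evidence_const * (real 2 ^ CARD('d) * (1 + ln (real n)) + (\<Sum>j\<in>grid 2. (fit n x y 2 j)\<^sup>2))))"
    using pi2 lik_const_pos[of n] by simp
  also have "\<dots> \<le> pmf \<pi> 2 * (\<integral>\<theta>. lik n x y 2 \<theta> \<partial>coef_prior \<sigma> \<zeta> lam n 2)"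
    using evidence_lower[OF n1 _ x, of 2 y] pi2 by (intro mult_left_mono) auto
  also have "\<dots> \<le> pmass n x y UNIV"
    by (rule posterior_mass_UNIV_ge[OF x])
  finally show ?thesis .
qed

lemma eventually_ln_ge: "\<forall>\<^sub>F n in sequentially. c \<le> ln (real n)"
  using filterlim_compose[OF ln_at_top filterlim_real_sequentially] by (simp add: filterlim_at_top)

text \<open>Level in the sense of type I error. On the good event the posterior gives the complement
  of the test event at most 1 / n, which is eventually at most 1 - \<gamma>.\<close>

lemma level_of_test:
  assumes \<gamma>: "\<gamma> < 1" and M0: "M0 \<ge> level_const" and f0: "f0 \<in> mono_fns" and bdd: "bounded (f0 ` cbox 0 1)"
  shows "(\<lambda>n. true_expectation G Q f0 n (test \<gamma> M0 n)) \<longlonglongrightarrow> 0"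
proof -
  obtain K where K: "\<forall>x\<in>cbox 0 1. \<bar>f0 x\<bar> \<le> K" using bdd unfolding bounded_iff by auto
  have le: "true_expectation G Q f0 n (test \<gamma> M0 n) \<le> 2 / real n"
    if n: "1 \<le> ln (real n)" "K\<^sup>2 \<le> ln (real n)" "1 / real n \<le> 1 - \<gamma>" for n
  proof -
    have n1: "n \<ge> 1" using n(1) by (cases n) auto
    obtain \<Psi>1 where \<Psi>1: "\<Psi>1 \<in> borel_measurable (sample n)" "(\<integral>\<^sup>+\<omega>. \<Psi>1 \<omega> \<partial>sample n) \<le> ennreal (1 / real n)"
      "\<And>\<omega>. \<omega> \<in> space (sample n) \<Longrightarrow> \<Psi>1 \<omega> < 1 \<Longrightarrow> occupied n (pts \<omega>)"
      using occupied_penalty[OF n1 n(1)] by blast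
    obtain \<Psi>2 where \<Psi>2: "\<Psi>2 \<in> borel_measurable (sample n)" "(\<integral>\<^sup>+\<omega>. \<Psi>2 \<omega> \<partial>sample n) \<le> ennreal (1 / real n)"
      "\<And>\<omega>. \<omega> \<in> space (sample n) \<Longrightarrow> \<Psi>2 \<omega> < 1 \<Longrightarrow> noise_small n (pts \<omega>) (errs \<omega>)"
      using noise_penalty[OF n1] by blast
    have "ennreal (true_expectation G Q f0 n (test \<gamma> M0 n)) \<le> (\<integral>\<^sup>+\<omega>. \<Psi>1 \<omega> + \<Psi>2 \<omega> \<partial>sample n)"
    proof (rule true_expectation_le)
      fix \<omega> assume \<omega>: "\<omega> \<in> space (sample n)" "\<Psi>1 \<omega> + \<Psi>2 \<omega> < 1"
      have "\<Psi>1 \<omega> < 1" by (rule le_less_trans[OF _ \<omega>(2)]) simp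
      then have occ: "occupied n (pts \<omega>)" by (rule \<Psi>1(3)[OF \<omega>(1)])
      have "\<Psi>2 \<omega> < 1" by (rule le_less_trans[OF _ \<omega>(2)]) simp
      then have noise: "noise_small n (pts \<omega>) (errs \<omega>)" by (rule \<Psi>2(3)[OF \<omega>(1)])
      have x: "\<forall>i<n. pts \<omega> i \<in> cbox 0 1" using pts_in_cube[OF \<omega>(1)] by blast
      let ?D = "\<lambda>i. (pts \<omega> i, f0 (pts \<omega> i) + errs \<omega> i)"
      let ?m = "posterior_mass \<sigma> \<pi> \<zeta> lam n ?D"
      have pos: "0 < ?m UNIV" by (rule posterior_mass_pos[OF n(1) x])
      \<comment> \<open>The second part of the bound is zero: every level is controlled by its
        likelihood, and the prior upper tail does not enter.\<close>
      have "?m (- mono_event M0 n) \<le> ?m UNIV / real n + suminf (\<lambda>J. 0)"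
      proof (rule posterior_mass_le[OF x])
        fix J \<theta> assume J: "J \<ge> 1" "(J, step_fn J \<theta>) \<in> - mono_event M0 n"
        then have "likelihood \<sigma> n ?D (step_fn J \<theta>) \<le> ?m UNIV / real n"
          using monotone_truth_bound[OF M0 n(1) x f0 K n(2) occ noise J(1)] by auto
        then show "pmf \<pi> J * likelihood \<sigma> n ?D (step_fn J \<theta>) \<le> pmf \<pi> J * (?m UNIV / real n) + 0"
          by (simp only: add_0_right) (intro mult_left_mono, auto)
      qed (use pos n1 in auto)
      then have "?m (- mono_event M0 n) \<le> ?m UNIV * (1 / real n)" by simp
      also have "\<dots> \<le> ?m UNIV * (1 - \<gamma>)" using pos n(3) by (intro mult_left_mono) auto
      finally have "\<gamma> * ?m UNIV \<le> ?m (mono_event M0 n)"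
        using posterior_mass_split[where A = "mono_event M0 n" and y = "\<lambda>i. f0 (pts \<omega> i) + errs \<omega> i", OF x mono_event_measurable]
        by (simp add: algebra_simps)
      then have "\<gamma> \<le> post_prob n ?D (mono_event M0 n)"
        using pos by (simp add: posterior_def pos_le_divide_eq)
      then show "test \<gamma> M0 n ?D = 0" by (simp add: mono_test_eq)
    qed (auto simp: mono_test_eq)
    also have "\<dots> = (\<integral>\<^sup>+\<omega>. \<Psi>1 \<omega> \<partial>sample n) + (\<integral>\<^sup>+\<omega>. \<Psi>2 \<omega> \<partial>sample n)"
      by (intro nn_integral_add \<Psi>1 \<Psi>2)
    also have "\<dots> \<le> ennreal (1 / real n) + ennreal (1 / real n)" by (intro add_mono \<Psi>1 \<Psi>2)
    also have "\<dots> = ennreal (2 / real n)" by (simp add: ennreal_plus[symmetric] del: ennreal_plus)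
    finally show ?thesis by (subst (asm) ennreal_le_iff) auto
  qed
  have ev: "\<forall>\<^sub>F n in sequentially. 1 / real n \<le> 1 - \<gamma>"
    using order_tendstoD(2)[OF lim_1_over_n, of "1 - \<gamma>"] \<gamma> by (auto elim: eventually_mono)
  show ?thesis
  proof (rule tendsto_sandwich[where f = "\<lambda>_. 0" and h = "\<lambda>n. 2 / real n"])
    show "\<forall>\<^sub>F n in sequentially. true_expectation G Q f0 n (test \<gamma> M0 n) \<le> 2 / real n"
      using eventually_ln_ge[of 1] eventually_ln_ge[of "K\<^sup>2"] ev by eventually_elim (rule le)
    show "(\<lambda>n. 2 / real n) \<longlonglongrightarrow> 0" by (rule lim_const_over_n)
  qed (auto intro!: true_expectation_nonneg always_eventually simp: mono_test_eq)
qed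

subsection \<open>Alternatives\<close>

text \<open>With F the projection of v on level J, the noise meets v - F through
  \<open>cross_small\<close> and F - \<theta> only through its own projection, through
  \<open>noise_small\<close>. Each of the two loses at most a quarter of its squared norm, which
  leaves 3/4.\<close>

lemma rss_ge:
  assumes noise: "noise_small n x e" and cross: "cross_small n x e v" and J: "J \<ge> 1"
  shows "(\<Sum>i<n. (e i)\<^sup>2) + 3 / 4 * (\<Sum>i<n. (\<theta> (cidx J (x i)) - v i)\<^sup>2) - 72 * sg\<^sup>2 * (real J ^ CARD('d) + ln (real n))
    \<le> rss n x (\<lambda>i. v i + e i) J \<theta>"
proof -
  define F where "F i = fit n x v J (cidx J (x i))" for i
  define t where "t i = \<theta> (cidx J (x i))" for i
  define E where "E i = fit n x e J (cidx J (x i))" for i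
  have pyth: "(\<Sum>i<n. (v i - t i)\<^sup>2) = (\<Sum>i<n. (v i - F i)\<^sup>2) + (\<Sum>i<n. (F i - t i)\<^sup>2)"
    using cavg_pythagoras[of v \<theta> "\<lambda>i. cidx J (x i)" n] by (simp add: F_def t_def)
  have "(\<Sum>i<n. e i * (F i - t i)) = (\<Sum>i<n. E i * (F i - t i))"
    using sum_mult_cavg[of e "\<lambda>j. fit n x v J j - \<theta> j" "\<lambda>i. cidx J (x i)" n] by (simp add: F_def t_def E_def)
  also have "\<dots> \<ge> (\<Sum>i<n. - (2 * (E i)\<^sup>2 + (F i - t i)\<^sup>2 / 8))"
  proof (intro sum_mono)
    fix i
    \<comment> \<open>Completing the square with the weight that matches the fraction 1/8 of
      \<open>cross_small\<close>.\<close>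
    have "0 \<le> (4 * E i + (F i - t i))\<^sup>2" by simp
    then show "- (2 * (E i)\<^sup>2 + (F i - t i)\<^sup>2 / 8) \<le> E i * (F i - t i)"
      by (simp add: power2_sum power_mult_distrib)
  qed
  finally have c2: "- (2 * (\<Sum>i<n. (E i)\<^sup>2)) - (\<Sum>i<n. (F i - t i)\<^sup>2) / 8 \<le> (\<Sum>i<n. e i * (F i - t i))"
    by (simp add: sum_negf sum_subtractf sum_distrib_left sum_divide_distrib)
  have V: "(\<Sum>i<n. (E i)\<^sup>2) \<le> 12 * sg\<^sup>2 * (real J ^ CARD('d) + ln (real n))"
    using noise J unfolding noise_small_def E_def by blast
  have c1: "- ((\<Sum>i<n. (v i - F i)\<^sup>2) / 8 + 4 * sg\<^sup>2 * (3 * ln (real n) + real J)) \<le> (\<Sum>i<n. e i * (v i - F i))"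
    using cross[unfolded cross_small_def, rule_format, OF J] unfolding F_def by (simp add: abs_le_iff)
  have JJ: "real J \<le> real J ^ CARD('d)" using J by (intro self_le_power) auto
  also have "\<dots> \<le> 3 * real J ^ CARD('d)" by simp
  finally have "3 * ln (real n) + real J \<le> 3 * (real J ^ CARD('d) + ln (real n))"
    by (simp add: distrib_left)
  then have "4 * sg\<^sup>2 * (3 * ln (real n) + real J) \<le> 4 * sg\<^sup>2 * (3 * (real J ^ CARD('d) + ln (real n)))"
    by (intro mult_left_mono) auto
  also have "\<dots> = 12 * sg\<^sup>2 * (real J ^ CARD('d) + ln (real n))" by (simp add: algebra_simps)
  finally have "4 * sg\<^sup>2 * (3 * ln (real n) + real J) \<le> 12 * sg\<^sup>2 * (real J ^ CARD('d) + ln (real n))" .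
  moreover have "rss n x (\<lambda>i. v i + e i) J \<theta> = (\<Sum>i<n. (e i)\<^sup>2) + 2 * ((\<Sum>i<n. e i * (v i - F i)) + (\<Sum>i<n. e i * (F i - t i))) + (\<Sum>i<n. (v i - t i)\<^sup>2)"
  proof -
    have "rss n x (\<lambda>i. v i + e i) J \<theta> = (\<Sum>i<n. (e i)\<^sup>2 + 2 * (e i * (v i - F i) + e i * (F i - t i)) + (v i - t i)\<^sup>2)"
      unfolding rss_def t_def[symmetric] by (intro sum.cong) (auto simp: power2_eq_square algebra_simps)
    then show ?thesis by (simp add: sum.distrib sum_distrib_left)
  qed
  moreover have "(\<Sum>i<n. (\<theta> (cidx J (x i)) - v i)\<^sup>2) = (\<Sum>i<n. (v i - t i)\<^sup>2)"
    by (simp add: t_def power2_commute)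
  \<comment> \<open>Of the six units, four come from the projected noise (twice the 2 of the
    completed square) and two from the doubled bound of the cross term.\<close>
  moreover have "72 * sg\<^sup>2 * (real J ^ CARD('d) + ln (real n)) = 6 * (12 * sg\<^sup>2 * (real J ^ CARD('d) + ln (real n)))" by simp
  ultimately show ?thesis using c1 c2 V pyth unfolding distrib_left minus_add_distrib by linarith
qed

text \<open>The 2 absorbs the squared bias and a quarter of it from the cross term; 48
  \<open>sg\<close>^2 is twice the noise bound 24 \<open>sg\<close>^2 of that cross term.\<close>

definition reference_const :: real where
  "reference_const = mass_const + (2 + 48 * sg\<^sup>2) / (2 * \<sigma>\<^sup>2)"

text \<open>A level with small bias has evidence close to the likelihood at the truth, up to its
  complexity and its empirical squared bias.\<close>

lemma reference_mass:
  assumes ln: "1 \<le> ln (real n)" and J: "2 \<le> J" "J \<le> n" and x: "\<forall>i<n. x i \<in> cbox 0 1"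
    and noise: "noise_small n x e" and cross: "cross_small n x e v"
    and v: "\<forall>i<n. \<bar>v i\<bar> \<le> K" and K: "K\<^sup>2 \<le> ln (real n)"
  shows "lik_const n * exp (- (\<Sum>i<n. (e i)\<^sup>2) / (2 * \<sigma>\<^sup>2)
      - reference_const * (real J ^ CARD('d) * ln (real n) + (\<Sum>i<n. (v i - fit n x v J (cidx J (x i)))\<^sup>2)))
    \<le> pmass n x (\<lambda>i. v i + e i) UNIV"
proof -
  define C0 where "C0 = mass_const"
  define C where "C = C0 + (2 + 48 * sg\<^sup>2) / (2 * \<sigma>\<^sup>2)"
  have C0: "0 < C0" using mass_const_pos by (simp add: C0_def)
  define y where "y = (\<lambda>i. v i + e i)"
  define F where "F i = fit n x v J (cidx J (x i))" for i
  define T where "T = real J ^ CARD('d) * ln (real n)"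
  define A where "A = (\<Sum>i<n. (v i - F i)\<^sup>2)"
  have J1: "J \<ge> 1" using J by simp
  have "real J \<le> real J ^ CARD('d)" using J by (intro self_le_power) auto
  moreover have "real J ^ CARD('d) + ln (real n) \<le> 2 * T"
    unfolding T_def using ln J by (intro add_le_twice_mult one_le_power) auto
  ultimately have "3 * ln (real n) + real J \<le> 6 * T" using ln by linarith
  from mult_left_mono[OF this, of "4 * sg\<^sup>2"] have "4 * sg\<^sup>2 * (3 * ln (real n) + real J) \<le> 24 * sg\<^sup>2 * T"
    by simp
  moreover have "(\<Sum>i<n. e i * (v i - F i)) \<le> A / 8 + 4 * sg\<^sup>2 * (3 * ln (real n) + real J)"
    using cross[unfolded cross_small_def, rule_format, OF J1] unfolding F_def A_def by (simp add: abs_le_iff)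
  moreover have "rss n x y J (fit n x v J) = (\<Sum>i<n. (e i)\<^sup>2) + 2 * (\<Sum>i<n. e i * (v i - F i)) + A"
  proof -
    have "rss n x y J (fit n x v J) = (\<Sum>i<n. (e i)\<^sup>2 + 2 * (e i * (v i - F i)) + (v i - F i)\<^sup>2)"
      unfolding rss_def F_def[symmetric] y_def by (intro sum.cong) (auto simp: power2_eq_square algebra_simps)
    then show ?thesis by (simp add: sum.distrib sum_distrib_left A_def)
  qed
  \<comment> \<open>The least squares fit to the data does at least as well as the projection of the
    truth.\<close>
  moreover have "rss n x y J (fit n x y J) \<le> rss n x y J (fit n x v J)"
    using rss_pythagoras[of n x y J "fit n x v J"] by (simp add: sum_nonneg)
  moreover have "0 \<le> A" "0 \<le> T" using ln by (auto simp: A_def T_def intro!: sum_nonneg)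
  moreover have "(2 + 48 * sg\<^sup>2) * (T + A) = 2 * T + 2 * A + 48 * sg\<^sup>2 * T + 48 * sg\<^sup>2 * A" by (simp add: algebra_simps)
  moreover have "0 \<le> 48 * sg\<^sup>2 * A" using \<open>0 \<le> A\<close> by simp
  ultimately have "rss n x y J (fit n x y J) \<le> (\<Sum>i<n. (e i)\<^sup>2) + (2 + 48 * sg\<^sup>2) * (T + A)" by linarith
  then have "rss n x y J (fit n x y J) / (2 * \<sigma>\<^sup>2) \<le> ((\<Sum>i<n. (e i)\<^sup>2) + (2 + 48 * sg\<^sup>2) * (T + A)) / (2 * \<sigma>\<^sup>2)"
    by (intro divide_right_mono) auto
  moreover have "C0 * T \<le> C0 * (T + A)" using C0 \<open>0 \<le> A\<close> by simp
  moreover have "C * (T + A) = C0 * (T + A) + (2 + 48 * sg\<^sup>2) * (T + A) / (2 * \<sigma>\<^sup>2)"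
    by (simp add: C_def distrib_right)
  ultimately have "- (\<Sum>i<n. (e i)\<^sup>2) / (2 * \<sigma>\<^sup>2) - C * (T + A) \<le> - rss n x y J (fit n x y J) / (2 * \<sigma>\<^sup>2) - C0 * T"
    by (simp add: add_divide_distrib)
  then have "lik_const n * exp (- (\<Sum>i<n. (e i)\<^sup>2) / (2 * \<sigma>\<^sup>2) - C * (T + A)) \<le>
    lik_const n * exp (- rss n x y J (fit n x y J) / (2 * \<sigma>\<^sup>2) - C0 * T)"
    using lik_const_pos[of n] by simp
  also have "\<dots> \<le> pmass n x (\<lambda>i. v i + e i) UNIV"
    using posterior_mass_lower[OF ln J x noise v K] by (simp add: y_def T_def C0_def)
  finally show ?thesis by (simp add: T_def A_def F_def C_def C0_def reference_const_def)
qed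

text \<open>One constant for both the deficit of the reference level and the noise loss of
  \<open>rss_ge\<close> on competing levels.\<close>

definition posterior_const :: real where
  "posterior_const = reference_const + 72 * sg\<^sup>2 / (2 * \<sigma>\<^sup>2)"

lemma posterior_const_pos: "0 < posterior_const"
  using mass_const_pos by (simp add: posterior_const_def reference_const_def add_pos_nonneg)

text \<open>\<open>P\<close> bounds the log deficit of reference level \<open>J0\<close> against the
  likelihood at the truth, and \<open>Z\<close> is the exponent to be gained. Small levels gain it
  from the distance to the truth, big levels from the prior, where the extra J makes the sum over
  levels converge.\<close>

lemma posterior_small:
  assumes ln: "1 \<le> ln (real n)" and J0: "2 \<le> J0" "J0 \<le> n" and x: "\<forall>i<n. x i \<in> cbox 0 1"
    and noise: "noise_small n x e" and cross: "cross_small n x e v"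
    and v: "\<forall>i<n. \<bar>v i\<bar> \<le> K" and K: "K\<^sup>2 \<le> ln (real n)"
    and P: "posterior_const * (real J0 ^ CARD('d) * ln (real n) + (\<Sum>i<n. (v i - fit n x v J0 (cidx J0 (x i)))\<^sup>2)) \<le> P"
    and small: "\<And>J \<theta>. J \<ge> 1 \<Longrightarrow> (J, step_fn J \<theta>) \<in> A \<Longrightarrow> \<not> big J \<Longrightarrow>
      posterior_const * (real J ^ CARD('d) + ln (real n)) + P + Z \<le> 3 / (8 * \<sigma>\<^sup>2) * (\<Sum>i<n. (\<theta> (cidx J (x i)) - v i)\<^sup>2)"
    and big: "\<And>J. J \<ge> 1 \<Longrightarrow> big J \<Longrightarrow> 2 \<le> J \<and>
      posterior_const * (real J ^ CARD('d) + ln (real n)) + P + Z + real J \<le> b1 * real J ^ CARD('d) * ln (real J)"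
  shows "post_prob n (\<lambda>i. (x i, v i + e i)) A \<le> 3 * exp (- Z)"
proof -
  define C0 where "C0 = reference_const"
  define C where "C = posterior_const"
  note P = P[folded C_def] and small = small[folded C_def] and big = big[folded C_def]
  have "C0 > 0" using mass_const_pos by (simp add: C0_def reference_const_def add_pos_nonneg)
  then have C: "C > 0" "C0 \<le> C" "72 * sg\<^sup>2 / (2 * \<sigma>\<^sup>2) \<le> C"
    using sigma by (auto simp: C_def C0_def posterior_const_def add_pos_nonneg)
  let ?D = "\<lambda>i. (x i, v i + e i)"
  let ?m = "posterior_mass \<sigma> \<pi> \<zeta> lam n ?D"
  define U where "U = lik_const n * exp (- (\<Sum>i<n. (e i)\<^sup>2) / (2 * \<sigma>\<^sup>2))"
  define R where "R = real J0 ^ CARD('d) * ln (real n) + (\<Sum>i<n. (v i - fit n x v J0 (cidx J0 (x i)))\<^sup>2)"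
  have U: "0 < U" using lik_const_pos by (simp add: U_def)
  have "0 \<le> R" unfolding R_def using ln by (intro add_nonneg_nonneg sum_nonneg) auto
  then have "C0 * R \<le> P" using P C(2) by (auto simp: R_def intro: order.trans[OF mult_right_mono])
  then have "U * exp (- P) \<le> U * exp (- (C0 * R))" using U by simp
  also have "\<dots> = lik_const n * exp (- (\<Sum>i<n. (e i)\<^sup>2) / (2 * \<sigma>\<^sup>2) - C0 * R)"
    by (simp add: U_def mult.assoc exp_add[symmetric])
  also have "\<dots> \<le> ?m UNIV"
    unfolding R_def C0_def by (rule reference_mass[OF ln J0 x noise cross v K])
  finally have UP: "U * exp (- P) \<le> ?m UNIV" .
  then have pos: "0 < ?m UNIV" using U by (meson exp_gt_zero less_le_trans mult_pos_pos)
  have lik: "likelihood \<sigma> n ?D (step_fn J \<theta>) \<le> U * exp (C * (real J ^ CARD('d) + ln (real n)) - 3 / (8 * \<sigma>\<^sup>2) * (\<Sum>i<n. (\<theta> (cidx J (x i)) - v i)\<^sup>2))"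
    if J: "J \<ge> 1" for J \<theta>
  proof -
    let ?S = "\<Sum>i<n. (\<theta> (cidx J (x i)) - v i)\<^sup>2" and ?B = "real J ^ CARD('d) + ln (real n)"
    have "((\<Sum>i<n. (e i)\<^sup>2) + 3 / 4 * ?S - 72 * sg\<^sup>2 * ?B) / (2 * \<sigma>\<^sup>2) \<le> rss n x (\<lambda>i. v i + e i) J \<theta> / (2 * \<sigma>\<^sup>2)"
      by (intro divide_right_mono rss_ge[OF noise cross J]) simp
    moreover have "72 * sg\<^sup>2 / (2 * \<sigma>\<^sup>2) * ?B \<le> C * ?B"
      using ln by (intro mult_right_mono C(3) add_nonneg_nonneg) auto
    ultimately have "- rss n x (\<lambda>i. v i + e i) J \<theta> / (2 * \<sigma>\<^sup>2) \<le> - (\<Sum>i<n. (e i)\<^sup>2) / (2 * \<sigma>\<^sup>2) + (C * ?B - 3 / (8 * \<sigma>\<^sup>2) * ?S)"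
      by (simp add: add_divide_distrib diff_divide_distrib)
    then have "likelihood \<sigma> n ?D (step_fn J \<theta>) \<le> lik_const n * exp (- (\<Sum>i<n. (e i)\<^sup>2) / (2 * \<sigma>\<^sup>2) + (C * ?B - 3 / (8 * \<sigma>\<^sup>2) * ?S))"
      unfolding likelihood_eq[OF J x] using lik_const_pos[of n] by simp
    then show ?thesis unfolding U_def exp_add by (simp add: mult.assoc)
  qed
  \<comment> \<open>The 3 in the claim: 1 from the small levels and 2 from the geometric series,
    which starts at J = 0.\<close>
  have "?m A \<le> ?m UNIV * exp (- Z) + suminf (\<lambda>J. ?m UNIV * exp (- Z) * (1 / 2) ^ J)"
  proof (rule posterior_mass_le[OF x])
    fix J \<theta> assume J: "J \<ge> 1" and A: "(J, step_fn J \<theta>) \<in> A"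
    let ?S = "\<Sum>i<n. (\<theta> (cidx J (x i)) - v i)\<^sup>2" and ?B = "real J ^ CARD('d) + ln (real n)"
    have mono: "U * exp t \<le> ?m UNIV * exp (- Z - w)" if "t \<le> - P - Z - w" for t w
    proof -
      have "U * exp t \<le> U * exp (- P) * exp (- Z - w)"
        using that U by (simp add: exp_add[symmetric] mult.assoc)
      also have "\<dots> \<le> ?m UNIV * exp (- Z - w)" using UP by (intro mult_right_mono) auto
      finally show ?thesis .
    qed
    show "pmf \<pi> J * likelihood \<sigma> n ?D (step_fn J \<theta>) \<le> pmf \<pi> J * (?m UNIV * exp (- Z)) + ?m UNIV * exp (- Z) * (1 / 2) ^ J"
    proof (cases "big J")
      case False
      have "likelihood \<sigma> n ?D (step_fn J \<theta>) \<le> U * exp (C * ?B - 3 / (8 * \<sigma>\<^sup>2) * ?S)" by (rule lik[OF J])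
      also have "\<dots> \<le> ?m UNIV * exp (- Z - 0)" using small J A False by (intro mono) (auto simp: algebra_simps)
      finally have "pmf \<pi> J * likelihood \<sigma> n ?D (step_fn J \<theta>) \<le> pmf \<pi> J * (?m UNIV * exp (- Z))"
        by (intro mult_left_mono) auto
      moreover have "0 \<le> ?m UNIV * exp (- Z) * (1 / 2) ^ J" using pos by simp
      ultimately show ?thesis by linarith
    next
      case True
      then have J2: "2 \<le> J" and b: "C * ?B + P + Z + real J \<le> b1 * real J ^ CARD('d) * ln (real J)" using big J by auto
      have "likelihood \<sigma> n ?D (step_fn J \<theta>) \<le> U * exp (C * ?B - 3 / (8 * \<sigma>\<^sup>2) * ?S)" by (rule lik[OF J])
      \<comment> \<open>On big levels \<theta> may fit well; the squared distance is dropped and the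
        prior weight does all the work.\<close>
      also have "\<dots> \<le> U * exp (C * ?B)" using U by (simp add: sum_nonneg)
      finally have "pmf \<pi> J * likelihood \<sigma> n ?D (step_fn J \<theta>) \<le> exp (- b1 * real J ^ CARD('d) * ln (real J)) * (U * exp (C * ?B))"
        using pi_tails[OF J2] by (intro mult_mono likelihood_nonneg) auto
      also have "\<dots> = U * exp (C * ?B - b1 * real J ^ CARD('d) * ln (real J))"
        by (simp add: exp_add[symmetric] mult.left_commute)
      also have "\<dots> \<le> ?m UNIV * exp (- Z - real J)" using b by (intro mono) auto
      also have "\<dots> = ?m UNIV * exp (- Z) * exp (- 1) ^ J"
        by (simp add: exp_of_nat_mult[symmetric] exp_add[symmetric] mult.assoc)
      also have "\<dots> \<le> ?m UNIV * exp (- Z) * (1 / 2) ^ J"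
        using pos exp_ge_add_one_self[of "1 :: real"]
        by (intro mult_left_mono power_mono) (auto simp: exp_minus field_simps)
      finally have "pmf \<pi> J * likelihood \<sigma> n ?D (step_fn J \<theta>) \<le> ?m UNIV * exp (- Z) * (1 / 2) ^ J" .
      moreover have "0 \<le> pmf \<pi> J * (?m UNIV * exp (- Z))" using pos by simp
      ultimately show ?thesis by linarith
    qed
  qed (use pos in \<open>auto intro!: summable_mult summable_geometric\<close>)
  also have "suminf (\<lambda>J. ?m UNIV * exp (- Z) * (1 / 2) ^ J) = ?m UNIV * exp (- Z) * 2"
    by (subst suminf_mult) (auto simp: suminf_geometric)
  finally have "?m A \<le> 3 * exp (- Z) * ?m UNIV" by simp
  then show ?thesis using pos by (simp add: posterior_def pos_divide_le_eq)
qed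

lemma add_square_le: "(a + b)\<^sup>2 \<le> 2 * a\<^sup>2 + 2 * (b :: real)\<^sup>2"
  using sum_squares_bound[of a b] by (simp add: power2_sum)

text \<open>If \<open>f0\<close> is far from the monotone step functions of level \<open>J\<close>, a step function in the test event is
  far from \<open>f0\<close> also in the empirical norm; the two norms are compared on a refinement of level \<open>J * k\<close>
  fine enough for \<open>f0\<close> to be close to a step function.\<close>

lemma event_separated:
  assumes n: "1 \<le> ln (real n)" and x: "\<forall>i<n. x i \<in> cbox 0 1" and occ: "occupied n x"
    and f0: "f0 \<in> borel_measurable G" "\<forall>x\<in>cbox 0 1. \<bar>f0 x\<bar> \<le> K"
    and J: "J \<ge> 1" and k: "k \<ge> 1" and lev: "real (J * k) ^ CARD('d) * occ_const * ln (real n) \<le> real n"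
    and u: "(\<integral>x. (f0 x - u (cidx (J * k) x))\<^sup>2 \<partial>G) \<le> \<delta>"
      "(\<Sum>i<n. (f0 (x i) - u (cidx (J * k) (x i)))\<^sup>2) \<le> \<delta> * real n"
    and far: "\<And>h. h \<in> mono_step_fns J \<Longrightarrow> r \<le> (hell f0 h)\<^sup>2"
    and M0: "0 < M0" "16 * M0\<^sup>2 * (real J ^ CARD('d) * ln (real n) / real n) \<le> r"
    and \<delta>: "36 * \<delta> \<le> \<sigma>\<^sup>2 * r" and ev: "(J, step_fn J \<theta>) \<in> mono_event M0 n"
  shows "real n * \<sigma>\<^sup>2 * r / 32 \<le> (\<Sum>i<n. (\<theta> (cidx J (x i)) - f0 (x i))\<^sup>2)"
proof -
  note f0(1)[measurable]
  have n1: "n \<ge> 1" using n by (cases n) auto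
  then have np: "0 < real n" by simp
  have m: "J * k \<ge> 1" using J k by simp
  define t where "t = M0 * sqrt (real J ^ CARD('d) * ln (real n) / real n)"
  have t: "0 < t"
    unfolding t_def using M0(1) J less_le_trans[OF zero_less_one n] np
    by (intro mult_pos_pos real_sqrt_gt_zero divide_pos_pos zero_less_power) simp_all
  have t2: "t\<^sup>2 = M0\<^sup>2 * (real J ^ CARD('d) * ln (real n) / real n)"
    using n by (simp add: t_def power_mult_distrib)
  \<comment> \<open>The infimum need not be attained, so the radius is doubled; this uses t >
    0.\<close>
  have "hell_setdist (step_fn J \<theta>) (mono_step_fns J) < 2 * t"
    using ev t by (simp add: mono_event_def t_def)
  then obtain h where h: "h \<in> mono_step_fns J" "hell (step_fn J \<theta>) h < 2 * t"
    using hellinger_setdist_less_iff[OF mono_step_fns_nonempty] by blast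
  have hm: "h \<in> borel_measurable G" using h(1) step_fn_measurable[OF J] by (auto simp: mono_step_fns_def step_fns_def)
  have "(hell (step_fn J \<theta>) h)\<^sup>2 \<le> (2 * t)\<^sup>2" using h(2) by (intro power_mono hellinger_nonneg) auto
  moreover have "r \<le> 2 * (hell f0 (step_fn J \<theta>))\<^sup>2 + 2 * (hell (step_fn J \<theta>) h)\<^sup>2"
    by (rule order.trans[OF far[OF h(1)] hellinger_quasi_triangle[OF f0(1) step_fn_measurable[OF J] hm]])
  moreover have "16 * t\<^sup>2 \<le> r" using M0(2) t2 by simp
  \<comment> \<open>The two approximations give r \<le> 2 H^2 + 8 t^2 for the distance H of f0 from
    the step function, and 8 t^2 \<le> r / 2.\<close>
  ultimately have hel: "r / 4 \<le> (hell f0 (step_fn J \<theta>))\<^sup>2" by (simp add: power_mult_distrib)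
  \<comment> \<open>\<theta> read at the refined level, where it and \<open>u\<close> are functions
    of the same cell index and \<open>occupied_sum_le\<close> applies to their difference.\<close>
  define \<theta>' where "\<theta>' s = \<theta> (coarsen k s)" for s
  have fib: "\<theta> (cidx J z) = \<theta>' (cidx (J * k) z)" for z by (simp add: \<theta>'_def coarsen_cidx[OF k])
  have f0u: "integrable G (\<lambda>z. (f0 z - w (cidx (J * k) z))\<^sup>2)" for w
  proof -
    have i1: "integrable G (\<lambda>z. (f0 z)\<^sup>2)"
    proof (rule G.integrable_const_bound[where B = "K\<^sup>2"])
      show "AE z in G. norm ((f0 z)\<^sup>2) \<le> K\<^sup>2"
        using f0(2) by (intro AE_I2) (auto simp: space_G, metis abs_ge_zero power2_abs power_mono)
    qed simp
    have mw: "(\<lambda>z. w (cidx (J * k) z)) \<in> borel_measurable G" by (rule comp_cidx_measurable[OF m])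
    have i2: "integrable G (\<lambda>z. 2 * (f0 z)\<^sup>2 + 2 * (w (cidx (J * k) z))\<^sup>2)"
      using i1 integrable_comp_cidx[OF m, of "\<lambda>s. (w s)\<^sup>2"] by simp
    show ?thesis
    proof (rule Bochner_Integration.integrable_bound[OF i2])
      show "(\<lambda>z. (f0 z - w (cidx (J * k) z))\<^sup>2) \<in> borel_measurable G" using mw by measurable
      show "AE z in G. norm ((f0 z - w (cidx (J * k) z))\<^sup>2) \<le> norm (2 * (f0 z)\<^sup>2 + 2 * (w (cidx (J * k) z))\<^sup>2)"
        using add_square_le[of "f0 z" "- w (cidx (J * k) z)" for z] by (intro AE_I2) simp
    qed
  qed
  have step_eq: "step_fn J \<theta> z = \<theta>' (cidx (J * k) z)" if "z \<in> cbox 0 1" for z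
    using step_fn_eq[OF J that, of \<theta>] fib by simp
  have intf: "integrable G (\<lambda>z. (f0 z - step_fn J \<theta> z)\<^sup>2)"
    using f0u[of \<theta>'] by (subst Bochner_Integration.integrable_cong[OF refl]) (auto simp: space_G step_eq)
  have "r / 4 \<le> (\<integral>z. (f0 z - step_fn J \<theta> z)\<^sup>2 \<partial>G) / (4 * \<sigma>\<^sup>2)"
    by (rule order.trans[OF hel hellinger_sq_le[OF intf f0(1) step_fn_measurable[OF J]]])
  then have "\<sigma>\<^sup>2 * r \<le> (\<integral>z. (f0 z - step_fn J \<theta> z)\<^sup>2 \<partial>G)"
    using sigma by (simp add: field_simps)
  also have "\<dots> = (\<integral>z. (f0 z - \<theta>' (cidx (J * k) z))\<^sup>2 \<partial>G)"
    by (intro Bochner_Integration.integral_cong) (auto simp: space_G step_eq)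
  also have "\<dots> \<le> (\<integral>z. 2 * (f0 z - u (cidx (J * k) z))\<^sup>2 + 2 * (u (cidx (J * k) z) - \<theta>' (cidx (J * k) z))\<^sup>2 \<partial>G)"
  proof (intro integral_mono f0u)
    show "integrable G (\<lambda>z. 2 * (f0 z - u (cidx (J * k) z))\<^sup>2 + 2 * (u (cidx (J * k) z) - \<theta>' (cidx (J * k) z))\<^sup>2)"
      using f0u[of u] integrable_comp_cidx[OF m, of "\<lambda>s. (u s - \<theta>' s)\<^sup>2"] by simp
    show "(f0 z - \<theta>' (cidx (J * k) z))\<^sup>2 \<le> 2 * (f0 z - u (cidx (J * k) z))\<^sup>2 + 2 * (u (cidx (J * k) z) - \<theta>' (cidx (J * k) z))\<^sup>2" for z
      using add_square_le[of "f0 z - u (cidx (J * k) z)" "u (cidx (J * k) z) - \<theta>' (cidx (J * k) z)"] by simp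
  qed
  also have "\<dots> = 2 * (\<integral>z. (f0 z - u (cidx (J * k) z))\<^sup>2 \<partial>G) + 2 * (\<integral>z. (u (cidx (J * k) z) - \<theta>' (cidx (J * k) z))\<^sup>2 \<partial>G)"
    using f0u[of u] integrable_comp_cidx[OF m, of "\<lambda>s. (u s - \<theta>' s)\<^sup>2"] by simp
  also have "(\<integral>z. (u (cidx (J * k) z) - \<theta>' (cidx (J * k) z))\<^sup>2 \<partial>G) = (\<Sum>s\<in>grid (J * k). measure G (cell (J * k) s) * (u s - \<theta>' s)\<^sup>2)"
    by (rule integral_comp_cidx[OF m, of "\<lambda>s. (u s - \<theta>' s)\<^sup>2"])
  also have "\<dots> \<le> 4 / real n * (\<Sum>i<n. (u (cidx (J * k) (x i)) - \<theta>' (cidx (J * k) (x i)))\<^sup>2)"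
    by (rule occupied_sum_le[OF occ x n1 m lev]) simp
  also have "\<dots> \<le> 4 / real n * (2 * (\<Sum>i<n. (f0 (x i) - u (cidx (J * k) (x i)))\<^sup>2) + 2 * (\<Sum>i<n. (\<theta> (cidx J (x i)) - f0 (x i))\<^sup>2))"
  proof (intro mult_left_mono)
    have "(\<Sum>i<n. (u (cidx (J * k) (x i)) - \<theta>' (cidx (J * k) (x i)))\<^sup>2) \<le>
      (\<Sum>i<n. 2 * (f0 (x i) - u (cidx (J * k) (x i)))\<^sup>2 + 2 * (\<theta> (cidx J (x i)) - f0 (x i))\<^sup>2)"
    proof (intro sum_mono)
      fix i
      show "(u (cidx (J * k) (x i)) - \<theta>' (cidx (J * k) (x i)))\<^sup>2 \<le>
        2 * (f0 (x i) - u (cidx (J * k) (x i)))\<^sup>2 + 2 * (\<theta> (cidx J (x i)) - f0 (x i))\<^sup>2"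
        using add_square_le[of "f0 (x i) - u (cidx (J * k) (x i))" "\<theta> (cidx J (x i)) - f0 (x i)"]
        by (simp add: fib power2_commute[of "u _"])
    qed
    then show "(\<Sum>i<n. (u (cidx (J * k) (x i)) - \<theta>' (cidx (J * k) (x i)))\<^sup>2) \<le>
      2 * (\<Sum>i<n. (f0 (x i) - u (cidx (J * k) (x i)))\<^sup>2) + 2 * (\<Sum>i<n. (\<theta> (cidx J (x i)) - f0 (x i))\<^sup>2)"
      by (simp add: sum.distrib sum_distrib_left)
  qed simp
  also have "\<dots> \<le> 4 / real n * (2 * (\<delta> * real n) + 2 * (\<Sum>i<n. (\<theta> (cidx J (x i)) - f0 (x i))\<^sup>2))"
    using u(2) by (intro mult_left_mono) auto
  also have "\<dots> = 8 * \<delta> + 8 / real n * (\<Sum>i<n. (\<theta> (cidx J (x i)) - f0 (x i))\<^sup>2)"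
    using np by (simp add: distrib_left)
  finally have "\<sigma>\<^sup>2 * r \<le> 18 * \<delta> + 16 / real n * (\<Sum>i<n. (\<theta> (cidx J (x i)) - f0 (x i))\<^sup>2)"
    using u(1) by simp
  \<comment> \<open>The approximation error enters as 2 \<delta> in the population norm and 16
    \<delta> in the empirical norm; the hypothesis on \<delta> keeps half of the separation.\<close>
  then have "\<sigma>\<^sup>2 * r / 2 \<le> 16 / real n * (\<Sum>i<n. (\<theta> (cidx J (x i)) - f0 (x i))\<^sup>2)" using \<delta> by simp
  then show ?thesis using np by (simp add: field_simps)
qed

text \<open>The three standing good events cost 1 / n, 1 / n and 2 / n. The free penalty \<Psi>'
  leaves room for events that depend on the approximation of f0.\<close>

lemma alternative_expectation_le:
  assumes n: "1 \<le> ln (real n)" and f0: "f0 \<in> borel_measurable G" and \<Psi>': "\<Psi>' \<in> borel_measurable (sample n)"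
    and good: "\<And>\<omega>. \<omega> \<in> space (sample n) \<Longrightarrow> occupied n (pts \<omega>) \<Longrightarrow> noise_small n (pts \<omega>) (errs \<omega>) \<Longrightarrow>
      cross_small n (pts \<omega>) (errs \<omega>) (\<lambda>i. f0 (pts \<omega> i)) \<Longrightarrow> \<Psi>' \<omega> < 1 \<Longrightarrow>
      post_prob n (\<lambda>i. (pts \<omega> i, f0 (pts \<omega> i) + errs \<omega> i)) (mono_event M0 n) < \<gamma>"
  shows "ennreal (type_II \<gamma> M0 f0 n)
    \<le> ennreal (4 / real n) + (\<integral>\<^sup>+\<omega>. \<Psi>' \<omega> \<partial>sample n)"
proof -
  have n1: "n \<ge> 1" using n by (cases n) auto
  obtain \<Psi>1 where \<Psi>1: "\<Psi>1 \<in> borel_measurable (sample n)" "(\<integral>\<^sup>+\<omega>. \<Psi>1 \<omega> \<partial>sample n) \<le> ennreal (1 / real n)"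
    "\<And>\<omega>. \<omega> \<in> space (sample n) \<Longrightarrow> \<Psi>1 \<omega> < 1 \<Longrightarrow> occupied n (pts \<omega>)"
    using occupied_penalty[OF n1 n] by blast
  obtain \<Psi>2 where \<Psi>2: "\<Psi>2 \<in> borel_measurable (sample n)" "(\<integral>\<^sup>+\<omega>. \<Psi>2 \<omega> \<partial>sample n) \<le> ennreal (1 / real n)"
    "\<And>\<omega>. \<omega> \<in> space (sample n) \<Longrightarrow> \<Psi>2 \<omega> < 1 \<Longrightarrow> noise_small n (pts \<omega>) (errs \<omega>)"
    using noise_penalty[OF n1] by blast
  obtain \<Psi>3 where \<Psi>3: "\<Psi>3 \<in> borel_measurable (sample n)" "(\<integral>\<^sup>+\<omega>. \<Psi>3 \<omega> \<partial>sample n) \<le> ennreal (2 / real n)"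
    "\<And>\<omega>. \<omega> \<in> space (sample n) \<Longrightarrow> \<Psi>3 \<omega> < 1 \<Longrightarrow> cross_small n (pts \<omega>) (errs \<omega>) (\<lambda>i. f0 (pts \<omega> i))"
    using cross_penalty[OF n1 f0] by blast
  note [measurable] = \<Psi>1(1) \<Psi>2(1) \<Psi>3(1) \<Psi>'
  have "ennreal (type_II \<gamma> M0 f0 n) \<le>
    (\<integral>\<^sup>+\<omega>. \<Psi>1 \<omega> + (\<Psi>2 \<omega> + (\<Psi>3 \<omega> + \<Psi>' \<omega>)) \<partial>sample n)"
  proof (rule true_expectation_le)
    fix \<omega> assume \<omega>: "\<omega> \<in> space (sample n)" and lt: "\<Psi>1 \<omega> + (\<Psi>2 \<omega> + (\<Psi>3 \<omega> + \<Psi>' \<omega>)) < 1"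
    have lts: "\<Psi>1 \<omega> < 1" "\<Psi>2 \<omega> + (\<Psi>3 \<omega> + \<Psi>' \<omega>) < 1"
      by (rule le_less_trans[OF _ lt], simp)+
    have "\<Psi>2 \<omega> < 1" and lt2: "\<Psi>3 \<omega> + \<Psi>' \<omega> < 1" by (rule le_less_trans[OF _ lts(2)], simp)+
    moreover have "\<Psi>3 \<omega> < 1" "\<Psi>' \<omega> < 1" by (rule le_less_trans[OF _ lt2], simp)+
    ultimately show "1 - test \<gamma> M0 n (\<lambda>i. (pts \<omega> i, f0 (pts \<omega> i) + errs \<omega> i)) = 0"
      using good[OF \<omega>] \<Psi>1(3)[OF \<omega> lts(1)] \<Psi>2(3)[OF \<omega>] \<Psi>3(3)[OF \<omega>] by (simp add: mono_test_eq)
  qed (auto simp: mono_test_eq)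
  also have "\<dots> = (\<integral>\<^sup>+\<omega>. \<Psi>1 \<omega> \<partial>sample n) + ((\<integral>\<^sup>+\<omega>. \<Psi>2 \<omega> \<partial>sample n) + ((\<integral>\<^sup>+\<omega>. \<Psi>3 \<omega> \<partial>sample n) + (\<integral>\<^sup>+\<omega>. \<Psi>' \<omega> \<partial>sample n)))"
    by (simp add: nn_integral_add)
  also have "\<dots> \<le> ennreal (1 / real n) + (ennreal (1 / real n) + (ennreal (2 / real n) + (\<integral>\<^sup>+\<omega>. \<Psi>' \<omega> \<partial>sample n)))"
    by (intro add_mono \<Psi>1 \<Psi>2 \<Psi>3 order_refl)
  also have "\<dots> = ennreal (4 / real n) + (\<integral>\<^sup>+\<omega>. \<Psi>' \<omega> \<partial>sample n)"
    by (simp add: add.assoc[symmetric] ennreal_plus[symmetric] del: ennreal_plus)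
  finally show ?thesis .
qed

section \<open>Approximation by step functions and separation of a fixed alternative\<close>

lemma borel_measurable_G: "f \<in> borel_measurable borel \<Longrightarrow> f \<in> borel_measurable G"
  unfolding measurable_cong_sets[OF sets_G refl]
  by (intro measurable_restrict_space1 measurable_completion) simp

lemma AE_G_not_negligible:
  assumes "negligible N"
  shows "AE x in G. x \<notin> N"
proof -
  have "AE x in lebesgue. x \<notin> N"
    using assms by (intro AE_not_in) (simp add: negligible_iff_null_sets)
  then have "AE x in lebesgue_on (cbox 0 1). x \<notin> N"
    by (subst AE_restrict_space_iff) (auto elim: eventually_mono)
  then have "AE x in density (lebesgue_on (cbox 0 1)) (\<lambda>x. ennreal (g x)). x \<notin> N"
    using G_density(1) by (subst AE_density) (auto elim: eventually_mono)
  then show ?thesis by (simp only: G_density(2)[symmetric])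
qed

text \<open>Evaluating a function at one representative point per cell yields step function
  coefficients close to it.\<close>

definition cell_point :: "nat \<Rightarrow> nat ^ 'd \<Rightarrow> real ^ 'd" where
  "cell_point m s = (SOME z. z \<in> cbox 0 1 \<and> cidx m z = s)"

lemma cell_point:
  assumes "x \<in> cbox 0 1" "m \<ge> 1"
  shows "cell_point m (cidx m x) \<in> cbox 0 1" "norm (x - cell_point m (cidx m x)) \<le> real CARD('d) / real m"
proof -
  have "\<exists>z. z \<in> cbox 0 1 \<and> cidx m z = cidx m x" using assms(1) by blast
  from someI_ex[OF this]
  have "cell_point m (cidx m x) \<in> cbox 0 1 \<and> cidx m (cell_point m (cidx m x)) = cidx m x"
    unfolding cell_point_def .
  then show "cell_point m (cidx m x) \<in> cbox 0 1" "norm (x - cell_point m (cidx m x)) \<le> real CARD('d) / real m"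
    using dist_same_cell[OF assms(2,1)] by auto
qed

lemma clip_contraction: "\<bar>a\<bar> \<le> K \<Longrightarrow> \<bar>a - max (- K) (min K b)\<bar> \<le> \<bar>a - (b :: real)\<bar>"
  by (auto simp: max_def min_def abs_if split: if_splits)

text \<open>A Lebesgue measurable function is an almost everywhere limit of continuous ones.
  Clipping allows dominated convergence, and uniform continuity on the cube replaces a continuous
  approximant by its values at cell points.\<close>

lemma step_approximation:
  fixes f0 :: "real ^ 'd \<Rightarrow> real"
  assumes f0: "f0 \<in> borel_measurable G" "\<forall>x\<in>cbox 0 1. \<bar>f0 x\<bar> \<le> K" and K: "0 \<le> K" and \<kappa>: "0 < \<kappa>"
  shows "\<exists>m\<ge>2. \<exists>u. (\<forall>s. \<bar>u s\<bar> \<le> K) \<and> (\<integral>x. (f0 x - u (cidx m x))\<^sup>2 \<partial>G) \<le> \<kappa>"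
proof -
  note f0(1)[measurable]
  have "f0 \<in> borel_measurable (lebesgue_on (cbox 0 1))"
    using f0(1) by (simp add: measurable_cong_sets[OF sets_G refl])
  then have "f0 measurable_on (cbox 0 1)"
    using measurable_on_iff_borel_measurable[of "cbox 0 1" f0] by auto
  then obtain N h where N: "negligible N" and h: "\<And>k. continuous_on UNIV (h k)"
    and lim: "\<And>x. x \<notin> N \<Longrightarrow> (\<lambda>k :: nat. h k x) \<longlonglongrightarrow> (if x \<in> cbox 0 1 then f0 x else 0)"
    unfolding measurable_on_def by blast
  \<comment> \<open>Clipping at the bound of f0 preserves continuity and the limit, and dominates
    the squared errors by (2 K)^2.\<close>
  define c where "c k x = max (- K) (min K (h k x))" for k x
  have cK: "\<bar>c k x\<bar> \<le> K" for k x using K by (auto simp: c_def)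
  have c_cont: "continuous_on UNIV (c k)" for k
    unfolding c_def by (intro continuous_on_max continuous_on_min continuous_on_const h)
  have c_meas[measurable]: "c k \<in> borel_measurable G" for k
    by (intro borel_measurable_G borel_measurable_continuous_onI c_cont)
  have "(\<lambda>k. \<integral>x. (f0 x - c k x)\<^sup>2 \<partial>G) \<longlonglongrightarrow> (\<integral>x. 0 \<partial>G)"
  proof (rule integral_dominated_convergence[where w = "\<lambda>_. (2 * K)\<^sup>2"])
    show "AE x in G. (\<lambda>k. (f0 x - c k x)\<^sup>2) \<longlonglongrightarrow> 0"
      using AE_G_not_negligible[OF N] AE_space
    proof eventually_elim
      case (elim x)
      then have x: "x \<in> cbox 0 1" by (simp add: space_G)
      have "(\<lambda>k. c k x) \<longlonglongrightarrow> max (- K) (min K (f0 x))"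
        unfolding c_def using lim[OF elim(1)] x by (intro tendsto_max tendsto_min tendsto_const) simp
      moreover have "max (- K) (min K (f0 x)) = f0 x" using f0(2) x by (auto simp: abs_le_iff)
      ultimately have "(\<lambda>k. (f0 x - c k x)\<^sup>2) \<longlonglongrightarrow> (f0 x - f0 x)\<^sup>2" by (intro tendsto_intros) simp
      then show ?case by simp
    qed
    fix k
    show "AE x in G. norm ((f0 x - c k x)\<^sup>2) \<le> (2 * K)\<^sup>2"
    proof (intro AE_I2)
      fix x assume "x \<in> space G"
      then have "\<bar>f0 x\<bar> \<le> K" using f0(2) by (simp add: space_G)
      then have "\<bar>f0 x - c k x\<bar> \<le> 2 * K" using cK[of k x] by linarith
      then have "\<bar>f0 x - c k x\<bar>\<^sup>2 \<le> (2 * K)\<^sup>2" by (intro power_mono) auto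
      then show "norm ((f0 x - c k x)\<^sup>2) \<le> (2 * K)\<^sup>2" by simp
    qed
  qed auto
  then have "\<forall>\<^sub>F k in sequentially. (\<integral>x. (f0 x - c k x)\<^sup>2 \<partial>G) < \<kappa> / 4"
    using \<kappa> by (intro order_tendstoD(2)) auto
  then obtain k where k: "(\<integral>x. (f0 x - c k x)\<^sup>2 \<partial>G) < \<kappa> / 4" by (auto simp: eventually_sequentially)
  have "uniformly_continuous_on (cbox 0 1) (c k)"
    by (intro compact_uniformly_continuous continuous_on_subset[OF c_cont]) auto
  then obtain \<eta> where \<eta>: "0 < \<eta>" "\<And>x z. x \<in> cbox 0 1 \<Longrightarrow> z \<in> cbox 0 1 \<Longrightarrow> dist z x < \<eta> \<Longrightarrow> dist (c k z) (c k x) < sqrt \<kappa> / 2"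
    unfolding uniformly_continuous_on_def using \<kappa> by (metis half_gt_zero real_sqrt_gt_zero)
  obtain m0 :: nat where m0: "real CARD('d) / \<eta> < real m0" using reals_Archimedean2 by blast
  \<comment> \<open>At least 2, so that the result can serve as the reference level of
    \<open>posterior_small\<close>.\<close>
  define m where "m = max 2 m0"
  have m: "m \<ge> 2" "m \<ge> 1" by (auto simp: m_def)
  have "real CARD('d) / \<eta> < real m" using m0 by (simp add: m_def)
  then have dm: "real CARD('d) / real m < \<eta>" using \<eta>(1) m by (simp add: field_simps)
  define u where "u s = c k (cell_point m s)" for s
  have uK: "\<bar>u s\<bar> \<le> K" for s using cK by (simp add: u_def)
  have mu: "(\<lambda>x. u (cidx m x)) \<in> borel_measurable G" by (rule comp_cidx_measurable[OF m(2)])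
  have sq: "(f0 x - u (cidx m x))\<^sup>2 \<le> 2 * (f0 x - c k x)\<^sup>2 + \<kappa> / 2" if x: "x \<in> cbox 0 1" for x
  proof -
    have "dist x (cell_point m (cidx m x)) < \<eta>"
      using cell_point[OF x m(2)] dm by (simp add: dist_norm)
    then have "dist (c k x) (c k (cell_point m (cidx m x))) < sqrt \<kappa> / 2"
      using \<eta>(2)[OF cell_point(1)[OF x m(2)] x] by simp
    then have "\<bar>c k x - u (cidx m x)\<bar> \<le> sqrt \<kappa> / 2" by (simp add: u_def dist_real_def)
    then have "\<bar>c k x - u (cidx m x)\<bar>\<^sup>2 \<le> (sqrt \<kappa> / 2)\<^sup>2" by (intro power_mono) auto
    then have "(c k x - u (cidx m x))\<^sup>2 \<le> \<kappa> / 4" using \<kappa> by (simp add: power_divide)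
    then show ?thesis using add_square_le[of "f0 x - c k x" "c k x - u (cidx m x)"] by simp
  qed
  have bnd: "(a - b)\<^sup>2 \<le> (2 * K)\<^sup>2" if "\<bar>a\<bar> \<le> K" "\<bar>b\<bar> \<le> K" for a b
  proof -
    have "\<bar>a - b\<bar>\<^sup>2 \<le> (2 * K)\<^sup>2" using that by (intro power_mono) auto
    then show ?thesis by simp
  qed
  have "integrable G (\<lambda>x. (f0 x - c k x)\<^sup>2)" "integrable G (\<lambda>x. (f0 x - u (cidx m x))\<^sup>2)"
    by (rule G.integrable_const_bound[where B = "(2 * K)\<^sup>2"], rule AE_I2,
      use mu f0(2) cK uK bnd in \<open>simp_all add: space_G\<close>)+
  note i1 = this
  have "(\<integral>x. (f0 x - u (cidx m x))\<^sup>2 \<partial>G) \<le> (\<integral>x. 2 * (f0 x - c k x)\<^sup>2 + \<kappa> / 2 \<partial>G)"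
    using i1 sq by (intro integral_mono) (auto simp: space_G)
  also have "\<dots> = 2 * (\<integral>x. (f0 x - c k x)\<^sup>2 \<partial>G) + \<kappa> / 2"
    using i1 by (subst Bochner_Integration.integral_add) (auto simp: G.prob_space)
  also have "\<dots> \<le> \<kappa>" using k by simp
  finally show ?thesis using m(1) uK by blast
qed

text \<open>Monotone step functions are unbounded as a class, so L1 separation does not compare
  directly with the bounded Hellinger distance. Clipping h to [-K, K] keeps it monotone and does not
  move it away from f0; for bounded differences the two distances are comparable.\<close>

lemma hellinger_separation:
  assumes f0: "f0 \<in> borel_measurable G" "\<forall>x\<in>cbox 0 1. \<bar>f0 x\<bar> \<le> K" "f0 \<notin> L1_closure G mono_fns" and K: "0 \<le> K"
  shows "\<exists>r>0. \<forall>J\<ge>1. \<forall>h\<in>mono_step_fns J. r \<le> (hell f0 h)\<^sup>2"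
proof -
  note f0(1)[measurable]
  have "integrable G f0"
    using f0 by (intro G.integrable_const_bound[where B = K] AE_I2) (auto simp: space_G)
  then obtain e where e: "e > 0" "\<And>h. h \<in> mono_fns \<Longrightarrow> integrable G h \<Longrightarrow> e \<le> (\<integral>x. \<bar>f0 x - h x\<bar> \<partial>G)"
    using f0(3) unfolding L1_closure_def by (auto simp: not_less)
  \<comment> \<open>The clipped difference y satisfies y^2 \<le> 4 K^2, so with t = y^2 / (8
    \<sigma>^2), 1 - exp(-t) \<ge> t / (1 + t) = y^2 / (8 \<sigma>^2 + y^2) \<ge> c y^2.\<close>
  define c where "c = 1 / (8 * \<sigma>\<^sup>2 + 4 * K\<^sup>2)"
  have c: "0 < c" using sigma by (simp add: c_def add_pos_nonneg)
  have "2 * (c * e\<^sup>2) \<le> (hell f0 h)\<^sup>2" if J: "J \<ge> 1" and h: "h \<in> mono_step_fns J" for J h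
  proof -
    have hm[measurable]: "h \<in> borel_measurable G" using h step_fn_measurable[OF J] by (auto simp: mono_step_fns_def step_fns_def)
    define hK where "hK x = max (- K) (min K (h x))" for x
    define y where "y x = \<bar>f0 x - hK x\<bar>" for x
    have hKm[measurable]: "hK \<in> borel_measurable G" unfolding hK_def by measurable
    have hKK: "\<bar>hK x\<bar> \<le> K" for x using K by (auto simp: hK_def)
    have "hK \<in> mono_fns"
    proof -
      have "h \<in> mono_fns" using h by (simp add: mono_step_fns_def)
      then show ?thesis unfolding mono_fns_def monotone_on_def hK_def by (fastforce intro!: max.mono min.mono)
    qed
    moreover have "integrable G hK" using hKK by (intro G.integrable_const_bound[where B = K] AE_I2) auto
    ultimately have ey: "e \<le> (\<integral>x. y x \<partial>G)" unfolding y_def by (rule e(2))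
    have y2K: "0 \<le> y x \<and> y x \<le> 2 * K" if "x \<in> cbox 0 1" for x
      using f0(2) that hKK[of x] unfolding y_def by fastforce
    have ym[measurable]: "y \<in> borel_measurable G" unfolding y_def by measurable
    have "(y x)\<^sup>2 \<le> (2 * K)\<^sup>2" if "x \<in> cbox 0 1" for x using y2K[OF that] by (intro power_mono) auto
    then have iy2: "integrable G (\<lambda>x. (y x)\<^sup>2)"
      by (intro G.integrable_const_bound[where B = "(2 * K)\<^sup>2"] AE_I2) (auto simp: space_G)
    have iy: "integrable G y"
      using y2K by (intro G.integrable_const_bound[where B = "2 * K"] AE_I2) (auto simp: space_G)
    \<comment> \<open>The second moment is bounded below through the mean by integrating 0 \<le> (y
      - e)^2.\<close>
    have "e\<^sup>2 = 2 * e * e - e\<^sup>2" by (simp add: power2_eq_square)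
    also have "\<dots> \<le> 2 * e * (\<integral>x. y x \<partial>G) - e\<^sup>2" using ey e(1) by simp
    also have "\<dots> = (\<integral>x. 2 * e * y x - e\<^sup>2 \<partial>G)"
      using iy by (subst Bochner_Integration.integral_diff) (auto simp: G.prob_space)
    also have "\<dots> \<le> (\<integral>x. (y x)\<^sup>2 \<partial>G)"
    proof (intro integral_mono)
      show "2 * e * y x - e\<^sup>2 \<le> (y x)\<^sup>2" for x
        using zero_le_power2[of "y x - e"] by (simp add: power2_diff mult_ac)
    qed (use iy iy2 in auto)
    finally have ey2: "e\<^sup>2 \<le> (\<integral>x. (y x)\<^sup>2 \<partial>G)" .
    have "(\<integral>x. c * (y x)\<^sup>2 \<partial>G) \<le> (\<integral>x. 1 - exp (- ((f0 x - h x)\<^sup>2 / (8 * \<sigma>\<^sup>2))) \<partial>G)"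
    proof (intro integral_mono)
      fix x assume "x \<in> space G"
      then have x: "x \<in> cbox 0 1" by (simp add: space_G)
      define t where "t = (y x)\<^sup>2 / (8 * \<sigma>\<^sup>2)"
      have "y x \<le> \<bar>f0 x - h x\<bar>" unfolding y_def hK_def using f0(2) x by (intro clip_contraction) auto
      then have "(y x)\<^sup>2 \<le> (f0 x - h x)\<^sup>2" using y2K[OF x] by (metis power2_abs power_mono)
      then have "t \<le> (f0 x - h x)\<^sup>2 / (8 * \<sigma>\<^sup>2)" unfolding t_def by (intro divide_right_mono) auto
      then have 1: "1 - exp (- t) \<le> 1 - exp (- ((f0 x - h x)\<^sup>2 / (8 * \<sigma>\<^sup>2)))" by simp
      have t0: "0 \<le> t" by (simp add: t_def)
      have "exp (- t) \<le> 1 / (1 + t)"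
        using exp_ge_add_one_self[of t] t0 by (simp add: exp_minus inverse_eq_divide frac_le)
      moreover have "1 - 1 / (1 + t) = t / (1 + t)" using t0 by (simp add: field_simps)
      moreover have "t / (1 + t) = (y x)\<^sup>2 / (8 * \<sigma>\<^sup>2 + (y x)\<^sup>2)"
        using sigma by (simp add: t_def divide_simps add_pos_nonneg) 
      moreover have "(y x)\<^sup>2 \<le> (2 * K)\<^sup>2" using y2K[OF x] by (intro power_mono) auto
      then have "c * (y x)\<^sup>2 \<le> (y x)\<^sup>2 / (8 * \<sigma>\<^sup>2 + (y x)\<^sup>2)"
        using sigma unfolding c_def by (simp add: power_mult_distrib) (intro divide_left_mono mult_pos_pos add_pos_nonneg, auto)
      ultimately show "c * (y x)\<^sup>2 \<le> 1 - exp (- ((f0 x - h x)\<^sup>2 / (8 * \<sigma>\<^sup>2)))" using 1 by linarith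
    qed (use iy iy2 in auto)
    also have "\<dots> = 1 - (\<integral>x. exp (- ((f0 x - h x)\<^sup>2 / (8 * \<sigma>\<^sup>2))) \<partial>G)"
      by (subst Bochner_Integration.integral_diff) (auto simp: G.prob_space)
    finally have "c * (\<integral>x. (y x)\<^sup>2 \<partial>G) \<le> 1 - (\<integral>x. exp (- ((f0 x - h x)\<^sup>2 / (8 * \<sigma>\<^sup>2))) \<partial>G)" by simp
    moreover have "c * e\<^sup>2 \<le> c * (\<integral>x. (y x)\<^sup>2 \<partial>G)" using ey2 c by (intro mult_left_mono) auto
    ultimately show ?thesis unfolding hellinger_sq by simp
  qed
  then show ?thesis using c e(1) by (intro exI[of _ "2 * (c * e\<^sup>2)"]) auto
qed

section \<open>Hoelder functions\<close>

lemma holder_classD: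
  assumes f: "f \<in> holder_class \<alpha> L"
  shows "\<forall>x\<in>cbox 0 (1 :: real ^ 'd). \<bar>f x\<bar> \<le> L"
    and "x \<in> cbox 0 (1 :: real ^ 'd) \<Longrightarrow> z \<in> cbox 0 1 \<Longrightarrow> \<bar>f x - f z\<bar> \<le> L * norm (x - z) powr \<alpha>"
proof -
  define A where "A = (SUP x\<in>cbox 0 (1 :: real ^ 'd). ereal \<bar>f x\<bar>)"
  define B where "B = (SUP (x, y)\<in>{(x, y). x \<in> cbox 0 (1 :: real ^ 'd) \<and> y \<in> cbox 0 1 \<and> x \<noteq> y}.
          ereal (\<bar>f x - f y\<bar> / norm (x - y) powr \<alpha>))"
  have AB: "A + B \<le> ereal L" using f by (simp add: holder_class_def A_def B_def)
  \<comment> \<open>Two distinct points of the cube: the suprema are then over nonempty sets and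
    nonnegative, so each one is bounded by L separately.\<close>
  have zo: "(0 :: real ^ 'd) \<in> cbox 0 1" "(1 :: real ^ 'd) \<in> cbox 0 1" "(0 :: real ^ 'd) \<noteq> 1"
    by (auto simp: mem_box_cart vec_eq_iff)
  have A1: "ereal \<bar>f x\<bar> \<le> A" if "x \<in> cbox 0 1" for x unfolding A_def using that by (intro SUP_upper)
  have B1: "ereal (\<bar>f x - f y\<bar> / norm (x - y) powr \<alpha>) \<le> B" if "x \<in> cbox 0 1" "y \<in> cbox 0 1" "x \<noteq> y" for x y
    unfolding B_def using that by (intro SUP_upper2[of "(x, y)"]) auto
  have A0: "0 \<le> A" using A1[OF zo(1)] by (rule order.trans[rotated]) simp
  have B0: "0 \<le> B" using B1[OF zo] by (rule order.trans[rotated]) simp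
  have AL: "A \<le> ereal L" using AB B0 by (metis add.right_neutral add_left_mono order.trans)
  have BL: "B \<le> ereal L" using AB A0 by (metis add.left_neutral add_right_mono order.trans)
  show "\<forall>x\<in>cbox 0 (1 :: real ^ 'd). \<bar>f x\<bar> \<le> L" using order.trans[OF A1 AL] by auto
  show "\<bar>f x - f z\<bar> \<le> L * norm (x - z) powr \<alpha>" if xz: "x \<in> cbox 0 (1 :: real ^ 'd)" "z \<in> cbox 0 1"
  proof (cases "x = z")
    case False
    then have "\<bar>f x - f z\<bar> / norm (x - z) powr \<alpha> \<le> L" using order.trans[OF B1[OF xz] BL] by simp
    then show ?thesis using False by (simp add: divide_le_eq)
  qed simp
qed

lemma holder_measurable:
  assumes f: "f \<in> holder_class \<alpha> L" and \<alpha>: "0 < \<alpha>" and L: "0 < L"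
  shows "f \<in> borel_measurable G"
proof -
  have "continuous_on (cbox 0 (1 :: real ^ 'd)) f"
    unfolding continuous_on_iff
  proof (intro ballI allI impI)
    fix x :: "real ^ 'd" and e :: real assume x: "x \<in> cbox 0 1" and e: "0 < e"
    define \<eta> where "\<eta> = (e / L) powr (1 / \<alpha>)"
    have "0 < \<eta>" using e L by (simp add: \<eta>_def)
    moreover have "dist (f z) (f x) < e" if z: "z \<in> cbox 0 1" "dist z x < \<eta>" for z
    proof -
      have "norm (z - x) powr \<alpha> < \<eta> powr \<alpha>"
        using z(2) \<alpha> by (intro powr_less_mono2) (auto simp: dist_norm)
      also have "\<eta> powr \<alpha> = e / L" using \<alpha> e L by (simp add: \<eta>_def powr_powr)
      finally have "L * norm (z - x) powr \<alpha> < e" using L by (simp add: field_simps)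
      then show ?thesis using holder_classD(2)[OF f z(1) x] by (simp add: dist_real_def)
    qed
    ultimately show "\<exists>d>0. \<forall>z\<in>cbox 0 1. dist z x < d \<longrightarrow> dist (f z) (f x) < e" by blast
  qed
  then show ?thesis
    unfolding measurable_cong_sets[OF sets_G refl]
    by (intro continuous_imp_measurable_on_sets_lebesgue) auto
qed

text \<open>The real number \<open>a\<close> stands in for the level m because the optimal
  resolution is not an integer. \<alpha> \<le> 1 and d \<ge> 1 give d^\<alpha> \<le> d.\<close>

lemma holder_step_approximation:
  assumes f: "f \<in> holder_class \<alpha> L" and \<alpha>: "0 < \<alpha>" "\<alpha> \<le> 1" and L: "0 < L" and x: "x \<in> cbox 0 1"
    and a: "0 < a" "a \<le> real m"
  shows "(f x - f (cell_point m (cidx m x)))\<^sup>2 \<le> (L * real CARD('d))\<^sup>2 * (a powr (- \<alpha>))\<^sup>2"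
proof -
  have m: "m \<ge> 1" using a by (cases m) auto
  have "norm (x - cell_point m (cidx m x)) \<le> real CARD('d) / a"
    using cell_point(2)[OF x m] a by (meson divide_left_mono order.trans of_nat_0_le_iff mult_pos_pos less_le_trans)
  then have "norm (x - cell_point m (cidx m x)) powr \<alpha> \<le> (real CARD('d) / a) powr \<alpha>"
    using \<alpha> by (intro powr_mono2) auto
  also have "\<dots> = real CARD('d) powr \<alpha> * a powr (- \<alpha>)"
    using a by (simp add: powr_divide powr_minus_divide)
  also have "\<dots> \<le> real CARD('d) powr 1 * a powr (- \<alpha>)"
    using \<alpha> by (intro mult_right_mono powr_mono) auto
  finally have "norm (x - cell_point m (cidx m x)) powr \<alpha> \<le> real CARD('d) * a powr (- \<alpha>)" by simp
  then have "L * norm (x - cell_point m (cidx m x)) powr \<alpha> \<le> L * (real CARD('d) * a powr (- \<alpha>))"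
    using L by (intro mult_left_mono) auto
  then have "\<bar>f x - f (cell_point m (cidx m x))\<bar> \<le> L * real CARD('d) * a powr (- \<alpha>)"
    using holder_classD(2)[OF f x cell_point(1)[OF x m]] by simp
  then have "\<bar>f x - f (cell_point m (cidx m x))\<bar>\<^sup>2 \<le> (L * real CARD('d) * a powr (- \<alpha>))\<^sup>2"
    by (intro power_mono) auto
  then show ?thesis by (simp add: power_mult_distrib)
qed

section \<open>Consistency against fixed alternatives and uniformly over the Hoelder class\<close>

text \<open>The prior exponent is at least c l J^d, counted as five shares: one pays for C J^d, one
  for J \<le> J^d and three for R.\<close>

lemma large_level_bound:
  assumes J: "J \<ge> 1" and c: "0 < c" and lnJ: "c * l \<le> b1 * ln (real J)" and l: "5 * C \<le> c * l" "5 \<le> c * l" "0 < l"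
    and R: "5 * R \<le> 3 * (c * (real J ^ CARD('d) * l))"
  shows "C * real J ^ CARD('d) + R + real J \<le> b1 * real J ^ CARD('d) * ln (real J)"
proof -
  define p where "p = real J ^ CARD('d)"
  have p: "0 < p" "real J \<le> p" using J by (auto simp: p_def intro!: self_le_power)
  have "5 * C * p \<le> c * l * p" using l p by (intro mult_right_mono) auto
  moreover have "5 * p \<le> c * l * p" using l p by (intro mult_right_mono) auto
  moreover have "c * l * p \<le> b1 * ln (real J) * p" using lnJ p by (intro mult_right_mono) auto
  moreover have "5 * R \<le> 3 * (c * l * p)" using R by (simp add: p_def mult_ac)
  ultimately show ?thesis unfolding p_def[symmetric] using p(2) by (simp add: mult_ac)
qed

lemma fit_sum_le:
  "(\<Sum>i<n. (v i - fit n x v J (cidx J (x i)))\<^sup>2) \<le> (\<Sum>i<n. (v i - w (cidx J (x i)))\<^sup>2)"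
  using cavg_pythagoras[of v w "\<lambda>i. cidx J (x i)" n] by (simp add: sum_nonneg)

lemma eventually_ln_le_linear:
  assumes "0 < q"
  shows "\<forall>\<^sub>F n in sequentially. A * ln (real n) + B \<le> q * real n"
proof -
  have "(\<lambda>n. A * (ln (real n) / real n) + B * (1 / real n)) \<longlonglongrightarrow> A * 0 + B * 0"
    by (intro tendsto_intros lim_ln_over_n lim_1_over_n)
  then have "\<forall>\<^sub>F n in sequentially. A * (ln (real n) / real n) + B * (1 / real n) < q"
    using assms by (intro order_tendstoD(2)) auto
  then show ?thesis
    using eventually_gt_at_top[of 0]
  proof eventually_elim
    case (elim n)
    then have "A * (ln (real n) / real n) + B * (1 / real n) = (A * ln (real n) + B) / real n"
      by (simp add: add_divide_distrib)
    with elim have "(A * ln (real n) + B) / real n < q" by simp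
    with elim(2) show ?case by (simp add: divide_less_eq)
  qed
qed

text \<open>Two step approximations of f0 play different roles. \<open>Jb\<close> is accurate
  relative to the separation r and serves to compare the norms; it fixes the border D between small
  and big levels. \<open>Ja\<close> is the reference level, accurate relative to r and D, so it is
  chosen last.\<close>

lemma consistency_fixed_alternative:
  assumes \<gamma>: "0 < \<gamma>" and M0: "0 < M0"
    and f0: "f0 \<in> borel_measurable G" "\<forall>x\<in>cbox 0 1. \<bar>f0 x\<bar> \<le> K" "f0 \<notin> L1_closure G mono_fns" and K: "0 \<le> K"
  shows "(\<lambda>n. type_II \<gamma> M0 f0 n) \<longlonglongrightarrow> 0"
proof -
  note f0(1)[measurable]
  define C where "C = posterior_const"
  have C: "C > 0" using posterior_const_pos by (simp add: C_def)
  note post = posterior_small[folded C_def]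
  obtain r where r: "r > 0" and far: "\<And>J h. J \<ge> 1 \<Longrightarrow> h \<in> mono_step_fns J \<Longrightarrow> r \<le> (hell f0 h)\<^sup>2"
    using hellinger_separation[OF f0 K] by blast
  define d where "d = real CARD('d)"
  have d: "1 \<le> d" by (simp add: d_def Suc_leI)
  have occ: "1 \<le> occ_const" using g_bounds(1) by (simp add: occ_const_def)
  \<comment> \<open>Makes the bound 3 exp(-Z) equal to 3 \<gamma> / 4.\<close>
  define Z where "Z = ln (4 / \<gamma>)"
  have Z: "3 * exp (- Z) < \<gamma>" using \<gamma> by (simp add: Z_def exp_minus)
  \<comment> \<open>Log likelihood loss per observation of a separated coefficient vector: 3 / (8
    \<sigma>^2) times the \<sigma>^2 r / 32 of \<open>event_separated\<close>.\<close>
  define q where "q = 3 * r / 256"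
  define \<kappa>b where "\<kappa>b = \<sigma>\<^sup>2 * r / 144"
  have q: "0 < q" using r by (simp add: q_def)
  have \<kappa>b: "0 < \<kappa>b" using r sigma by (simp add: \<kappa>b_def)
  obtain Jb ub where Jb: "2 \<le> Jb" "\<forall>s. \<bar>ub s\<bar> \<le> K" "(\<integral>x. (f0 x - ub (cidx Jb x))\<^sup>2 \<partial>G) \<le> \<kappa>b"
    using step_approximation[OF f0(1,2) K \<kappa>b] by blast
  \<comment> \<open>The first entry keeps the squared radius of the test below r / 16 on small
    levels, the second makes the refinement J * Jb of a small level occupied.\<close>
  define D where "D = min (r / (16 * M0\<^sup>2)) (1 / (real Jb ^ CARD('d) * occ_const))"
  have Jbd: "0 < real Jb ^ CARD('d)" using Jb by simp
  have D: "0 < D" "16 * M0\<^sup>2 * D \<le> r" "real Jb ^ CARD('d) * occ_const * D \<le> 1"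
  proof -
    show "0 < D" using r M0 Jbd occ by (simp add: D_def)
    have "16 * M0\<^sup>2 * D \<le> 16 * M0\<^sup>2 * (r / (16 * M0\<^sup>2))" by (intro mult_left_mono) (auto simp: D_def)
    then show "16 * M0\<^sup>2 * D \<le> r" using M0 by simp
    have "real Jb ^ CARD('d) * occ_const * D \<le> real Jb ^ CARD('d) * occ_const * (1 / (real Jb ^ CARD('d) * occ_const))"
      using Jbd occ by (intro mult_left_mono) (auto simp: D_def)
    then show "real Jb ^ CARD('d) * occ_const * D \<le> 1" using Jbd occ by simp
  qed
  \<comment> \<open>On big levels J^d \<ge> sqrt n, hence log J \<ge> log n / (2 d) and b1 log J
    \<ge> c log n.\<close>
  define c where "c = b1 / (2 * d)"
  have c: "0 < c" using b_pos d by (simp add: c_def)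
  \<comment> \<open>The bias of the reference level then costs at most a quarter of q n on small
    levels and one share of the prior exponent on big levels.\<close>
  define \<kappa>a where "\<kappa>a = min (q / (16 * C)) (c * D / (20 * C))"
  have \<kappa>a: "0 < \<kappa>a" "16 * C * \<kappa>a \<le> q" "20 * C * \<kappa>a \<le> c * D"
  proof -
    show "0 < \<kappa>a" using q C c D by (simp add: \<kappa>a_def)
    have "16 * C * \<kappa>a \<le> 16 * C * (q / (16 * C))" using C by (intro mult_left_mono) (auto simp: \<kappa>a_def)
    then show "16 * C * \<kappa>a \<le> q" using C by simp
    have "20 * C * \<kappa>a \<le> 20 * C * (c * D / (20 * C))" using C by (intro mult_left_mono) (auto simp: \<kappa>a_def)
    then show "20 * C * \<kappa>a \<le> c * D" using C by simp
  qed
  obtain Ja ua where Ja: "2 \<le> Ja" "\<forall>s. \<bar>ua s\<bar> \<le> K" "(\<integral>x. (f0 x - ua (cidx Ja x))\<^sup>2 \<partial>G) \<le> \<kappa>a"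
    using step_approximation[OF f0(1,2) K \<kappa>a(1)] by blast
  \<comment> \<open>The added 1 keeps B positive when K = 0.\<close>
  define B where "B = 4 * K\<^sup>2 + 1"
  have B: "0 < B" by (simp add: B_def add_nonneg_pos)
  have wB: "0 \<le> (f0 x - u (cidx m x))\<^sup>2 \<and> (f0 x - u (cidx m x))\<^sup>2 \<le> B"
    if "\<forall>s. \<bar>u s\<bar> \<le> K" "x \<in> cbox 0 1" for u m x
  proof -
    have "\<bar>f0 x\<bar> \<le> K" "\<bar>u (cidx m x)\<bar> \<le> K" using that f0(2) by auto
    then have "\<bar>f0 x - u (cidx m x)\<bar> \<le> 2 * K" by linarith
    then have "\<bar>f0 x - u (cidx m x)\<bar>\<^sup>2 \<le> (2 * K)\<^sup>2" by (intro power_mono) auto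
    then show ?thesis by (simp add: B_def)
  qed
  define rate where "rate n = 4 / real n + (exp (- (2 * \<kappa>a / B * real n)) + exp (- (2 * \<kappa>b / B * real n)))" for n
  have main: "type_II \<gamma> M0 f0 n \<le> rate n"
    if ln: "1 \<le> ln (real n)" "K\<^sup>2 \<le> ln (real n)" "4 * C * D / q \<le> ln (real n)" "5 * C / c \<le> ln (real n)" "5 / c \<le> ln (real n)"
      and Jan: "real Ja \<le> ln (real n)"
      and sm: "(C + C * real Ja ^ CARD('d)) * ln (real n) + Z \<le> q / 4 * real n"
      and bg: "(C + C * real Ja ^ CARD('d)) * ln (real n) + Z \<le> c * D / 5 * real n"
      and rt: "ln (real n) \<le> D * sqrt (real n)" for n
  proof -
    have n1: "n \<ge> 1" using ln by (cases n) auto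
    then have np: "0 < real n" by simp
    have lp: "0 < ln (real n)" using ln by linarith
    have Ja_n: "Ja \<le> n" using Jan ln_le_minus_one[OF np] by linarith
    define P where "P = C * (real Ja ^ CARD('d) * ln (real n) + 4 * \<kappa>a * real n)"
    have Jam: "Ja \<ge> 1" "Jb \<ge> 1" using Ja Jb by auto
    have meas_a: "(\<lambda>x. (f0 x - ua (cidx Ja x))\<^sup>2) \<in> borel_measurable G"
      using comp_cidx_measurable[OF Jam(1), of ua] by measurable
    have meas_b: "(\<lambda>x. (f0 x - ub (cidx Jb x))\<^sup>2) \<in> borel_measurable G"
      using comp_cidx_measurable[OF Jam(2), of ub] by measurable
    obtain \<Psi>a where \<Psi>a: "\<Psi>a \<in> borel_measurable (sample n)" "(\<integral>\<^sup>+\<omega>. \<Psi>a \<omega> \<partial>sample n) \<le> ennreal (exp (- (2 * \<kappa>a / B * real n)))"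
      "\<And>\<omega>. \<omega> \<in> space (sample n) \<Longrightarrow> \<Psi>a \<omega> < 1 \<Longrightarrow> (\<Sum>i<n. (f0 (pts \<omega> i) - ua (cidx Ja (pts \<omega> i)))\<^sup>2) \<le> 4 * \<kappa>a * real n"
      using empirical_mean_penalty[OF meas_a wB[OF Ja(2)] B Ja(3) less_imp_le[OF \<kappa>a(1)], of n] by blast
    obtain \<Psi>b where \<Psi>b: "\<Psi>b \<in> borel_measurable (sample n)" "(\<integral>\<^sup>+\<omega>. \<Psi>b \<omega> \<partial>sample n) \<le> ennreal (exp (- (2 * \<kappa>b / B * real n)))"
      "\<And>\<omega>. \<omega> \<in> space (sample n) \<Longrightarrow> \<Psi>b \<omega> < 1 \<Longrightarrow> (\<Sum>i<n. (f0 (pts \<omega> i) - ub (cidx Jb (pts \<omega> i)))\<^sup>2) \<le> 4 * \<kappa>b * real n"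
      using empirical_mean_penalty[OF meas_b wB[OF Jb(2)] B Jb(3) less_imp_le[OF \<kappa>b], of n] by blast
    note [measurable] = \<Psi>a(1) \<Psi>b(1)
    have "ennreal (type_II \<gamma> M0 f0 n) \<le>
      ennreal (4 / real n) + (\<integral>\<^sup>+\<omega>. \<Psi>a \<omega> + \<Psi>b \<omega> \<partial>sample n)"
    proof (rule alternative_expectation_le[OF ln(1) f0(1)])
      fix \<omega> assume \<omega>: "\<omega> \<in> space (sample n)" and occu: "occupied n (pts \<omega>)" and noise: "noise_small n (pts \<omega>) (errs \<omega>)"
        and cross: "cross_small n (pts \<omega>) (errs \<omega>) (\<lambda>i. f0 (pts \<omega> i))" and lt: "\<Psi>a \<omega> + \<Psi>b \<omega> < 1"
      have "\<Psi>a \<omega> < 1" "\<Psi>b \<omega> < 1" by (rule le_less_trans[OF _ lt], simp)+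
      note emp = \<Psi>a(3)[OF \<omega> this(1)] \<Psi>b(3)[OF \<omega> this(2)]
      have x: "\<forall>i<n. pts \<omega> i \<in> cbox 0 1" using pts_in_cube[OF \<omega>] by blast
      have "post_prob n (\<lambda>i. (pts \<omega> i, f0 (pts \<omega> i) + errs \<omega> i)) (mono_event M0 n) \<le> 3 * exp (- Z)"
      proof (rule post[where P = P and big = "\<lambda>J. D * real n \<le> real J ^ CARD('d) * ln (real n)", OF ln(1) Ja(1) Ja_n x noise cross _ ln(2)])
        show "\<forall>i<n. \<bar>f0 (pts \<omega> i)\<bar> \<le> K" using f0(2) x by auto
        show "C * (real Ja ^ CARD('d) * ln (real n) + (\<Sum>i<n. (f0 (pts \<omega> i) - fit n (pts \<omega>) (\<lambda>i. f0 (pts \<omega> i)) Ja (cidx Ja (pts \<omega> i)))\<^sup>2)) \<le> P"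
          unfolding P_def using C emp(1) order.trans[OF fit_sum_le[of "\<lambda>i. f0 (pts \<omega> i)" n Ja "pts \<omega>" ua]]
          by (intro mult_left_mono add_left_mono) auto
        {
          fix J :: nat and \<theta> assume J: "J \<ge> 1" and ev: "(J, step_fn J \<theta>) \<in> mono_event M0 n"
            and "\<not> D * real n \<le> real J ^ CARD('d) * ln (real n)"
          then have Jn: "real J ^ CARD('d) * ln (real n) \<le> D * real n" by simp
          \<comment> \<open>The coefficients of level \<open>Jb\<close> are read at the refined
            level J * Jb, this time with J as the refinement factor.\<close>
          have fib: "ub (cidx Jb z) = ub (coarsen J (cidx (J * Jb) z))" for z
            using coarsen_cidx[OF J, of Jb z] by (simp add: mult.commute)
          have "real n * \<sigma>\<^sup>2 * r / 32 \<le> (\<Sum>i<n. (\<theta> (cidx J (pts \<omega> i)) - f0 (pts \<omega> i))\<^sup>2)"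
          proof (rule event_separated[where \<delta> = "4 * \<kappa>b" and u = "\<lambda>s. ub (coarsen J s)", OF ln(1) x occu f0(1,2) J Jam(2) _ _ _ far[OF J] M0 _ _ ev])
            have "real (J * Jb) ^ CARD('d) * occ_const * ln (real n) = (real Jb ^ CARD('d) * occ_const) * (real J ^ CARD('d) * ln (real n))"
              by (simp add: power_mult_distrib mult_ac)
            also have "\<dots> \<le> (real Jb ^ CARD('d) * occ_const) * (D * real n)"
              using Jn Jbd occ by (intro mult_left_mono) auto
            also have "\<dots> \<le> 1 * real n" using D(3) by (simp only: mult.assoc[symmetric]) (intro mult_right_mono, auto)
            finally show "real (J * Jb) ^ CARD('d) * occ_const * ln (real n) \<le> real n" by simp
            show "(\<integral>x. (f0 x - ub (coarsen J (cidx (J * Jb) x)))\<^sup>2 \<partial>G) \<le> 4 * \<kappa>b"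
              using Jb(3) \<kappa>b unfolding fib by simp
            show "(\<Sum>i<n. (f0 (pts \<omega> i) - ub (coarsen J (cidx (J * Jb) (pts \<omega> i))))\<^sup>2) \<le> 4 * \<kappa>b * real n"
              using emp(2) unfolding fib .
            have "16 * M0\<^sup>2 * (real J ^ CARD('d) * ln (real n) / real n) \<le> 16 * M0\<^sup>2 * D"
              using Jn np by (intro mult_left_mono) (auto simp: divide_le_eq)
            then show "16 * M0\<^sup>2 * (real J ^ CARD('d) * ln (real n) / real n) \<le> r" using D(2) by simp
            show "36 * (4 * \<kappa>b) \<le> \<sigma>\<^sup>2 * r" by (simp add: \<kappa>b_def)
          qed
          then have "3 / (8 * \<sigma>\<^sup>2) * (real n * \<sigma>\<^sup>2 * r / 32) \<le> 3 / (8 * \<sigma>\<^sup>2) * (\<Sum>i<n. (\<theta> (cidx J (pts \<omega> i)) - f0 (pts \<omega> i))\<^sup>2)"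
            by (intro mult_left_mono) auto
          moreover have "3 / (8 * \<sigma>\<^sup>2) * (real n * \<sigma>\<^sup>2 * r / 32) = q * real n"
            using sigma by (simp add: q_def)
          moreover have "C * (real J ^ CARD('d) + ln (real n)) + P + Z \<le> q * real n"
          proof -
            \<comment> \<open>On small levels J^d is at most D n / log n; the factor 1 / log n makes
              C J^d negligible against q n.\<close>
            have "4 * C * D \<le> q * ln (real n)" using ln(3) q by (simp add: divide_le_eq mult.commute)
            then have "4 * C * D * real n \<le> q * ln (real n) * real n" by (intro mult_right_mono) auto
            moreover have "4 * C * (real J ^ CARD('d) * ln (real n)) \<le> 4 * C * (D * real n)"
              using Jn C by (intro mult_left_mono) auto
            ultimately have "(4 * C * real J ^ CARD('d)) * ln (real n) \<le> (q * real n) * ln (real n)"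
              by (simp add: mult_ac)
            then have "4 * C * real J ^ CARD('d) \<le> q * real n" using lp by simp
            moreover have "16 * C * \<kappa>a * real n \<le> q * real n" using \<kappa>a(2) by (intro mult_right_mono) auto
            moreover have "0 \<le> q * real n" using q by simp
            ultimately show ?thesis using sm by (simp add: P_def algebra_simps)
          qed
          ultimately show "C * (real J ^ CARD('d) + ln (real n)) + P + Z \<le> 3 / (8 * \<sigma>\<^sup>2) * (\<Sum>i<n. (\<theta> (cidx J (pts \<omega> i)) - f0 (pts \<omega> i))\<^sup>2)"
            by linarith
        }
        {
          fix J :: nat assume J: "J \<ge> 1" and Jn: "D * real n \<le> real J ^ CARD('d) * ln (real n)"
          \<comment> \<open>Eventually log n \<le> D sqrt n, so a big level has J^d \<ge> D n / log
            n \<ge> sqrt n.\<close>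
          have "ln (real n) * sqrt (real n) \<le> D * sqrt (real n) * sqrt (real n)"
            using rt by (intro mult_right_mono) auto
          also have "\<dots> = D * real n" by (simp add: mult.assoc)
          finally have "sqrt (real n) * ln (real n) \<le> real J ^ CARD('d) * ln (real n)"
            using Jn by (simp add: mult.commute)
          then have sq: "sqrt (real n) \<le> real J ^ CARD('d)" using lp by simp
          have "ln (sqrt (real n)) \<le> ln (real J ^ CARD('d))" using sq np J by (subst ln_le_cancel_iff) auto
          then have lnJ: "ln (real n) / 2 \<le> d * ln (real J)" using np J by (simp add: ln_sqrt ln_realpow d_def)
          have J2: "2 \<le> J"
          proof (rule ccontr)
            assume "\<not> 2 \<le> J"
            then have "J = 1" using J by simp
            then show False using lnJ lp by simp
          qed
          have "C * real J ^ CARD('d) + (C * ln (real n) + P + Z) + real J \<le> b1 * real J ^ CARD('d) * ln (real J)"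
          proof (rule large_level_bound[OF J c, where l = "ln (real n)"])
            show "c * ln (real n) \<le> b1 * ln (real J)"
              using mult_left_mono[OF lnJ, of "b1 / d"] d b_pos by (simp add: c_def)
            show "5 * C \<le> c * ln (real n)" "5 \<le> c * ln (real n)" using ln(4,5) c by (simp_all add: divide_le_eq mult.commute)
            define X Y where "X = c * (D * real n)" and "Y = c * (real J ^ CARD('d) * ln (real n))"
            have "20 * C * \<kappa>a * real n \<le> c * D * real n" using \<kappa>a(3) by (intro mult_right_mono) auto
            then have X1: "20 * C * \<kappa>a * real n \<le> X" by (simp add: X_def mult.assoc)
            have X2: "0 \<le> X" "X \<le> Y" unfolding X_def Y_def using Jn c D(1) by (auto intro!: mult_left_mono)
            have X3: "5 * ((C + C * real Ja ^ CARD('d)) * ln (real n) + Z) \<le> X"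
              using bg by (simp add: X_def mult.assoc)
            have "5 * (C * ln (real n) + P + Z) = 5 * ((C + C * real Ja ^ CARD('d)) * ln (real n) + Z) + 20 * C * \<kappa>a * real n"
              by (simp add: P_def algebra_simps)
            then show "5 * (C * ln (real n) + P + Z) \<le> 3 * (c * (real J ^ CARD('d) * ln (real n)))"
              unfolding Y_def[symmetric] using X1 X2 X3 by linarith
          qed (rule lp)
          then show "2 \<le> J \<and> C * (real J ^ CARD('d) + ln (real n)) + P + Z + real J \<le> b1 * real J ^ CARD('d) * ln (real J)"
            using J2 by (simp add: distrib_left add_ac)
        }
      qed
      then show "post_prob n (\<lambda>i. (pts \<omega> i, f0 (pts \<omega> i) + errs \<omega> i)) (mono_event M0 n) < \<gamma>"
        using Z by linarith
    qed measurable
    also have "(\<integral>\<^sup>+\<omega>. \<Psi>a \<omega> + \<Psi>b \<omega> \<partial>sample n) = (\<integral>\<^sup>+\<omega>. \<Psi>a \<omega> \<partial>sample n) + (\<integral>\<^sup>+\<omega>. \<Psi>b \<omega> \<partial>sample n)"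
      by (intro nn_integral_add) auto
    also have "ennreal (4 / real n) + \<dots> \<le> ennreal (4 / real n) + (ennreal (exp (- (2 * \<kappa>a / B * real n))) + ennreal (exp (- (2 * \<kappa>b / B * real n))))"
      by (intro add_left_mono add_mono \<Psi>a(2) \<Psi>b(2))
    also have "\<dots> = ennreal (rate n)" by (simp add: rate_def ennreal_plus[symmetric] del: ennreal_plus)
    finally show ?thesis by (subst (asm) ennreal_le_iff) (auto simp: rate_def)
  qed
  show ?thesis
  proof (rule tendsto_sandwich[where f = "\<lambda>_. 0" and h = rate])
    have rt: "\<forall>\<^sub>F n in sequentially. ln (real n) \<le> D * sqrt (real n)"
      using D(1) by real_asymp
    have l1: "\<forall>\<^sub>F n in sequentially. (C + C * real Ja ^ CARD('d)) * ln (real n) + Z \<le> q / 4 * real n"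
      using q by (intro eventually_ln_le_linear) simp
    have l2: "\<forall>\<^sub>F n in sequentially. (C + C * real Ja ^ CARD('d)) * ln (real n) + Z \<le> c * D / 5 * real n"
      using c D(1) by (intro eventually_ln_le_linear) simp
    show "\<forall>\<^sub>F n in sequentially. type_II \<gamma> M0 f0 n \<le> rate n"
      using eventually_ln_ge[of 1] eventually_ln_ge[of "K\<^sup>2"] eventually_ln_ge[of "4 * C * D / q"] eventually_ln_ge[of "5 * C / c"]
        eventually_ln_ge[of "5 / c"] eventually_ln_ge[of "real Ja"] l1 l2 rt
      by eventually_elim (rule main)
    have e: "(\<lambda>n. exp (- (\<beta> * real n))) \<longlonglongrightarrow> 0" if "0 < \<beta>" for \<beta> :: real
      using that by real_asymp
    have "rate \<longlonglongrightarrow> 0 + (0 + 0)"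
      unfolding rate_def[abs_def] using \<kappa>a(1) \<kappa>b B by (intro tendsto_add lim_const_over_n e) auto
    then show "rate \<longlonglongrightarrow> 0" by simp
  qed (auto intro!: true_expectation_nonneg always_eventually simp: mono_test_eq)
qed


text \<open>All costs and gains are multiples of T = n \<epsilon>^2, and the likelihood gain grows
  like Cr^2 T. The Hoelder bias bound holds at every point, so the error bound is the same for all
  f0 in the class and passes to the supremum.\<close>

lemma consistency_holder_alternatives:
  assumes \<gamma>: "0 < \<gamma>" and M0: "0 < M0" and \<alpha>: "0 < \<alpha>" "\<alpha> \<le> 1" and L: "0 < L"
  shows "\<exists>C0>0. \<forall>Cr\<ge>C0. (\<lambda>n. SUP f0 \<in> {f0 \<in> holder_class \<alpha> L.
      hell_setdist f0 mono_fns > Cr * (real n / ln (real n)) powr (- \<alpha> / (2 * \<alpha> + real CARD('d)))}.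
    ennreal (type_II \<gamma> M0 f0 n)) \<longlonglongrightarrow> 0"
proof -
  define C where "C = posterior_const"
  have C: "C > 0" using posterior_const_pos by (simp add: C_def)
  note post = posterior_small[folded C_def]
  define d where "d = real CARD('d)"
  define E where "E = (2 :: real) ^ CARD('d)"
  have d: "1 \<le> d" by (simp add: d_def Suc_leI)
  have E: "2 \<le> E" unfolding E_def using self_le_power[of "2 :: real" "CARD('d)"] by simp
  have occ: "1 \<le> occ_const" using g_bounds(1) by (simp add: occ_const_def)
  define Z where "Z = ln (4 / \<gamma>)"
  have Z: "3 * exp (- Z) < \<gamma>" using \<gamma> by (simp add: Z_def exp_minus)
  \<comment> \<open>Big levels satisfy J \<ge> a, so log J \<ge> log(n / log n) / (2 \<alpha> + d)
    \<ge> log n / (2 (2 \<alpha> + d)) for large n.\<close>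
  define c where "c = b1 / (2 * (2 * \<alpha> + d))"
  have c: "0 < c" using b_pos d \<alpha> by (simp add: c_def)
  define C6 where "C6 = C * (E + (L * d)\<^sup>2)"
  have C6: "0 < C6" using C E by (simp add: C6_def add_pos_nonneg)
  \<comment> \<open>On levels with J^d \<ge> D Jr^d, the deficit P of the reference level and the
    term C log n then cost at most one share of the prior exponent each.\<close>
  define D where "D = 1 + 5 * C6 / c + 5 * C / c"
  have D: "1 \<le> D" "5 * C6 \<le> c * D" "5 * C \<le> c * D"
  proof -
    show "1 \<le> D" using C C6 c by (simp add: D_def)
    have "c * D = c + 5 * C6 + 5 * C" using c by (simp add: D_def distrib_left)
    then show "5 * C6 \<le> c * D" "5 * C \<le> c * D" using c C C6 by auto
  qed
  define S1 where "S1 = C * (D * E + E) + C6 + E"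
  \<comment> \<open>The summands make Cr^2 large enough for, in turn, Cr^2 \<ge> Cr, a likelihood
    gain exceeding all costs S1 T, a test radius below the separation, and a bias below the
    separation.\<close>
  define C0 where "C0 = 1 + 256 / 3 * S1 + 16 * M0\<^sup>2 * (D * E) + 36 * (L * d)\<^sup>2 / \<sigma>\<^sup>2"
  have S1: "0 \<le> S1" using C D E C6 by (simp add: S1_def)
  have C0t: "0 \<le> 256 / 3 * S1" "0 \<le> 16 * M0\<^sup>2 * (D * E)" "0 \<le> 36 * (L * d)\<^sup>2 / \<sigma>\<^sup>2" using S1 D E by auto
  then have C0: "0 < C0" "1 \<le> C0" unfolding C0_def by linarith+
  \<comment> \<open>The refined level used below is at most (D + 1) Jr; W \<epsilon>^2 \<le> 1 makes
    it occupied, and E \<le> W keeps the reference level Jr below n.\<close>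
  define W where "W = (D + 1) ^ CARD('d) * occ_const * E"
  have W: "2 \<le> W" "E \<le> W"
  proof -
    have "1 * 1 \<le> (D + 1) ^ CARD('d) * occ_const" using D occ by (intro mult_mono one_le_power) auto
    then have "1 * E \<le> W" unfolding W_def using E by (intro mult_right_mono) auto
    then show "2 \<le> W" "E \<le> W" using E by auto
  qed
  have main: "ennreal (type_II \<gamma> M0 f0 n) \<le> ennreal (4 / real n)"
    if Cr: "C0 \<le> Cr" and ln: "1 \<le> ln (real n)" "L\<^sup>2 \<le> ln (real n)" "5 * C / c \<le> ln (real n)" "5 / c \<le> ln (real n)"
      "5 * Z / c \<le> ln (real n)" "Z \<le> ln (real n)"
      and Wn: "W \<le> (real n / ln (real n)) powr (2 * \<alpha> / (2 * \<alpha> + d))"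
      and f0: "f0 \<in> holder_class \<alpha> L"
      and sep: "hell_setdist f0 mono_fns > Cr * (real n / ln (real n)) powr (- \<alpha> / (2 * \<alpha> + d))"
    for Cr n f0
  proof -
    define l where "l = ln (real n)"
    \<comment> \<open>The resolution that balances squared bias a^(-2 \<alpha>) against complexity
      a^d log n / n; at this value n \<epsilon>^2 = a^d log n.\<close>
    define a where "a = (real n / l) powr (1 / (2 * \<alpha> + d))"
    define \<epsilon> where "\<epsilon> = a powr (- \<alpha>)"
    define Jr where "Jr = nat \<lceil>a\<rceil>"
    define T where "T = real n * \<epsilon>\<^sup>2"
    define p where "p = real Jr ^ CARD('d) * l"
    have l: "1 \<le> l" "0 < l" using ln(1) by (auto simp: l_def)
    have n1: "n \<ge> 1" using ln(1) by (cases n) auto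
    then have np: "0 < real n" by simp
    have nl: "0 < real n / l" using np l by simp
    have a0: "0 < a" using np l by (simp add: a_def)
    have ad: "0 < 2 * \<alpha> + d" using \<alpha> d by simp
    have \<epsilon>_rate: "(real n / ln (real n)) powr (- \<alpha> / (2 * \<alpha> + d)) = \<epsilon>"
      by (simp add: \<epsilon>_def a_def powr_powr l_def)
    have Wa: "W \<le> a powr (2 * \<alpha>)" using Wn by (simp add: a_def powr_powr l_def)
    have a1: "1 < a"
    proof (rule ccontr)
      assume "\<not> 1 < a"
      then have "a powr (2 * \<alpha>) \<le> 1 powr (2 * \<alpha>)" using a0 \<alpha> by (intro powr_mono2) auto
      then show False using Wa W by simp
    qed
    have \<epsilon>: "0 < \<epsilon>" using a0 by (simp add: \<epsilon>_def)
    have eps2: "\<epsilon>\<^sup>2 = a powr (- (2 * \<alpha>))"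
      using a0 by (simp add: \<epsilon>_def power2_eq_square powr_add[symmetric])
    have epsW: "W * \<epsilon>\<^sup>2 \<le> 1"
    proof -
      have "W * \<epsilon>\<^sup>2 \<le> a powr (2 * \<alpha>) * \<epsilon>\<^sup>2" using Wa by (intro mult_right_mono) auto
      also have "\<dots> = 1" using a0 by (simp add: eps2 powr_add[symmetric])
      finally show ?thesis .
    qed
    have T_eq: "T = a ^ CARD('d) * l"
    proof -
      have "a powr (2 * \<alpha> + d) = real n / l" using ad np l by (simp add: a_def powr_powr)
      then have "real n = a powr (2 * \<alpha> + d) * l" using l by simp
      then have "T = a powr (2 * \<alpha> + d) * a powr (- (2 * \<alpha>)) * l" by (simp add: T_def eps2)
      also have "a powr (2 * \<alpha> + d) * a powr (- (2 * \<alpha>)) = a powr d" by (simp add: powr_add[symmetric])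
      also have "a powr d = a ^ CARD('d)" using a0 by (simp add: d_def powr_realpow)
      finally show ?thesis .
    qed
    have Jr: "a \<le> real Jr" "real Jr \<le> 2 * a" "2 \<le> Jr"
    proof -
      show "a \<le> real Jr" unfolding Jr_def by linarith
      show "real Jr \<le> 2 * a" unfolding Jr_def using a1 by linarith
      show "2 \<le> Jr" using a1 unfolding Jr_def by linarith
    qed
    have Jr1: "Jr \<ge> 1" using Jr by simp
    have T0: "0 < T" using np \<epsilon> by (simp add: T_def)
    have pT: "T \<le> p" "p \<le> E * T"
    proof -
      show "T \<le> p" unfolding T_eq p_def using Jr a0 l by (intro mult_right_mono power_mono) auto
      have "real Jr ^ CARD('d) \<le> (2 * a) ^ CARD('d)" using Jr by (intro power_mono) auto
      then have "p \<le> (2 * a) ^ CARD('d) * l" unfolding p_def using l by (intro mult_right_mono) auto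
      then show "p \<le> E * T" by (simp add: T_eq E_def power_mult_distrib)
    qed
    have Jrd: "1 \<le> real Jr ^ CARD('d)" using Jr1 by (intro one_le_power) auto
    have lp: "l \<le> p" using mult_right_mono[OF Jrd, of l] l by (simp add: p_def)
    have ETn: "E * T \<le> real n"
    proof -
      have "E * \<epsilon>\<^sup>2 \<le> W * \<epsilon>\<^sup>2" using W by (intro mult_right_mono) auto
      then have "real n * (E * \<epsilon>\<^sup>2) \<le> real n * 1" using epsW by (intro mult_left_mono) auto
      then show ?thesis by (simp add: T_def mult_ac)
    qed
    have Jrn: "Jr \<le> n"
    proof -
      have "real Jr \<le> real Jr ^ CARD('d)" using Jr1 by (intro self_le_power) auto
      also have "\<dots> \<le> p" unfolding p_def using l Jrd by (simp add: mult_le_cancel_left1)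
      finally have "real Jr \<le> real n" using pT ETn by linarith
      then show ?thesis by simp
    qed
    have fm: "f0 \<in> borel_measurable G" by (rule holder_measurable[OF f0 \<alpha>(1) L])
    note fm[measurable]
    have fL: "\<forall>x\<in>cbox 0 1. \<bar>f0 x\<bar> \<le> L" by (rule holder_classD(1)[OF f0])
    define \<delta> where "\<delta> = (L * d)\<^sup>2 * \<epsilon>\<^sup>2"
    define u where "u m s = f0 (cell_point m s)" for m s
    have approx: "(f0 z - u m (cidx m z))\<^sup>2 \<le> \<delta>" if "z \<in> cbox 0 1" "a \<le> real m" for z m
      using holder_step_approximation[OF f0 \<alpha> L that(1) a0 that(2)] by (simp add: u_def \<delta>_def d_def \<epsilon>_def)
    define P where "P = C6 * T"
    define big where "big J \<longleftrightarrow> D * real Jr ^ CARD('d) \<le> real J ^ CARD('d)" for J :: nat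
    have far: "Cr\<^sup>2 * \<epsilon>\<^sup>2 \<le> (hell f0 h)\<^sup>2" if "h \<in> mono_step_fns J" for J h
    proof -
      have "Cr * \<epsilon> < hell f0 h"
        using sep[unfolded \<epsilon>_rate] hellinger_setdist_le[of h mono_fns f0] that by (simp add: mono_step_fns_def)
      then have "(Cr * \<epsilon>)\<^sup>2 \<le> (hell f0 h)\<^sup>2" using Cr C0 \<epsilon> by (intro power_mono) auto
      then show ?thesis by (simp add: power_mult_distrib)
    qed
    have Cr2: "C0 \<le> Cr\<^sup>2"
    proof -
      have "C0 * 1 \<le> Cr * Cr" using Cr C0 by (intro mult_mono) auto
      then show ?thesis by (simp add: power2_eq_square)
    qed
    have CrB: "256 / 3 * S1 \<le> Cr\<^sup>2" "16 * M0\<^sup>2 * (D * E) \<le> Cr\<^sup>2" "36 * (L * d)\<^sup>2 / \<sigma>\<^sup>2 \<le> Cr\<^sup>2"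
      using Cr2 C0t unfolding C0_def by linarith+
    \<comment> \<open>The additional penalty is 0, since the bias is bounded surely and not only
      with high probability.\<close>
    have "ennreal (type_II \<gamma> M0 f0 n) \<le>
      ennreal (4 / real n) + (\<integral>\<^sup>+\<omega>. 0 \<partial>sample n)"
    proof (rule alternative_expectation_le[OF ln(1) fm])
      fix \<omega> assume \<omega>: "\<omega> \<in> space (sample n)" and occu: "occupied n (pts \<omega>)" and noise: "noise_small n (pts \<omega>) (errs \<omega>)"
        and cross: "cross_small n (pts \<omega>) (errs \<omega>) (\<lambda>i. f0 (pts \<omega> i))"
      have x: "\<forall>i<n. pts \<omega> i \<in> cbox 0 1" using pts_in_cube[OF \<omega>] by blast
      have emp: "(\<Sum>i<n. (f0 (pts \<omega> i) - u m (cidx m (pts \<omega> i)))\<^sup>2) \<le> \<delta> * real n" if "a \<le> real m" for m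
      proof -
        have "(\<Sum>i<n. (f0 (pts \<omega> i) - u m (cidx m (pts \<omega> i)))\<^sup>2) \<le> (\<Sum>i<n. \<delta>)"
          using x approx[OF _ that] by (intro sum_mono) auto
        then show ?thesis by (simp add: mult.commute)
      qed
      have "post_prob n (\<lambda>i. (pts \<omega> i, f0 (pts \<omega> i) + errs \<omega> i)) (mono_event M0 n) \<le> 3 * exp (- Z)"
      proof (rule post[where P = P and big = big, OF ln(1) Jr(3) Jrn x noise cross _ ln(2)])
        show "\<forall>i<n. \<bar>f0 (pts \<omega> i)\<bar> \<le> L" using fL x by auto
        have "(\<Sum>i<n. (f0 (pts \<omega> i) - fit n (pts \<omega>) (\<lambda>i. f0 (pts \<omega> i)) Jr (cidx Jr (pts \<omega> i)))\<^sup>2) \<le> \<delta> * real n"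
          by (rule order.trans[OF fit_sum_le[of "\<lambda>i. f0 (pts \<omega> i)" n Jr "pts \<omega>" "u Jr"] emp[OF Jr(1)]])
        also have "\<delta> * real n = (L * d)\<^sup>2 * T" by (simp add: \<delta>_def T_def)
        finally have "C * (p + (\<Sum>i<n. (f0 (pts \<omega> i) - fit n (pts \<omega>) (\<lambda>i. f0 (pts \<omega> i)) Jr (cidx Jr (pts \<omega> i)))\<^sup>2)) \<le> C * (E * T + (L * d)\<^sup>2 * T)"
          using C pT(2) by (intro mult_left_mono add_mono) auto
        also have "\<dots> = P" by (simp add: P_def C6_def algebra_simps)
        finally show "C * (real Jr ^ CARD('d) * ln (real n) + (\<Sum>i<n. (f0 (pts \<omega> i) - fit n (pts \<omega>) (\<lambda>i. f0 (pts \<omega> i)) Jr (cidx Jr (pts \<omega> i)))\<^sup>2)) \<le> P"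
          by (simp add: p_def l_def)
        {
          fix J :: nat and \<theta> assume J: "J \<ge> 1" and ev: "(J, step_fn J \<theta>) \<in> mono_event M0 n" and "\<not> big J"
          then have JJr: "real J ^ CARD('d) < D * real Jr ^ CARD('d)" by (simp add: big_def)
          have Jp: "real J ^ CARD('d) * l \<le> D * E * T"
          proof -
            have "real J ^ CARD('d) * l \<le> D * real Jr ^ CARD('d) * l" using JJr l by (intro mult_right_mono) auto
            also have "\<dots> = D * p" by (simp add: p_def)
            also have "\<dots> \<le> D * (E * T)" using pT D by (intro mult_left_mono) auto
            finally show ?thesis by (simp add: mult.assoc)
          qed
          \<comment> \<open>D \<ge> 1 gives D \<le> D^d, so comparing d-th powers yields J \<le> D
            Jr.\<close>
          have Jlt: "real J \<le> D * real Jr"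
          proof (rule ccontr)
            assume "\<not> real J \<le> D * real Jr"
            then have "(D * real Jr) ^ CARD('d) \<le> real J ^ CARD('d)" using D by (intro power_mono) auto
            moreover have "D * real Jr ^ CARD('d) \<le> (D * real Jr) ^ CARD('d)"
              using D Jrd self_le_power[OF D(1), of "CARD('d)"] by (simp add: power_mult_distrib mult_right_mono)
            ultimately show False using JJr by linarith
          qed
          \<comment> \<open>J k lies between Jr and Jr + J: fine enough for the bias bound, coarse
            enough for occupancy.\<close>
          define k where "k = Jr div J + 1"
          have Jk: "Jr \<le> J * k" "J * k \<le> Jr + J"
          proof -
            have "J * (Jr div J) + Jr mod J = Jr" "Jr mod J < J" "J * k = J * (Jr div J) + J" using J by (simp_all add: k_def)
            then show "Jr \<le> J * k" "J * k \<le> Jr + J" by linarith+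
          qed
          have am: "a \<le> real (J * k)" using Jr(1) Jk(1) by (meson of_nat_le_iff order.trans)
          have "real n * \<sigma>\<^sup>2 * (Cr\<^sup>2 * \<epsilon>\<^sup>2) / 32 \<le> (\<Sum>i<n. (\<theta> (cidx J (pts \<omega> i)) - f0 (pts \<omega> i))\<^sup>2)"
          proof (rule event_separated[where \<delta> = \<delta> and u = "u (J * k)" and k = k, OF ln(1) x occu fm fL J _ _ _ emp[OF am] far M0 _ _ ev])
            show "1 \<le> k" by (simp add: k_def)
            have "real (J * k) \<le> real Jr + real J" using Jk(2) by (metis of_nat_add of_nat_le_iff)
            then have "real (J * k) \<le> (D + 1) * real Jr" using Jlt by (simp add: distrib_right)
            then have "real (J * k) ^ CARD('d) \<le> ((D + 1) * real Jr) ^ CARD('d)" by (intro power_mono) auto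
            then have "real (J * k) ^ CARD('d) * (occ_const * l) \<le> ((D + 1) * real Jr) ^ CARD('d) * (occ_const * l)"
              using occ l by (intro mult_right_mono) auto
            also have "\<dots> = ((D + 1) ^ CARD('d) * occ_const) * p" by (simp add: power_mult_distrib p_def mult_ac)
            also have "\<dots> \<le> ((D + 1) ^ CARD('d) * occ_const) * (E * T)"
              using pT D occ by (intro mult_left_mono) auto
            also have "\<dots> = real n * (W * \<epsilon>\<^sup>2)" by (simp add: W_def T_def mult_ac)
            also have "\<dots> \<le> real n * 1" by (intro mult_left_mono epsW) auto
            finally show "real (J * k) ^ CARD('d) * occ_const * ln (real n) \<le> real n" by (simp add: l_def mult.assoc)
            have m1: "J * k \<ge> 1" using Jk(1) Jr1 by linarith
            have "(\<integral>x. (f0 x - u (J * k) (cidx (J * k) x))\<^sup>2 \<partial>G) \<le> \<delta>"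
              using approx[OF _ am] by (intro G.integral_le_bound) (auto simp: space_G \<delta>_def)
            then show "(\<integral>x. (f0 x - u (J * k) (cidx (J * k) x))\<^sup>2 \<partial>G) \<le> \<delta>" .
            have "16 * M0\<^sup>2 * (real J ^ CARD('d) * l) \<le> 16 * M0\<^sup>2 * (D * E * T)"
              using Jp by (intro mult_left_mono) auto
            also have "\<dots> = 16 * M0\<^sup>2 * (D * E) * \<epsilon>\<^sup>2 * real n" by (simp add: T_def)
            also have "\<dots> \<le> Cr\<^sup>2 * \<epsilon>\<^sup>2 * real n"
              by (intro mult_right_mono CrB) auto
            finally show "16 * M0\<^sup>2 * (real J ^ CARD('d) * ln (real n) / real n) \<le> Cr\<^sup>2 * \<epsilon>\<^sup>2"
              using np by (simp add: l_def divide_le_eq)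
            have "36 * (L * d)\<^sup>2 \<le> \<sigma>\<^sup>2 * Cr\<^sup>2" using CrB(3) sigma by (simp add: divide_le_eq mult.commute)
            then have "36 * (L * d)\<^sup>2 * \<epsilon>\<^sup>2 \<le> \<sigma>\<^sup>2 * Cr\<^sup>2 * \<epsilon>\<^sup>2" by (intro mult_right_mono) auto
            then show "36 * \<delta> \<le> \<sigma>\<^sup>2 * (Cr\<^sup>2 * \<epsilon>\<^sup>2)" by (simp add: \<delta>_def mult.assoc)
          qed
          then have "3 / (8 * \<sigma>\<^sup>2) * (real n * \<sigma>\<^sup>2 * (Cr\<^sup>2 * \<epsilon>\<^sup>2) / 32) \<le> 3 / (8 * \<sigma>\<^sup>2) * (\<Sum>i<n. (\<theta> (cidx J (pts \<omega> i)) - f0 (pts \<omega> i))\<^sup>2)"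
            by (intro mult_left_mono) auto
          moreover have "3 / (8 * \<sigma>\<^sup>2) * (real n * \<sigma>\<^sup>2 * (Cr\<^sup>2 * \<epsilon>\<^sup>2) / 32) = 3 / 256 * Cr\<^sup>2 * T"
            using sigma by (simp add: T_def)
          moreover have "C * (real J ^ CARD('d) + l) + P + Z \<le> 3 / 256 * Cr\<^sup>2 * T"
          proof -
            have "real J ^ CARD('d) * 1 \<le> real J ^ CARD('d) * l" using l by (intro mult_left_mono) auto
            then have "real J ^ CARD('d) + l \<le> D * E * T + E * T" using Jp lp pT by linarith
            then have "C * (real J ^ CARD('d) + l) \<le> C * (D * E * T + E * T)" using C by (intro mult_left_mono) auto
            moreover have "Z \<le> E * T" using ln(6) lp pT by (simp add: l_def)
            moreover have "S1 * T = C * (D * E * T + E * T) + P + E * T" by (simp add: S1_def P_def algebra_simps)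
            moreover have "S1 \<le> 3 / 256 * Cr\<^sup>2" using CrB(1) by simp
            then have "S1 * T \<le> 3 / 256 * Cr\<^sup>2 * T" using T0 by (intro mult_right_mono) auto
            ultimately show ?thesis by linarith
          qed
          ultimately show "C * (real J ^ CARD('d) + ln (real n)) + P + Z \<le> 3 / (8 * \<sigma>\<^sup>2) * (\<Sum>i<n. (\<theta> (cidx J (pts \<omega> i)) - f0 (pts \<omega> i))\<^sup>2)"
            unfolding l_def by linarith
        }
        {
          fix J :: nat assume J: "J \<ge> 1" and "big J"
          then have JD: "D * real Jr ^ CARD('d) \<le> real J ^ CARD('d)" by (simp add: big_def)
          have "1 * real Jr ^ CARD('d) \<le> D * real Jr ^ CARD('d)" using D by (intro mult_right_mono) auto
          then have "real Jr ^ CARD('d) \<le> real J ^ CARD('d)" using JD by linarith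
          then have JrJ: "real Jr \<le> real J"
            using power_mono_iff[of "real Jr" "real J" "CARD('d)"] by (simp only: of_nat_0_le_iff) simp
          then have J2: "2 \<le> J" using Jr(3) by simp
          \<comment> \<open>Hence log(n / log n) \<ge> log n / 2, so log J is of order log n on big
            levels.\<close>
          have "ln l \<le> l / 2"
          proof -
            have "ln (l / 2) \<le> l / 2 - 1" using l by (intro ln_le_minus_one) auto
            then show ?thesis using l ln_2_less_1 by (simp add: ln_div)
          qed
          then have "l / 2 \<le> ln (real n / l)" using np l by (simp add: ln_div l_def[symmetric])
          then have "l / 2 / (2 * \<alpha> + d) \<le> ln (real n / l) / (2 * \<alpha> + d)" using ad by (intro divide_right_mono) auto
          also have "\<dots> = ln a" using np l by (simp add: a_def ln_powr)
          also have "\<dots> \<le> ln (real J)" using a0 Jr(1) JrJ by (subst ln_le_cancel_iff) auto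
          finally have lnJ: "l / 2 / (2 * \<alpha> + d) \<le> ln (real J)" .
          define X where "X = c * (real J ^ CARD('d) * l)"
          have cDp: "c * D * p \<le> X"
          proof -
            have "D * real Jr ^ CARD('d) * l \<le> real J ^ CARD('d) * l" using JD l by (intro mult_right_mono) auto
            then have "c * (D * real Jr ^ CARD('d) * l) \<le> X" unfolding X_def using c by (intro mult_left_mono) auto
            then show ?thesis by (simp add: p_def mult.assoc)
          qed
          have "C * real J ^ CARD('d) + (C * l + P + Z) + real J \<le> b1 * real J ^ CARD('d) * ln (real J)"
          proof (rule large_level_bound[OF J c, where l = l])
            have "b1 * (l / 2 / (2 * \<alpha> + d)) \<le> b1 * ln (real J)" using lnJ b_pos by (intro mult_left_mono) auto
            then show "c * l \<le> b1 * ln (real J)" by (simp add: c_def)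
            show "5 * C \<le> c * l" "5 \<le> c * l" using ln(3,4) c by (simp_all add: divide_le_eq mult.commute l_def)
            have "5 * C * p \<le> c * D * p" using D lp l by (intro mult_right_mono) auto
            moreover have "5 * C * l \<le> 5 * C * p" using lp C by (intro mult_left_mono) auto
            ultimately have 1: "5 * C * l \<le> X" using cDp by linarith
            have "5 * C6 * T \<le> 5 * C6 * p" using pT C6 by (intro mult_left_mono) auto
            moreover have "5 * C6 * p \<le> c * D * p" using D lp l by (intro mult_right_mono) auto
            ultimately have 2: "5 * P \<le> X" using cDp by (simp add: P_def)
            have "5 * Z \<le> c * l" using ln(5) c by (simp add: divide_le_eq mult.commute l_def)
            also have "\<dots> \<le> X"
            proof -
              have "1 * l \<le> real J ^ CARD('d) * l" using J l by (intro mult_right_mono one_le_power) auto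
              then show ?thesis unfolding X_def using c by (intro mult_left_mono) auto
            qed
            finally have 3: "5 * Z \<le> X" .
            show "5 * (C * l + P + Z) \<le> 3 * (c * (real J ^ CARD('d) * l))"
              unfolding X_def[symmetric] using 1 2 3 by (simp add: distrib_left)
          qed (rule l)
          then show "2 \<le> J \<and> C * (real J ^ CARD('d) + ln (real n)) + P + Z + real J \<le> b1 * real J ^ CARD('d) * ln (real J)"
            using J2 by (simp add: distrib_left add_ac l_def)
        }
      qed
      then show "post_prob n (\<lambda>i. (pts \<omega> i, f0 (pts \<omega> i) + errs \<omega> i)) (mono_event M0 n) < \<gamma>"
        using Z by linarith
    qed simp
    then show ?thesis by simp
  qed
  have "(\<lambda>n. SUP f0 \<in> {f0 \<in> holder_class \<alpha> L.
      hell_setdist f0 mono_fns > Cr * (real n / ln (real n)) powr (- \<alpha> / (2 * \<alpha> + real CARD('d)))}.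
    ennreal (type_II \<gamma> M0 f0 n)) \<longlonglongrightarrow> 0"
    if Cr: "C0 \<le> Cr" for Cr
  proof (rule tendsto_sandwich[where f = "\<lambda>_. 0" and h = "\<lambda>n. ennreal (4 / real n)"])
    have "filterlim (\<lambda>n. real n / ln (real n)) at_top sequentially" by real_asymp
    moreover have "0 < 2 * \<alpha> / (2 * \<alpha> + d)" using \<alpha> d by simp
    then have "filterlim (\<lambda>x. x powr (2 * \<alpha> / (2 * \<alpha> + d))) at_top at_top" by real_asymp
    ultimately have "filterlim (\<lambda>n. (real n / ln (real n)) powr (2 * \<alpha> / (2 * \<alpha> + d))) at_top sequentially"
      by (rule filterlim_compose[rotated])
    then have Wev: "\<forall>\<^sub>F n in sequentially. W \<le> (real n / ln (real n)) powr (2 * \<alpha> / (2 * \<alpha> + d))"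
      by (simp add: filterlim_at_top)
    show "\<forall>\<^sub>F n in sequentially. (SUP f0 \<in> {f0 \<in> holder_class \<alpha> L.
      hell_setdist f0 mono_fns > Cr * (real n / ln (real n)) powr (- \<alpha> / (2 * \<alpha> + real CARD('d)))}.
      ennreal (type_II \<gamma> M0 f0 n)) \<le> ennreal (4 / real n)"
      using eventually_ln_ge[of 1] eventually_ln_ge[of "L\<^sup>2"] eventually_ln_ge[of "5 * C / c"] eventually_ln_ge[of "5 / c"]
        eventually_ln_ge[of "5 * Z / c"] eventually_ln_ge[of Z] Wev
    proof eventually_elim
      case (elim n)
      then show ?case by (intro SUP_least main[OF Cr]) (auto simp: d_def)
    qed
    have "(\<lambda>n. ennreal (4 / real n)) \<longlonglongrightarrow> ennreal 0" by (intro tendsto_ennrealI lim_const_over_n)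
    then show "(\<lambda>n. ennreal (4 / real n)) \<longlonglongrightarrow> 0" by simp
  qed auto
  then show ?thesis using C0 by blast
qed

end

theorem theorem3p4:
  fixes G :: "(real ^ 'd) measure" and g :: "real ^ 'd \<Rightarrow> real"
    and Q :: "real measure" and \<pi> :: "nat pmf"
    and \<zeta> lam :: "nat \<Rightarrow> nat \<Rightarrow> nat ^ 'd \<Rightarrow> real"
    and \<sigma>0 \<gamma> g_lo g_hi b1 b2 z_bd lam_lo lam_hi :: real
  assumes sigma: "\<sigma>0 > 0"
    and gamma: "0 < \<gamma>" "\<gamma> < 1"
    and G_prob: "prob_space G"
    and G_density: "g \<in> borel_measurable (lebesgue_on (cbox 0 1))"
      "G = density (lebesgue_on (cbox 0 1)) (\<lambda>x. ennreal (g x))"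
    and g_bounds: "0 < g_lo"
      "AE x in lebesgue_on (cbox 0 1). g_lo \<le> g x \<and> g x \<le> g_hi"
    and Q_prob: "prob_space Q" "sets Q = sets borel"
    and Q_subgaussian: "subgaussian Q"
    and Q_mean: "(\<integral>e. e \<partial>Q) = 0"
    and Q_variance: "(\<integral>e. e\<^sup>2 \<partial>Q) = \<sigma>0\<^sup>2"
    and zeta_bounded: "\<And>n J j. J \<ge> 1 \<Longrightarrow> j \<in> grid J \<Longrightarrow> \<bar>\<zeta> n J j\<bar> \<le> z_bd"
    and lam_pos: "\<And>n J j. J \<ge> 1 \<Longrightarrow> j \<in> grid J \<Longrightarrow> 0 < lam n J j"
    and lam_bounds: "0 < lam_lo"
      "\<And>n J j. J \<ge> 1 \<Longrightarrow> j \<in> grid J \<Longrightarrow> lam_lo \<le> (lam n J j)\<^sup>2 \<and> (lam n J j)\<^sup>2 \<le> lam_hi"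
    and b_pos: "0 < b1" "0 < b2"
    and pi_positive_integers: "pmf \<pi> 0 = 0"
    and pi_tails: "\<And>J. J \<ge> 2 \<Longrightarrow>
        exp (- b2 * real J ^ CARD('d) * ln (real J)) \<le> pmf \<pi> J
        \<and> pmf \<pi> J \<le> exp (- b1 * real J ^ CARD('d) * ln (real J))"
  shows "\<exists>M1>0. \<forall>M0\<ge>M1.
    (\<forall>f0. f0 \<in> mono_fns \<and> bounded (f0 ` cbox 0 1) \<longrightarrow>
       (\<lambda>n. true_expectation G Q f0 n (mono_test G \<sigma>0 \<pi> \<zeta> lam \<gamma> M0 n)) \<longlonglongrightarrow> 0)
    \<and>
    (\<forall>f0. integrable (lebesgue_on (cbox 0 1)) f0 \<and> bounded (f0 ` cbox 0 1)
         \<and> f0 \<notin> L1_closure G mono_fns \<longrightarrow>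
       (\<lambda>n. true_expectation G Q f0 n (\<lambda>D. 1 - mono_test G \<sigma>0 \<pi> \<zeta> lam \<gamma> M0 n D)) \<longlonglongrightarrow> 0)
    \<and>
    (\<forall>\<alpha> L. 0 < \<alpha> \<and> \<alpha> \<le> 1 \<and> 0 < L \<longrightarrow>
       (\<exists>C0>0. \<forall>C\<ge>C0.
         (\<lambda>n. SUP f0 \<in> {f0 \<in> holder_class \<alpha> L.
                 hellinger_setdist G \<sigma>0 f0 mono_fns
                   > C * (real n / ln (real n)) powr (- \<alpha> / (2 * \<alpha> + real CARD('d)))}.
            ennreal (true_expectation G Q f0 n
              (\<lambda>D. 1 - mono_test G \<sigma>0 \<pi> \<zeta> lam \<gamma> M0 n D))) \<longlonglongrightarrow> 0))"
proof -
  interpret step_regression G g Q \<pi> \<zeta> lam \<sigma>0 g_lo g_hi b1 b2 z_bd lam_lo lam_hi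
    by (rule step_regression.intro) fact+
  have fixed: "(\<lambda>n. true_expectation G Q f0 n (\<lambda>D. 1 - mono_test G \<sigma>0 \<pi> \<zeta> lam \<gamma> M0 n D)) \<longlonglongrightarrow> 0"
    if "M0 \<ge> level_const" and f0: "integrable (lebesgue_on (cbox 0 1)) f0 \<and> bounded (f0 ` cbox 0 1) \<and> f0 \<notin> L1_closure G mono_fns"
    for M0 and f0 :: "real ^ 'd \<Rightarrow> real"
  proof -
    obtain K where K: "\<forall>x\<in>cbox 0 1. \<bar>f0 x\<bar> \<le> K" using f0 unfolding bounded_iff by auto
    have "f0 \<in> borel_measurable G"
      using f0 by (subst measurable_cong_sets[OF sets_G refl]) auto
    moreover have "\<forall>x\<in>cbox 0 1. \<bar>f0 x\<bar> \<le> \<bar>K\<bar>" using K by (auto intro: order.trans)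
    ultimately show ?thesis
      using that(1) f0 level_const_pos by (intro consistency_fixed_alternative[OF gamma(1)]) auto
  qed
  show ?thesis
  \<comment> \<open>The type I error fixes the threshold on \<open>M0\<close>. Against alternatives
    every positive \<open>M0\<close> works, and in the Hoelder claim the constant C0 may depend on
    \<open>M0\<close>, \<alpha> and L.\<close>
  proof (rule exI[of _ level_const], intro conjI allI impI)
    fix M0 \<alpha> L :: real assume "level_const \<le> M0" "0 < \<alpha> \<and> \<alpha> \<le> 1 \<and> 0 < L"
    then show "\<exists>C0>0. \<forall>C\<ge>C0. (\<lambda>n. SUP f0 \<in> {f0 \<in> holder_class \<alpha> L.
        hellinger_setdist G \<sigma>0 f0 mono_fns > C * (real n / ln (real n)) powr (- \<alpha> / (2 * \<alpha> + real CARD('d)))}.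
      ennreal (true_expectation G Q f0 n (\<lambda>D. 1 - mono_test G \<sigma>0 \<pi> \<zeta> lam \<gamma> M0 n D))) \<longlonglongrightarrow> 0"
      using level_const_pos by (intro consistency_holder_alternatives[OF gamma(1)]) auto
  qed (use level_const_pos level_of_test[OF gamma(2)] fixed in blast)+
qed

end
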